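(* Let $\omega$ be a radial weight, $X_1,Y_1\in\{H(\infty,1),H^1,D^1_0,HL(1)\}$ and $T\in\{H_\omega,\widetilde{H_\omega}\}$. Then the following statements are equivalent: (i) $T:X_1\to Y_1$ is bounded; (ii) $\omega\in\widehat{\mathcal{D}}$ and the measure $\mu_\omega$ supported on $[0,1)$ given by $d\mu_\omega(t)=\omega(t)\left(\int_0^t\frac{ds}{\widehat{\omega}(s)}\right)dt$ is a $1$-Carleson measure for $X_1$; (iii) $\omega\in\widehat{\mathcal{D}}$ and $$M_{1,c}(\omega)=\sup_{a\in[0,1)}\frac{1}{1-a}\int_a^1\omega(t)\left(\int_0^t\frac{ds}{\widehat{\omega}(s)}\right)dt<\infty;$$ (iv) $\omega\in\mathcal{D}$ and $M_{1,c}(\omega)<\infty$; (v) $\omega\in\widehat{\mathcal{D}}$ and $$M_{1,d}(\omega)=\sup_{a\in[0,1)}\frac{\widehat{\omega}(a)}{1-a}\left(\int_0^a\frac{ds}{\widehat{\omega}(s)}\right)<\infty;$$ (vi) $\omega\in\widehat{\mathcal{D}}$ and $$M_1(\omega)=\sup_{N\in\mathbb{N}}(N+1)\,\omega_{2N}\sum_{k=0}^N\frac{1}{(k+1)^2\omega_{2k}}<\infty.$$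
   Context: $\mathbb{D}$ is the open unit disc of $\mathbb{C}$, $\mathcal{H}(\mathbb{D})$ the space of analytic functions on $\mathbb{D}$, $dA=\frac{dx\,dy}{\pi}$, $\mathbb{N}=\{1,2,\dots\}$. Radial weights: a radial weight is a nonnegative $\omega\in L^1([0,1))$, extended to $\mathbb{D}$ by $\omega(z)=\omega(|z|)$; standing assumption: $\widehat{\omega}(r)=\int_r^1\omega(s)\,ds>0$ for all $0\le r<1$. Moments: $\omega_x=\int_0^1 r^x\omega(r)\,dr$, $x\ge0$. $\omega\in\widehat{\mathcal{D}}$ if there is $C>1$ with $\widehat{\omega}(r)\le C\,\widehat{\omega}(\frac{1+r}{2})$ for all $0\le r<1$. $\omega\in\check{\mathcal{D}}$ if there are $K>1$, $C>1$ with $\widehat{\omega}(r)\ge C\,\widehat{\omega}(1-\frac{1-r}{K})$ for all $0\le r<1$. $\mathcal{D}=\widehat{\mathcal{D}}\cap\check{\mathcal{D}}$. Operators: $B^\omega_z(\zeta)=\sum_{n\ge0}\frac{(\overline{z}\zeta)^n}{2\omega_{2n+1}}$ is the reproducing kernel of the Bergman space $A^2_\omega=\{f\in\mathcal{H}(\mathbb{D}):\int_{\mathbb{D}}|f|^2\omega\,dA<\infty\}$, and $$H_\omega(f)(z)=\int_0^1 f(t)\left(\frac1z\int_0^zB^\omega_t(\zeta)\,d\zeta\right)\omega(t)\,dt,\qquad \widetilde{H_\omega}(f)(z)=\int_0^1|f(t)|\left(\frac1z\int_0^zB^\omega_t(\zeta)\,d\zeta\right)\omega(t)\,dt.$$ $T:X\to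 Y$ is bounded if $T(f)$ is well defined and belongs to $Y$ for every $f\in X$, and $\sup_{\|f\|_X\le1}\|T(f)\|_Y<\infty$. Spaces (of $f(z)=\sum_{n\ge 0}\widehat f(n)z^n\in\mathcal{H}(\mathbb{D})$ with finite norm): $H^1$: $\|f\|_{H^1}=\sup_{0<r<1}\frac1{2\pi}\int_0^{2\pi}|f(re^{i\theta})|d\theta$; $D^1_0$: $\|f\|=|f(0)|+\int_{\mathbb{D}}|f'(z)|\,dA(z)$; $HL(1)$: $\|f\|=\sum_{n\ge0}|\widehat f(n)|(n+1)^{-1}$; $H(\infty,1)$: $\|f\|=\int_0^1M_\infty(r,f)\,dr$ with $M_\infty(r,f)=\max_\theta|f(re^{i\theta})|$. A positive Borel measure $\mu$ on $\mathbb{D}$ is a $1$-Carleson measure for $X$ if the identity operator $I_d:X\to L^1(\mu)$ is bounded. *)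

theory Defs
  imports "HOL-Complex_Analysis.Complex_Analysis"
begin

subsection \<open>Radial weights\<close>

(* Only the values of a weight on [0,1) matter. Since a weight is merely an L^1 function,
   integrals involving it are taken over the completed measure lebesgue; lborel is used
   where the integrand is continuous. *)

definition tail_int :: "(real \<Rightarrow> real) \<Rightarrow> real \<Rightarrow> real" where
  "tail_int \<omega> r = (LINT s:{r..<1}|lebesgue. \<omega> s)"

definition radial_weight :: "(real \<Rightarrow> real) \<Rightarrow> bool" where
  "radial_weight \<omega> \<longleftrightarrow>
     (\<forall>r\<in>{0..<1}. 0 \<le> \<omega> r) \<and> set_integrable lebesgue {0..<1} \<omega> \<and>
     (\<forall>r\<in>{0..<1}. 0 < tail_int \<omega> r)"

(* 0 powr 0 = 0 affects the moment of order 0 only on a null set. *)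
definition moment :: "(real \<Rightarrow> real) \<Rightarrow> real \<Rightarrow> real" where
  "moment \<omega> x = (LINT r:{0..<1}|lebesgue. r powr x * \<omega> r)"

definition Dhat :: "(real \<Rightarrow> real) set" where
  "Dhat = {\<omega>. radial_weight \<omega> \<and>
     (\<exists>C>1. \<forall>r\<in>{0..<1}. tail_int \<omega> r \<le> C * tail_int \<omega> ((1 + r) / 2))}"

definition Dcheck :: "(real \<Rightarrow> real) set" where
  "Dcheck = {\<omega>. radial_weight \<omega> \<and>
     (\<exists>K>1. \<exists>C>1. \<forall>r\<in>{0..<1}. tail_int \<omega> r \<ge> C * tail_int \<omega> (1 - (1 - r) / K))}"

definition Dreg :: "(real \<Rightarrow> real) set" where
  "Dreg = Dhat \<inter> Dcheck"


subsection \<open>Spaces of analytic functions and bounded operators\<close>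

(* A space is given by its extended-valued norm on H(D). *)
definition H_space :: "((complex \<Rightarrow> complex) \<Rightarrow> ennreal) \<Rightarrow> (complex \<Rightarrow> complex) set" where
  "H_space N = {f. f holomorphic_on ball 0 1 \<and> N f < \<infinity>}"

definition taylor_coeff :: "(complex \<Rightarrow> complex) \<Rightarrow> nat \<Rightarrow> complex" where
  "taylor_coeff f n = (deriv ^^ n) f 0 / fact n"

definition M_inf :: "real \<Rightarrow> (complex \<Rightarrow> complex) \<Rightarrow> real" where
  "M_inf r f = (SUP \<theta>\<in>{0..2 * pi}. cmod (f (rcis r \<theta>)))"

definition norm_H1 :: "(complex \<Rightarrow> complex) \<Rightarrow> ennreal" where
  "norm_H1 f = (SUP r\<in>{0<..<1}.
     ennreal (1 / (2 * pi)) * (\<integral>\<^sup>+\<theta>\<in>{0..2 * pi}. ennreal (cmod (f (rcis r \<theta>))) \<partial>lborel))"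

definition norm_D10 :: "(complex \<Rightarrow> complex) \<Rightarrow> ennreal" where
  "norm_D10 f = ennreal (cmod (f 0)) +
     ennreal (1 / pi) * (\<integral>\<^sup>+z\<in>ball 0 1. ennreal (cmod (deriv f z)) \<partial>lborel)"

definition norm_HL1 :: "(complex \<Rightarrow> complex) \<Rightarrow> ennreal" where
  "norm_HL1 f = (\<Sum>n. ennreal (cmod (taylor_coeff f n) / real (n + 1)))"

definition norm_Hinf1 :: "(complex \<Rightarrow> complex) \<Rightarrow> ennreal" where
  "norm_Hinf1 f = (\<integral>\<^sup>+r\<in>{0..<1}. ennreal (M_inf r f) \<partial>lborel)"

(* The operator is partial: the value None means that T f is not well defined. *)
definition bounded_op ::
  "('a \<Rightarrow> 'b option) \<Rightarrow> 'a set \<Rightarrow> ('a \<Rightarrow> ennreal) \<Rightarrow> 'b set \<Rightarrow> ('b \<Rightarrow> ennreal) \<Rightarrow> bool" where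
  "bounded_op T X NX Y NY \<longleftrightarrow>
     (\<forall>f\<in>X. \<exists>g\<in>Y. T f = Some g) \<and>
     (SUP f\<in>{f\<in>X. NX f \<le> 1}. NY (the (T f))) < \<infinity>"

definition carleson1 :: "complex measure \<Rightarrow> ((complex \<Rightarrow> complex) \<Rightarrow> ennreal) \<Rightarrow> bool" where
  "carleson1 \<mu> N \<longleftrightarrow>
     bounded_op Some (H_space N) N
       {f. integrable \<mu> f} (\<lambda>f. \<integral>\<^sup>+z. ennreal (cmod (f z)) \<partial>\<mu>)"


subsection \<open>The Hilbert-type operators\<close>

definition bergman_kernel :: "(real \<Rightarrow> real) \<Rightarrow> complex \<Rightarrow> complex \<Rightarrow> complex" where
  "bergman_kernel \<omega> z \<zeta> =
     (\<Sum>n. (cnj z * \<zeta>) ^ n / of_real (2 * moment \<omega> (2 * real n + 1)))"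

(* The singularity of the mean at z = 0 is removable. *)
definition mean_kernel :: "(real \<Rightarrow> real) \<Rightarrow> real \<Rightarrow> complex \<Rightarrow> complex" where
  "mean_kernel \<omega> t z =
     (if z = 0 then bergman_kernel \<omega> (of_real t) 0
      else 1 / z * contour_integral (linepath 0 z) (bergman_kernel \<omega> (of_real t)))"

(* Well defined means that the defining integral converges absolutely at every z in the disc. *)
definition kernel_op ::
  "(real \<Rightarrow> real) \<Rightarrow> (real \<Rightarrow> complex) \<Rightarrow> (complex \<Rightarrow> complex) option" where
  "kernel_op \<omega> g =
     (if \<forall>z\<in>ball 0 1. set_integrable lebesgue {0..<1} (\<lambda>t. g t * mean_kernel \<omega> t z * of_real (\<omega> t))
      then Some (\<lambda>z. LINT t:{0..<1}|lebesgue. g t * mean_kernel \<omega> t z * of_real (\<omega> t))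
      else None)"

definition H_op :: "(real \<Rightarrow> real) \<Rightarrow> (complex \<Rightarrow> complex) \<Rightarrow> (complex \<Rightarrow> complex) option" where
  "H_op \<omega> f = kernel_op \<omega> (\<lambda>t. f (of_real t))"

definition H_tilde_op :: "(real \<Rightarrow> real) \<Rightarrow> (complex \<Rightarrow> complex) \<Rightarrow> (complex \<Rightarrow> complex) option" where
  "H_tilde_op \<omega> f = kernel_op \<omega> (\<lambda>t. of_real (cmod (f (of_real t))))"


subsection \<open>The measure and the constants\<close>

definition inv_tail_int :: "(real \<Rightarrow> real) \<Rightarrow> real \<Rightarrow> real" where
  "inv_tail_int \<omega> t = (LINT s:{0..<t}|lebesgue. 1 / tail_int \<omega> s)"

definition mu_weight :: "(real \<Rightarrow> real) \<Rightarrow> complex measure" where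
  "mu_weight \<omega> =
     distr (density (restrict_space lebesgue {0..<1}) (\<lambda>t. ennreal (\<omega> t * inv_tail_int \<omega> t)))
       (restrict_space borel (ball 0 1)) complex_of_real"

definition M1c :: "(real \<Rightarrow> real) \<Rightarrow> ennreal" where
  "M1c \<omega> = (SUP a\<in>{0..<1}.
     ennreal (1 / (1 - a)) * (\<integral>\<^sup>+t\<in>{a..<1}. ennreal (\<omega> t * inv_tail_int \<omega> t) \<partial>lebesgue))"

definition M1d :: "(real \<Rightarrow> real) \<Rightarrow> ennreal" where
  "M1d \<omega> = (SUP a\<in>{0..<1}. ennreal (tail_int \<omega> a / (1 - a) * inv_tail_int \<omega> a))"

definition M1 :: "(real \<Rightarrow> real) \<Rightarrow> ennreal" where
  "M1 \<omega> = (SUP N\<in>{1::nat..}.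
     ennreal (real (N + 1) * moment \<omega> (2 * real N) *
       (\<Sum>k=0..N. 1 / (real (k + 1) ^ 2 * moment \<omega> (2 * real k)))))"

end

theory Submission
  imports Defs "HOL-Real_Asymp.Real_Asymp"
begin

text \<open>
  The norms satisfy \<open>H(\<infinity>,1) \<le> 8 N \<le> 64 D\<^sup>1\<^sub>0\<close> for each of the four norms \<open>N\<close>, so sixteen mapping
  properties reduce to two. If \<open>T\<close> is bounded from \<open>D\<^sup>1\<^sub>0\<close> to \<open>H(\<infinity>,1)\<close>, then the functions
  \<open>(1 - a\<^sup>2)\<^sup>2 (1 - a z)\<^sup>-\<^sup>3\<close> have images with nonnegative coefficients, and summing these gives an inequality between
  moments from which both the doubling condition and the bound on \<open>M\<^sub>1\<close> are read off. Conversely, the derivative of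
  the averaged kernel is \<open>t F(t z)\<close>, where \<open>F\<close> has the coefficients \<open>b\<^sub>n = (n + 1) / (2 (n + 2) \<omega>\<^bsub>2n+3\<^esub>)\<close>.
  Since \<open>b\<close> is regularly growing, Cauchy--Schwarz applied to \<open>F = ((1 - s w) F) (1 - s w)\<^sup>-\<^sup>1\<close> bounds its integral
  means on the circle of radius \<open>s\<close> by a multiple of \<open>1 / W s\<close>, where \<open>W\<close> is the tail of \<open>\<omega>\<close>. Integration in \<open>s\<close>
  bounds the \<open>D\<^sup>1\<^sub>0\<close> norm of the kernel at \<open>t\<close> by a multiple of \<open>\<integral>\<^sub>0\<^sup>t ds / W s\<close>, up to an additive constant, and
  the Carleson property of \<open>\<mu>\<^sub>\<omega>\<close> finishes the estimate from \<open>H(\<infinity>,1)\<close> to \<open>D\<^sup>1\<^sub>0\<close>. For doubling \<open>\<omega>\<close>, each of the three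
  constants is finite if and only if \<open>W a * (\<integral>\<^sub>0\<^sup>a ds / W s) \<le> M (1 - a)\<close> for some \<open>M\<close>.
\<close>

section \<open>Polar coordinates\<close>

text \<open>The test function at a = 1 - 1/N probes the moments of order about N, and the single
  inequality it yields carries two pieces of information: its terms with n <= N reproduce the sum in
  \<open>M1\<close>, while its terms with 12 N <= n < 13 N compare the moments of order 16 N and 24
  N, which iterates to doubling. So boundedness delivers both halves of the condition at once. In
  the converse direction the obstacle is the L^1 mean of F on the circle of radius s. Summing the
  moduli of its coefficients overshoots 1 / W s by a factor of order 1 / (1 - s), and
  Cauchy--Schwarz applied to F itself still overshoots by the square root of that. Multiplication by
  1 - s w replaces coefficients by differences, and regular growth makes these smaller by a factor
  of order 1 / (n + 1). The two L^2 norms then have orders (1 - s)^(1/2) / W s and (1 - s)^(-1/2),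
  whose product is right. The first of these orders is where the bound on W a times the integral of
  1 / W enters: it says that the sum of b_n s^n / (n + 1)^2 is at most a multiple of (1 - s) / W
  s.\<close>

lemma borel_measurable_Complex [measurable (raw)]:
  assumes [measurable]: "f \<in> borel_measurable M" "g \<in> borel_measurable M"
  shows "(\<lambda>x. Complex (f x) (g x)) \<in> borel_measurable M"
  unfolding Complex_eq by measurable

text \<open>Lebesgue measure is determined by its values on boxes, and a box with respect to the
  basis 1, \<i> is a product of two intervals. This opens area integrals to Tonelli's
  theorem.\<close>

lemma lborel_complex_eq:
  "(lborel :: complex measure) = distr (lborel \<Otimes>\<^sub>M lborel) borel (\<lambda>(x, y). Complex x y)"
proof (rule lborel_eqI)
  have m[measurable]: "(\<lambda>(x, y). Complex x y) \<in> borel_measurable (lborel \<Otimes>\<^sub>M lborel)"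
    by measurable
  fix l u :: complex assume le: "\<And>b. b \<in> Basis \<Longrightarrow> l \<bullet> b \<le> u \<bullet> b"
  have le': "Re l \<le> Re u" "Im l \<le> Im u"
    using le[of 1] le[of \<i>] by (auto simp: Basis_complex_def inner_complex_def)
  have "emeasure (distr (lborel \<Otimes>\<^sub>M lborel) borel (\<lambda>(x, y). Complex x y)) (box l u)
      = emeasure (lborel \<Otimes>\<^sub>M lborel) ({Re l<..<Re u} \<times> {Im l<..<Im u})"
    using m by (subst emeasure_distr)
       (auto intro!: arg_cong2[where f=emeasure] simp: box_def Basis_complex_def space_pair_measure inner_complex_def)
  also have "\<dots> = (\<Prod>b\<in>Basis. (u - l) \<bullet> b)"
    using le' by (subst lborel.emeasure_pair_measure_Times)
      (auto simp: Basis_complex_def inner_complex_def ennreal_mult)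
  finally show "emeasure (distr (lborel \<Otimes>\<^sub>M lborel) borel (\<lambda>(x, y). Complex x y)) (box l u)
      = (\<Prod>b\<in>Basis. (u - l) \<bullet> b)" .
qed simp

lemma nn_integral_lborel_complex:
  fixes h :: "complex \<Rightarrow> ennreal"
  assumes [measurable]: "h \<in> borel_measurable borel"
  shows "(\<integral>\<^sup>+z. h z \<partial>lborel) = (\<integral>\<^sup>+y. \<integral>\<^sup>+x. h (Complex x y) \<partial>lborel \<partial>lborel)"
  by (subst lborel_complex_eq, subst nn_integral_distr)
       (auto simp: case_prod_beta' lborel_pair.nn_integral_snd[symmetric])

text \<open>Monotone convergence along an exhaustion; it carries a substitution from compact
  intervals to the whole line.\<close>

lemma SUP_nn_integral_indicator:
  fixes f :: "'a \<Rightarrow> ennreal"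
  assumes [measurable]: "f \<in> borel_measurable M" "\<And>n. A n \<in> sets M" and "incseq A"
  shows "(SUP n. \<integral>\<^sup>+x. f x * indicator (A n) x \<partial>M) = (\<integral>\<^sup>+x. f x * indicator (\<Union>n. A n) x \<partial>M)"
proof -
  have "(SUP n. indicator (A n) x :: ennreal) = indicator (\<Union>n. A n) x" for x
    by (intro antisym SUP_least) (auto split: split_indicator intro!: SUP_upper2)
  hence "(\<integral>\<^sup>+x. f x * indicator (\<Union>n. A n) x \<partial>M) = (\<integral>\<^sup>+x. (SUP n. f x * indicator (A n) x) \<partial>M)"
    by (simp add: SUP_mult_left_ennreal[symmetric])
  also have "\<dots> = (SUP n. \<integral>\<^sup>+x. f x * indicator (A n) x \<partial>M)"
    using \<open>incseq A\<close>
    by (intro nn_integral_monotone_convergence_SUP)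
       (auto simp: incseq_def le_fun_def split: split_indicator)
  finally show ?thesis by simp
qed

text \<open>The substitution is made backwards, with \<open>arctan\<close> on compact intervals,
  because its derivative 1 / (1 + x^2) is continuous everywhere and cancels the weight.\<close>

lemma nn_integral_tan_substitution:
  fixes f :: "real \<Rightarrow> ennreal"
  assumes [measurable]: "f \<in> borel_measurable borel"
  shows "(\<integral>\<^sup>+u. f u \<partial>lborel) =
    (\<integral>\<^sup>+x. f (tan x) * ennreal (1 + (tan x)\<^sup>2) * indicator {- (pi/2)<..<pi/2} x \<partial>lborel)"
proof -
  let ?F = "\<lambda>x. f (tan x) * ennreal (1 + (tan x)\<^sup>2)"
  have [measurable]: "(tan :: real \<Rightarrow> real) \<in> borel_measurable borel"
    unfolding tan_def by measurable
  have *: "(\<integral>\<^sup>+x. ?F x * indicator {arctan (- real (Suc n))..arctan (real (Suc n))} x \<partial>lborel)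
      = (\<integral>\<^sup>+x. f x * indicator {- real (Suc n)..real (Suc n)} x \<partial>lborel)" for n
  proof (subst nn_integral_substitution_aux[where g = arctan and f = ?F and g' = "\<lambda>x. inverse (1 + x\<^sup>2)"])
    show "continuous_on {- real (Suc n)..real (Suc n)} (\<lambda>x. inverse (1 + x\<^sup>2))"
      by (intro continuous_intros) (auto simp: add_nonneg_eq_0_iff)
    have "ennreal (1 + x\<^sup>2) * ennreal (inverse (1 + x\<^sup>2)) = 1" for x :: real
      by (subst ennreal_mult[symmetric]) (auto simp: add_nonneg_eq_0_iff)
    thus "(\<integral>\<^sup>+x. ?F (arctan x) * ennreal (inverse (1 + x\<^sup>2)) * indicator {- real (Suc n)..real (Suc n)} x \<partial>lborel)
      = (\<integral>\<^sup>+x. f x * indicator {- real (Suc n)..real (Suc n)} x \<partial>lborel)"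
      by (intro nn_integral_cong) (simp add: tan_arctan mult.assoc)
  qed (auto intro!: derivative_eq_intros)
  have U1: "(\<Union>n. {- real (Suc n)..real (Suc n)}) = UNIV"
  proof -
    have "\<exists>n. x \<in> {- real (Suc n)..real (Suc n)}" for x
      using real_arch_simple[of "\<bar>x\<bar>"] by (metis abs_le_iff atLeastAtMost_iff le_SucI lift_Suc_mono_le neg_le_iff_le minus_le_iff of_nat_Suc of_nat_mono order_trans linorder_linear Suc_n_not_le_n of_nat_le_iff)
    thus ?thesis by auto
  qed
  have U2: "(\<Union>n. {arctan (- real (Suc n))..arctan (real (Suc n))}) = {- (pi/2)<..<pi/2}"
  proof safe
    fix n x assume "x \<in> {arctan (- real (Suc n))..arctan (real (Suc n))}"
    thus "x \<in> {- (pi/2)<..<pi/2}"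
      using arctan_bounded[of "real (Suc n)"] arctan_bounded[of "- real (Suc n)"] by auto
  next
    fix x assume x: "x \<in> {- (pi/2)<..<pi/2}"
    obtain n where "tan x \<in> {- real (Suc n)..real (Suc n)}" using U1 by blast
    hence "arctan (tan x) \<in> {arctan (- real (Suc n))..arctan (real (Suc n))}"
      by (simp only: atLeastAtMost_iff arctan_le_iff)
    moreover have "arctan (tan x) = x" using x by (intro arctan_tan) auto
    ultimately show "x \<in> (\<Union>n. {arctan (- real (Suc n))..arctan (real (Suc n))})" by auto
  qed
  have "(\<integral>\<^sup>+u. f u \<partial>lborel) = (SUP n. \<integral>\<^sup>+x. f x * indicator {- real (Suc n)..real (Suc n)} x \<partial>lborel)"
    by (subst SUP_nn_integral_indicator) (auto simp: U1 incseq_def simp del: of_nat_Suc)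
  also have "\<dots> = (SUP n. \<integral>\<^sup>+x. ?F x * indicator {arctan (- real (Suc n))..arctan (real (Suc n))} x \<partial>lborel)"
    by (simp only: *)
  also have "\<dots> = (\<integral>\<^sup>+x. ?F x * indicator {- (pi/2)<..<pi/2} x \<partial>lborel)"
    by (subst SUP_nn_integral_indicator, simp, simp, force simp: incseq_def arctan_le_iff simp del: of_nat_Suc)
       (simp only: U2)
  finally show ?thesis .
qed

lemma nn_integral_upper_half_plane_polar:
  fixes h :: "complex \<Rightarrow> ennreal"
  assumes [measurable]: "h \<in> borel_measurable borel"
  shows "(\<integral>\<^sup>+z. h z * indicator {z. Im z > 0} z \<partial>lborel) =
    (\<integral>\<^sup>+\<theta>. (\<integral>\<^sup>+r. h (rcis r \<theta>) * ennreal r * indicator {0<..} r \<partial>lborel) * indicator {0<..<pi} \<theta> \<partial>lborel)"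
proof -
  have "(\<integral>\<^sup>+z. h z * indicator {z. Im z > 0} z \<partial>lborel)
      = (\<integral>\<^sup>+y. (\<integral>\<^sup>+x. h (Complex x y) \<partial>lborel) * indicator {0<..} y \<partial>lborel)"
    by (subst nn_integral_lborel_complex)
       (auto intro!: nn_integral_cong simp: nn_integral_multc[symmetric] split: split_indicator)
  also have "\<dots> = (\<integral>\<^sup>+y. (\<integral>\<^sup>+u. h (Complex (y * u) y) * (ennreal y * indicator {0<..} y) \<partial>lborel) \<partial>lborel)"
  proof (intro nn_integral_cong)
    fix y :: real
    show "(\<integral>\<^sup>+x. h (Complex x y) \<partial>lborel) * indicator {0<..} y =
        (\<integral>\<^sup>+u. h (Complex (y * u) y) * (ennreal y * indicator {0<..} y) \<partial>lborel)"
    proof (cases "y > 0")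
      case True
      thus ?thesis
        by (subst nn_integral_real_affine[where c=y and t=0]) (auto simp: nn_integral_cmult[symmetric] mult_ac)
    qed auto
  qed
  also have "\<dots> = (\<integral>\<^sup>+u. (\<integral>\<^sup>+y. h (Complex (y * u) y) * (ennreal y * indicator {0<..} y) \<partial>lborel) \<partial>lborel)"
    by (rule lborel_pair.Fubini') measurable
  also have "\<dots> = (\<integral>\<^sup>+x. (\<integral>\<^sup>+y. h (Complex (y * tan x) y) * (ennreal y * indicator {0<..} y) \<partial>lborel)
        * ennreal (1 + (tan x)\<^sup>2) * indicator {- (pi/2)<..<pi/2} x \<partial>lborel)"
    by (subst nn_integral_tan_substitution) auto
  also have "\<dots> = (\<integral>\<^sup>+x. (\<integral>\<^sup>+r. h (rcis r (pi/2 - x)) * ennreal r * indicator {0<..} r \<partial>lborel)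
        * indicator {- (pi/2)<..<pi/2} x \<partial>lborel)"
  proof (intro nn_integral_cong)
    fix x :: real
    show "(\<integral>\<^sup>+y. h (Complex (y * tan x) y) * (ennreal y * indicator {0<..} y) \<partial>lborel)
        * ennreal (1 + (tan x)\<^sup>2) * indicator {- (pi/2)<..<pi/2} x
      = (\<integral>\<^sup>+r. h (rcis r (pi/2 - x)) * ennreal r * indicator {0<..} r \<partial>lborel)
        * indicator {- (pi/2)<..<pi/2} x"
    proof (cases "x \<in> {- (pi/2)<..<pi/2}")
      case True
      hence c: "cos x > 0" by (intro cos_gt_zero_pi) auto
      \<comment> \<open>The Jacobian factors of y = r cos x, x' = y u and u = tan x, namely cos x, r
        cos x and 1 + tan^2 x, multiply to r. Here the angle x is measured from the imaginary axis,
        so that the usual polar angle is pi/2 - x.\<close>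
      have e: "ennreal (cos x) * (ennreal (r * cos x) * ennreal (1 + (tan x)\<^sup>2)) = ennreal r" if "r > 0" for r
      proof -
        have "cos x * (r * cos x * (1 + (tan x)\<^sup>2)) = r"
          using c sin_squared_eq[of x] by (simp add: tan_def field_simps power2_eq_square)
        moreover have "0 \<le> cos x" "0 \<le> r * cos x" "0 \<le> 1 + (tan x)\<^sup>2" "0 \<le> r * cos x * (1 + (tan x)\<^sup>2)"
          using that c by (auto intro!: mult_nonneg_nonneg add_nonneg_nonneg)
        ultimately show ?thesis by (metis ennreal_mult)
      qed
      have pt: "Complex (r * cos x * tan x) (r * cos x) = rcis r (pi/2 - x)" for r
        using c by (simp add: complex_eq_iff cos_diff sin_diff tan_def)
      have "(\<integral>\<^sup>+y. h (Complex (y * tan x) y) * (ennreal y * indicator {0<..} y) \<partial>lborel) * ennreal (1 + (tan x)\<^sup>2)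
        = (\<integral>\<^sup>+y. h (Complex (y * tan x) y) * (ennreal y * indicator {0<..} y) * ennreal (1 + (tan x)\<^sup>2) \<partial>lborel)"
        by (subst nn_integral_multc) auto
      also have "\<dots> = ennreal (cos x) * (\<integral>\<^sup>+r. h (Complex (r * cos x * tan x) (r * cos x)) *
           (ennreal (r * cos x) * indicator {0<..} (r * cos x)) * ennreal (1 + (tan x)\<^sup>2) \<partial>lborel)"
        using c by (subst nn_integral_real_affine[where c="cos x" and t=0]) (auto simp: mult_ac)
      also have "\<dots> = (\<integral>\<^sup>+r. h (rcis r (pi/2 - x)) * ennreal r * indicator {0<..} r \<partial>lborel)"
        unfolding pt
      proof (subst nn_integral_cmult[symmetric])
        have [measurable]: "(\<lambda>r. rcis r (pi/2 - x)) \<in> borel_measurable borel"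
          unfolding rcis_def by measurable
        show "(\<lambda>r. h (rcis r (pi/2 - x)) * (ennreal (r * cos x) * indicator {0<..} (r * cos x)) * ennreal (1 + (tan x)\<^sup>2))
            \<in> borel_measurable lborel"
          by measurable
        show "(\<integral>\<^sup>+r. ennreal (cos x) * (h (rcis r (pi/2 - x)) * (ennreal (r * cos x) * indicator {0<..} (r * cos x)) * ennreal (1 + (tan x)\<^sup>2)) \<partial>lborel)
          = (\<integral>\<^sup>+r. h (rcis r (pi/2 - x)) * ennreal r * indicator {0<..} r \<partial>lborel)"
        proof (rule nn_integral_cong)
          fix r :: real
          show "ennreal (cos x) * (h (rcis r (pi/2 - x)) * (ennreal (r * cos x) * indicator {0<..} (r * cos x)) * ennreal (1 + (tan x)\<^sup>2))
            = h (rcis r (pi/2 - x)) * ennreal r * indicator {0<..} r"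
          proof (cases "r > 0")
            case True
            hence "ennreal (cos x) * (h (rcis r (pi/2 - x)) * (ennreal (r * cos x) * indicator {0<..} (r * cos x)) * ennreal (1 + (tan x)\<^sup>2))
               = h (rcis r (pi/2 - x)) * (ennreal (cos x) * (ennreal (r * cos x) * ennreal (1 + (tan x)\<^sup>2)))"
              using c by (simp only: mult_ac indicator_simps greaterThan_iff mult_pos_pos mult_1_left)
            thus ?thesis using True e by simp
          next
            case False
            thus ?thesis using c by (auto simp: zero_less_mult_iff)
          qed
        qed
      qed
      finally show ?thesis using True by simp
    qed simp
  qed
  also have "\<dots> = (\<integral>\<^sup>+\<theta>. (\<integral>\<^sup>+r. h (rcis r \<theta>) * ennreal r * indicator {0<..} r \<partial>lborel) * indicator {0<..<pi} \<theta> \<partial>lborel)"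
    unfolding rcis_def cis_conv_exp
    by (subst nn_integral_real_affine[where c="-1" and t="pi/2"])
       (auto intro!: nn_integral_cong split: split_indicator)
  finally show ?thesis .
qed

lemma rcis_add_pi: "rcis r (\<theta> + pi) = - rcis r \<theta>"
  by (simp add: complex_eq_iff)

text \<open>The half plane and not the whole plane is parametrised first because it reduces polar
  coordinates to the one-dimensional substitutions \<open>x = y tan \<phi>\<close> and \<open>y = r cos \<phi>\<close>.\<close>

theorem nn_integral_polar:
  fixes h :: "complex \<Rightarrow> ennreal"
  assumes [measurable]: "h \<in> borel_measurable borel"
  shows "(\<integral>\<^sup>+z. h z \<partial>lborel) =
    (\<integral>\<^sup>+r. ennreal r * (\<integral>\<^sup>+\<theta>. h (rcis r \<theta>) * indicator {0..2*pi} \<theta> \<partial>lborel) * indicator {0<..} r \<partial>lborel)"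
proof -
  define g where "g \<theta> = (\<integral>\<^sup>+r. h (rcis r \<theta>) * ennreal r * indicator {0<..} r \<partial>lborel)" for \<theta>
  have mr[measurable]: "(\<lambda>p. rcis (fst p) (snd p)) \<in> borel_measurable (borel \<Otimes>\<^sub>M borel)"
    "(\<lambda>p. rcis (snd p) (fst p)) \<in> borel_measurable (borel \<Otimes>\<^sub>M borel)"
    "(\<lambda>\<theta>. rcis r \<theta>) \<in> borel_measurable borel" "(\<lambda>r. rcis r \<theta>) \<in> borel_measurable borel" for r \<theta>
    unfolding rcis_def cis_conv_exp by measurable
  have [measurable]: "g \<in> borel_measurable borel"
    unfolding g_def by measurable
  \<comment> \<open>The reflection z to -z turns the lower half plane into the upper one and shifts
    the angle by pi; the real axis in between is a null set.\<close>
  have neg: "(\<integral>\<^sup>+z. k z \<partial>lborel) = (\<integral>\<^sup>+z. k (- z) \<partial>lborel)"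
    if [measurable]: "k \<in> borel_measurable borel" for k :: "complex \<Rightarrow> ennreal"
    by (subst lborel_affine[of "-1" "0::complex"])
       (auto simp: nn_integral_distr nn_integral_density)
  have "(\<integral>\<^sup>+z. h z * indicator {z. Im z < 0} z \<partial>lborel) = (\<integral>\<^sup>+z. h (- z) * indicator {z. Im z > 0} z \<partial>lborel)"
    by (subst neg) (auto intro!: nn_integral_cong split: split_indicator)
  also have "\<dots> = (\<integral>\<^sup>+\<theta>. g (\<theta> + pi) * indicator {0<..<pi} \<theta> \<partial>lborel)"
    by (subst nn_integral_upper_half_plane_polar) (auto simp: g_def rcis_add_pi)
  also have "\<dots> = (\<integral>\<^sup>+\<theta>. g \<theta> * indicator {pi<..<2*pi} \<theta> \<partial>lborel)"
    by (subst (2) nn_integral_real_affine[where c=1 and t=pi])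
       (auto intro!: nn_integral_cong simp: add_ac split: split_indicator)
  finally have low: "(\<integral>\<^sup>+z. h z * indicator {z. Im z < 0} z \<partial>lborel) = \<dots>" .
  have up: "(\<integral>\<^sup>+z. h z * indicator {z. Im z > 0} z \<partial>lborel) = (\<integral>\<^sup>+\<theta>. g \<theta> * indicator {0<..<pi} \<theta> \<partial>lborel)"
    by (subst nn_integral_upper_half_plane_polar) (auto simp: g_def)
  have null: "AE z in lborel. Im z \<noteq> (0::real)"
  proof -
    have "emeasure lborel {z. Im z = 0} = (\<integral>\<^sup>+z. indicator {z. Im z = 0} z \<partial>lborel)"
      by simp
    also have "\<dots> = (\<integral>\<^sup>+y. (\<integral>\<^sup>+x. indicator {0::real} y \<partial>(lborel :: real measure)) \<partial>lborel)"
      by (subst nn_integral_lborel_complex) (auto intro!: nn_integral_cong split: split_indicator)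
    also have "\<dots> = 0"
      by (subst nn_integral_0_iff_AE) (auto intro: AE_mp[OF AE_lborel_singleton[of 0]])
    finally have "{z. Im z = 0} \<in> null_sets lborel" by (simp add: null_sets_def)
    thus ?thesis by (intro AE_I'[where N = "{z. Im z = 0}"]) auto
  qed
  have "(\<integral>\<^sup>+z. h z \<partial>lborel) = (\<integral>\<^sup>+z. h z * indicator {z. Im z > 0} z + h z * indicator {z. Im z < 0} z \<partial>lborel)"
    by (rule nn_integral_cong_AE) (use null in eventually_elim, auto split: split_indicator)
  also have "\<dots> = (\<integral>\<^sup>+\<theta>. g \<theta> * indicator {0<..<pi} \<theta> + g \<theta> * indicator {pi<..<2*pi} \<theta> \<partial>lborel)"
    by (subst nn_integral_add, simp, simp, subst nn_integral_add) (auto simp: up low)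
  also have "\<dots> = (\<integral>\<^sup>+\<theta>. g \<theta> * indicator {0..2*pi} \<theta> \<partial>lborel)"
    by (rule nn_integral_cong_AE)
       (use AE_lborel_singleton[of 0] AE_lborel_singleton[of pi] AE_lborel_singleton[of "2*pi"] in eventually_elim,
        auto split: split_indicator)
  also have "\<dots> = (\<integral>\<^sup>+\<theta>. \<integral>\<^sup>+r. h (rcis r \<theta>) * ennreal r * indicator {0<..} r * indicator {0..2*pi} \<theta> \<partial>lborel \<partial>lborel)"
    unfolding g_def by (subst nn_integral_multc) auto
  also have "\<dots> = (\<integral>\<^sup>+r. \<integral>\<^sup>+\<theta>. h (rcis r \<theta>) * ennreal r * indicator {0<..} r * indicator {0..2*pi} \<theta> \<partial>lborel \<partial>lborel)"
    by (rule lborel_pair.Fubini') measurable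
  also have "\<dots> = (\<integral>\<^sup>+r. ennreal r * (\<integral>\<^sup>+\<theta>. h (rcis r \<theta>) * indicator {0..2*pi} \<theta> \<partial>lborel) * indicator {0<..} r \<partial>lborel)"
    by (auto intro!: nn_integral_cong simp: nn_integral_cmult[symmetric] mult_ac split: split_indicator)
  finally show ?thesis .
qed

text \<open>Measurability is asked only of the function cut off to the disc, since a function
  holomorphic there has arbitrary values elsewhere.\<close>

corollary nn_integral_polar_ball:
  fixes h :: "complex \<Rightarrow> ennreal"
  assumes "(\<lambda>z. h z * indicator (ball 0 1) z) \<in> borel_measurable borel"
  shows "(\<integral>\<^sup>+z\<in>ball 0 1. h z \<partial>lborel) =
    (\<integral>\<^sup>+r\<in>{0<..<1}. ennreal r * (\<integral>\<^sup>+\<theta>\<in>{0..2*pi}. h (rcis r \<theta>) \<partial>lborel) \<partial>lborel)"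
  by (subst nn_integral_polar[OF assms]) (auto intro!: nn_integral_cong split: split_indicator)

section \<open>Trigonometric series\<close>

abbreviation circ :: "real measure" where
  "circ \<equiv> restrict_space lborel {0..2*pi}"

lemma finite_measure_circ [simp]: "finite_measure circ"
  by (intro finite_measureI) (simp add: emeasure_restrict_space space_restrict_space)

lemma borel_measurable_cis [measurable]: "(\<lambda>x. cis x) \<in> borel_measurable borel"
  unfolding cis_conv_exp by measurable

lemma borel_measurable_cnj [measurable]: "cnj \<in> borel_measurable borel"
  by (intro borel_measurable_continuous_onI continuous_intros)

lemma circ_borel_measurable: "f \<in> borel_measurable borel \<Longrightarrow> f \<in> borel_measurable circ"
  by (simp add: measurable_restrict_space1)

lemma integral_circ: "integral\<^sup>L circ f = (LINT x:{0..2*pi}|lborel. f x)" for f :: "real \<Rightarrow> 'a :: {banach, second_countable_topology}"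
  by (subst integral_restrict_space) (auto simp: set_lebesgue_integral_def)

lemma integral_circ_cis: "integral\<^sup>L circ (\<lambda>x. cis (of_int k * x)) = (if k = 0 then of_real (2*pi) else 0)"
proof (cases "k = 0")
  case True
  thus ?thesis by (simp add: measure_restrict_space scaleR_conv_of_real)
next
  case False
  have "((\<lambda>x. cis (of_int k * x) / (\<i> * of_int k)) has_vector_derivative cis (of_int k * x)) (at x within A)" for x A
    unfolding cis_conv_exp has_vector_derivative_complex_iff using False
    by (auto intro!: derivative_eq_intros simp: Re_exp Im_exp field_simps Re_divide Im_divide power2_eq_square)
  hence "integral\<^sup>L lborel (\<lambda>x. indicator {0..2*pi} x *\<^sub>R cis (of_int k * x))
      = cis (of_int k * (2*pi)) / (\<i> * of_int k) - cis (of_int k * 0) / (\<i> * of_int k)"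
    by (intro integral_FTC_atLeastAtMost continuous_intros) auto
  also have "cis (of_int k * (2*pi)) = 1"
    using cis_multiple_2pi[of "of_int k"] by (simp add: mult_ac)
  finally show ?thesis using False by (simp add: integral_circ set_lebesgue_integral_def)
qed

text \<open>A power series on a circle, with the radius absorbed into the coefficients; absolute
  summability of \<open>a\<close> then is all that the L^2 theory needs.\<close>

definition trig_series :: "(nat \<Rightarrow> complex) \<Rightarrow> real \<Rightarrow> complex" where
  "trig_series a \<theta> = (\<Sum>n. a n * cis \<theta> ^ n)"

context
  fixes a :: "nat \<Rightarrow> complex"
  assumes sa: "summable (\<lambda>n. norm (a n))"
begin

lemma summable_norm_trig: "summable (\<lambda>n. norm (a n * cis \<theta> ^ n))"
  using sa by (simp add: norm_mult norm_power)

lemma trig_series_sums: "(\<lambda>n. a n * cis \<theta> ^ n) sums trig_series a \<theta>"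
  unfolding trig_series_def using summable_norm_cancel[OF summable_norm_trig] by (rule summable_sums)

lemma norm_trig_series_le: "norm (trig_series a \<theta>) \<le> (\<Sum>n. norm (a n))"
  unfolding trig_series_def
  by (rule order.trans[OF summable_norm[OF summable_norm_trig]]) (simp add: norm_mult norm_power)

lemma trig_series_borel [measurable]: "trig_series a \<in> borel_measurable borel"
  unfolding trig_series_def by measurable

text \<open>Termwise integration by absolute summability. With \<open>g\<close> a conjugate power of
  \<open>cis\<close> it extracts a coefficient, and with \<open>g\<close> the conjugate of the
  series itself it gives Parseval's identity.\<close>

lemma integral_trig_series_times:
  assumes [measurable]: "g \<in> borel_measurable borel" and g: "\<And>x. norm (g x) \<le> B"
  shows "(\<lambda>n. a n * integral\<^sup>L circ (\<lambda>x. cis x ^ n * g x)) sums integral\<^sup>L circ (\<lambda>x. trig_series a x * g x)"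
proof -
  interpret finite_measure circ by simp
  have m[measurable]: "(\<lambda>x. a n * cis x ^ n * g x) \<in> borel_measurable circ" for n
    by (intro circ_borel_measurable) measurable
  have B: "0 \<le> B" using norm_ge_zero[of "g 0"] g[of 0] by linarith
  have le: "norm (a n * cis x ^ n * g x) \<le> norm (a n) * B" for n x
    using g[of x] by (simp add: norm_mult norm_power mult_left_mono)
  have int: "integrable circ (\<lambda>x. a n * cis x ^ n * g x)" for n
    using le by (intro integrable_const_bound[where B="norm (a n) * B"]) auto
  have "(\<lambda>n. integral\<^sup>L circ (\<lambda>x. a n * cis x ^ n * g x)) sums integral\<^sup>L circ (\<lambda>x. \<Sum>n. a n * cis x ^ n * g x)"
  proof (rule sums_integral[OF int])
    show "AE x in circ. summable (\<lambda>n. norm (a n * cis x ^ n * g x))"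
    proof (rule AE_I2)
      fix x
      show "summable (\<lambda>n. norm (a n * cis x ^ n * g x))"
        by (rule summable_comparison_test'[OF summable_mult2[OF sa, of B], of 0]) (simp add: le)
    qed
    have "norm (LINT x|circ. norm (a n * cis x ^ n * g x)) \<le> norm (a n) * (B * measure circ (space circ))" for n
    proof -
      have "norm (LINT x|circ. norm (a n * cis x ^ n * g x)) \<le> (LINT x|circ. norm (a n) * B)"
        using integral_norm_bound[of circ "\<lambda>x. norm (a n * cis x ^ n * g x)"]
          integral_mono[OF integrable_norm[OF int, of n] integrable_const, of "norm (a n) * B"] le
        by (auto intro: order.trans)
      thus ?thesis by (simp add: mult_ac)
    qed
    thus "summable (\<lambda>n. LINT x|circ. norm (a n * cis x ^ n * g x))"
      by (intro summable_comparison_test'[OF summable_mult2[OF sa, of "B * measure circ (space circ)"], of 0])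
  qed
  moreover have "(\<Sum>n. a n * cis x ^ n * g x) = trig_series a x * g x" for x
    using trig_series_sums[of x] sums_mult2 sums_unique by metis
  moreover have "integral\<^sup>L circ (\<lambda>x. a n * cis x ^ n * g x) = a n * integral\<^sup>L circ (\<lambda>x. cis x ^ n * g x)" for n
    by (simp add: mult.assoc)
  ultimately show ?thesis by simp
qed

lemma integral_trig_series_coeff:
  "integral\<^sup>L circ (\<lambda>x. trig_series a x * cnj (cis x ^ m)) = 2 * pi * a m"
proof -
  have e: "cis x ^ n * cnj (cis x ^ m) = cis (of_int (int n - int m) * x)" for n x
  proof -
    have "cis x ^ n * cnj (cis x ^ m) = cis (real n * x) * cis (- (real m * x))"
      by (simp only: Complex.DeMoivre cis_cnj)
    thus ?thesis by (simp add: cis_mult left_diff_distrib)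
  qed
  have i: "integral\<^sup>L circ (\<lambda>x. cis x ^ n * cnj (cis x ^ m)) = (if n = m then of_real (2*pi) else 0)" for n
    unfolding e by (subst integral_circ_cis) auto
  have "(\<lambda>n. a n * integral\<^sup>L circ (\<lambda>x. cis x ^ n * cnj (cis x ^ m))) sums
      integral\<^sup>L circ (\<lambda>x. trig_series a x * cnj (cis x ^ m))"
    by (rule integral_trig_series_times[where B=1]) (auto simp: norm_power)
  hence "(\<lambda>n. if n = m then a n * of_real (2*pi) else 0) sums
      integral\<^sup>L circ (\<lambda>x. trig_series a x * cnj (cis x ^ m))"
    unfolding i by (simp add: if_distrib cong: if_cong)
  thus ?thesis using sums_single[of m "\<lambda>n. a n * of_real (2*pi)"] sums_unique2 by fastforce
qed

lemma integrable_trig_series: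
  assumes [measurable]: "g \<in> borel_measurable borel" and g: "\<And>x. norm (g x) \<le> B"
  shows "integrable circ (\<lambda>x. trig_series a x * g x)"
proof -
  interpret finite_measure circ by simp
  have "norm (trig_series a x * g x) \<le> (\<Sum>n. norm (a n)) * B" for x
    unfolding norm_mult by (intro mult_mono norm_trig_series_le g suminf_nonneg sa) auto
  thus ?thesis
    by (intro integrable_const_bound[where B="(\<Sum>n. norm (a n)) * B"] circ_borel_measurable) auto
qed

lemma summable_norm_square: "summable (\<lambda>n. (norm (a n))\<^sup>2)"
proof (rule summable_comparison_test_ev[OF _ sa])
  have "eventually (\<lambda>n. norm (a n) < 1) sequentially"
    using order_tendstoD(2)[OF summable_LIMSEQ_zero[OF sa], of 1] by simp
  thus "\<forall>\<^sub>F n in sequentially. norm ((norm (a n))\<^sup>2) \<le> norm (a n)"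
    by eventually_elim (auto simp: power2_eq_square mult_left_le)
qed

theorem parseval:
  "(\<integral>\<^sup>+\<theta>\<in>{0..2*pi}. ennreal ((norm (trig_series a \<theta>))\<^sup>2) \<partial>lborel) = ennreal (2 * pi * (\<Sum>n. (norm (a n))\<^sup>2))"
proof -
  let ?g = "\<lambda>x. cnj (trig_series a x)"
  have bg: "norm (?g x) \<le> (\<Sum>n. norm (a n))" for x by (simp add: norm_trig_series_le)
  have "integral\<^sup>L circ (\<lambda>x. cis x ^ n * ?g x) = 2 * pi * cnj (a n)" for n
  proof -
    have "integral\<^sup>L circ (\<lambda>x. cis x ^ n * ?g x) = integral\<^sup>L circ (\<lambda>x. cnj (trig_series a x * cnj (cis x ^ n)))"
      by (simp add: mult.commute)
    also have "\<dots> = cnj (integral\<^sup>L circ (\<lambda>x. trig_series a x * cnj (cis x ^ n)))"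
      by (rule Bochner_Integration.integral_cnj)
    also have "\<dots> = cnj (2 * pi * a n)" by (simp only: integral_trig_series_coeff)
    finally show ?thesis by simp
  qed
  hence "(\<lambda>n. a n * (2 * pi * cnj (a n))) sums integral\<^sup>L circ (\<lambda>x. trig_series a x * ?g x)"
    using integral_trig_series_times[of ?g, OF _ bg] by simp
  moreover have "a n * (2 * pi * cnj (a n)) = of_real (2 * pi * (norm (a n))\<^sup>2)" for n
    by (simp add: complex_norm_square[symmetric] mult_ac del: of_real_power)
  moreover have e: "trig_series a x * ?g x = of_real ((norm (trig_series a x))\<^sup>2)" for x
    by (simp only: complex_norm_square[symmetric])
  ultimately have "(\<lambda>n. of_real (2 * pi * (norm (a n))\<^sup>2) :: complex) sums of_real (integral\<^sup>L circ (\<lambda>x. (norm (trig_series a x))\<^sup>2))"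
    by (simp only: integral_complex_of_real)
  hence "(\<lambda>n. 2 * pi * (norm (a n))\<^sup>2) sums integral\<^sup>L circ (\<lambda>x. (norm (trig_series a x))\<^sup>2)"
    by (simp only: sums_of_real_iff)
  moreover have "(\<lambda>n. 2 * pi * (norm (a n))\<^sup>2) sums (2 * pi * (\<Sum>n. (norm (a n))\<^sup>2))"
    using summable_norm_square by (intro sums_mult summable_sums)
  ultimately have "integral\<^sup>L circ (\<lambda>x. (norm (trig_series a x))\<^sup>2) = 2 * pi * (\<Sum>n. (norm (a n))\<^sup>2)"
    using sums_unique2 by blast
  moreover have "integrable circ (\<lambda>x. (norm (trig_series a x))\<^sup>2)"
  proof -
    have "complex_integrable circ (\<lambda>x. trig_series a x * ?g x)"
      by (rule integrable_trig_series[OF _ bg]) simp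
    thus ?thesis by (simp only: e complex_of_real_integrable_eq)
  qed
  ultimately have "(\<integral>\<^sup>+x. ennreal ((norm (trig_series a x))\<^sup>2) \<partial>circ) = ennreal (2 * pi * (\<Sum>n. (norm (a n))\<^sup>2))"
    by (subst nn_integral_eq_integral) auto
  thus ?thesis by (subst (asm) nn_integral_restrict_space) auto
qed

lemma coeff_le_nn_integral_trig_series:
  "ennreal (2 * pi * norm (a m)) \<le> (\<integral>\<^sup>+\<theta>\<in>{0..2*pi}. ennreal (norm (trig_series a \<theta>)) \<partial>lborel)"
proof -
  have "ennreal (norm (integral\<^sup>L circ (\<lambda>x. trig_series a x * cnj (cis x ^ m)))) \<le>
      (\<integral>\<^sup>+x. ennreal (norm (trig_series a x * cnj (cis x ^ m))) \<partial>circ)"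
    by (intro integral_norm_bound_ennreal integrable_trig_series[where B=1]) (auto simp: norm_power)
  also have "\<dots> = (\<integral>\<^sup>+\<theta>\<in>{0..2*pi}. ennreal (norm (trig_series a \<theta>)) \<partial>lborel)"
    by (subst nn_integral_restrict_space) (auto simp: norm_mult norm_power)
  finally show ?thesis by (simp only: integral_trig_series_coeff norm_mult norm_of_real) simp
qed

end

lemma trig_series_geometric:
  assumes "norm z < 1"
  shows "trig_series (\<lambda>n. z ^ n) \<theta> = 1 / (1 - z * cis \<theta>)"
  unfolding trig_series_def
  using assms by (simp add: power_mult_distrib[symmetric] suminf_geometric norm_mult)

text \<open>Cauchy--Schwarz for the factorisation \<open>A = ((1 - s w) A) (1 - s w)\<^sup>-\<^sup>1\<close>,
  in the form \<open>2 x y \<le> \<lambda> x\<^sup>2 + y\<^sup>2 / \<lambda>\<close>: it trades an \<open>L\<^sup>1\<close> mean for an \<open>\<ell>\<^sup>2\<close> norm of differences of coefficients.\<close>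

lemma nn_integral_trig_series_le_differences:
  fixes a :: "nat \<Rightarrow> complex" and s c :: real
  assumes sa: "summable (\<lambda>n. norm (a n))" and s: "0 \<le> s" "s < 1" and c: "c > 0"
  defines "d \<equiv> (\<lambda>n. a n - (if n = 0 then 0 else s * a (n - 1)))"
  shows "(\<integral>\<^sup>+\<theta>\<in>{0..2*pi}. ennreal (norm (trig_series a \<theta>)) \<partial>lborel) \<le>
           ennreal (pi * (c * (\<Sum>n. (norm (d n))\<^sup>2) + 1 / (c * (1 - s))))"
proof -
  let ?e = "\<lambda>n. complex_of_real s ^ n"
  have sS: "summable (\<lambda>n. norm (a (Suc n)))" using sa by (subst summable_Suc_iff)
  have sd: "summable (\<lambda>n. norm (d n))"
  proof (subst summable_Suc_iff[symmetric], rule summable_comparison_test')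
    show "summable (\<lambda>n. norm (a (Suc n)) + s * norm (a n))"
      by (intro summable_add sS summable_mult sa)
    show "norm (norm (d (Suc n))) \<le> norm (a (Suc n)) + s * norm (a n)" for n
      using norm_triangle_ineq4[of "a (Suc n)" "s * a n"] s by (simp add: d_def norm_mult)
  qed
  have se: "summable (\<lambda>n. norm (?e n))" using s by (simp add: norm_power summable_geometric)
  have fac: "trig_series a \<theta> = trig_series d \<theta> * trig_series ?e \<theta>" for \<theta>
  proof -
    let ?w = "cis \<theta>"
    have ne: "1 - s * ?w \<noteq> 0"
    proof
      assume "1 - s * ?w = 0"
      hence "norm (s * ?w) = 1" by (metis eq_iff_diff_eq_0 norm_one)
      thus False using s by (simp add: norm_mult)
    qed
    have A: "(\<lambda>n. a n * ?w ^ n) sums trig_series a \<theta>" by (rule trig_series_sums[OF sa])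
    hence "(\<lambda>n. s * ?w * (a n * ?w ^ n)) sums (s * ?w * trig_series a \<theta>)" by (rule sums_mult)
    hence "(\<lambda>n. if n = 0 then 0 else s * ?w * (a (n - 1) * ?w ^ (n - 1))) sums (s * ?w * trig_series a \<theta>)"
      using sums_Suc[of "\<lambda>n. if n = 0 then 0 else s * ?w * (a (n - 1) * ?w ^ (n - 1))"] by simp
    from sums_diff[OF A this]
    have "(\<lambda>n. a n * ?w ^ n - (if n = 0 then 0 else s * ?w * (a (n - 1) * ?w ^ (n - 1)))) sums
        (trig_series a \<theta> - s * ?w * trig_series a \<theta>)" .
    moreover have "a n * ?w ^ n - (if n = 0 then 0 else s * ?w * (a (n - 1) * ?w ^ (n - 1))) = d n * ?w ^ n" for n
      by (cases n) (auto simp: d_def algebra_simps)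
    ultimately have "(\<lambda>n. d n * ?w ^ n) sums (trig_series a \<theta> - s * ?w * trig_series a \<theta>)"
      by simp
    hence "trig_series d \<theta> = trig_series a \<theta> * (1 - s * ?w)"
      using sums_unique2[OF trig_series_sums[OF sd, of \<theta>]] by (simp add: algebra_simps)
    thus ?thesis using ne s by (subst trig_series_geometric) auto
  qed
  have "ennreal (norm (trig_series a \<theta>)) \<le> ennreal (c / 2) * ennreal ((norm (trig_series d \<theta>))\<^sup>2)
      + ennreal (1 / (2 * c)) * ennreal ((norm (trig_series ?e \<theta>))\<^sup>2)" for \<theta>
  proof -
    have "x * y \<le> c / 2 * x\<^sup>2 + 1 / (2 * c) * y\<^sup>2" for x y :: real
    proof -
      have "0 \<le> (c * x - y)\<^sup>2 / (2 * c)" using c by simp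
      also have "\<dots> = c / 2 * x\<^sup>2 + 1 / (2 * c) * y\<^sup>2 - x * y"
        using c by (simp add: power2_eq_square field_simps)
      finally show ?thesis by simp
    qed
    thus ?thesis using c
      by (simp add: fac norm_mult ennreal_mult[symmetric] ennreal_plus[symmetric] del: ennreal_plus)
  qed
  hence "(\<integral>\<^sup>+\<theta>\<in>{0..2*pi}. ennreal (norm (trig_series a \<theta>)) \<partial>lborel) \<le>
    (\<integral>\<^sup>+\<theta>. ennreal (c / 2) * (ennreal ((norm (trig_series d \<theta>))\<^sup>2) * indicator {0..2*pi} \<theta>)
      + ennreal (1 / (2 * c)) * (ennreal ((norm (trig_series ?e \<theta>))\<^sup>2) * indicator {0..2*pi} \<theta>) \<partial>lborel)"
    by (intro nn_integral_mono) (auto split: split_indicator)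
  also have "\<dots> = ennreal (c / 2) * ennreal (2 * pi * (\<Sum>n. (norm (d n))\<^sup>2))
      + ennreal (1 / (2 * c)) * ennreal (2 * pi * (\<Sum>n. (norm (?e n))\<^sup>2))"
    using trig_series_borel[OF sd] trig_series_borel[OF se]
    by (simp add: nn_integral_add nn_integral_cmult parseval[OF sd] parseval[OF se])
  also have "(\<Sum>n. (norm (?e n))\<^sup>2) = 1 / (1 - s\<^sup>2)"
  proof -
    have "norm (s\<^sup>2) < 1" using s by (simp add: power_less_one_iff)
    moreover have "(norm (?e n))\<^sup>2 = (s\<^sup>2) ^ n" for n
      using s by (simp add: norm_power power_mult[symmetric] mult.commute)
    ultimately show ?thesis by (simp add: suminf_geometric)
  qed
  also have "ennreal (c / 2) * ennreal (2 * pi * (\<Sum>n. (norm (d n))\<^sup>2)) + ennreal (1 / (2 * c)) * ennreal (2 * pi * (1 / (1 - s\<^sup>2)))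
     \<le> ennreal (pi * (c * (\<Sum>n. (norm (d n))\<^sup>2) + 1 / (c * (1 - s))))"
  proof -
    have D: "0 \<le> (\<Sum>n. (norm (d n))\<^sup>2)" by (intro suminf_nonneg summable_norm_square sd) auto
    have s2: "s\<^sup>2 \<le> s" using s by (simp add: power2_eq_square mult_left_le)
    have "c / 2 * (2 * pi * (\<Sum>n. (norm (d n))\<^sup>2)) + 1 / (2 * c) * (2 * pi * (1 / (1 - s\<^sup>2)))
        = pi * (c * (\<Sum>n. (norm (d n))\<^sup>2) + 1 / (c * (1 - s\<^sup>2)))"
      using c by (simp add: field_simps)
    also have "\<dots> \<le> pi * (c * (\<Sum>n. (norm (d n))\<^sup>2) + 1 / (c * (1 - s)))"
      using c s s2 by (intro mult_left_mono add_left_mono divide_left_mono mult_pos_pos) auto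
    finally show ?thesis using c s s2 D
      by (simp add: ennreal_mult[symmetric] ennreal_plus[symmetric] del: ennreal_plus)
  qed
  finally show ?thesis .
qed

section \<open>Domination by tails\<close>

lemma nn_integral_layer_cake:
  fixes \<phi> :: "'a \<Rightarrow> real"
  assumes "sigma_finite_measure M" and [measurable]: "\<phi> \<in> borel_measurable M"
    and "\<And>x. x \<in> space M \<Longrightarrow> \<phi> x \<ge> 0"
  shows "(\<integral>\<^sup>+x. ennreal (\<phi> x) \<partial>M) = (\<integral>\<^sup>+t\<in>{0..}. emeasure M {x \<in> space M. t < \<phi> x} \<partial>lborel)"
proof -
  interpret M: sigma_finite_measure M by fact
  interpret pair_sigma_finite lborel M ..
  have "(\<integral>\<^sup>+x. ennreal (\<phi> x) \<partial>M) = (\<integral>\<^sup>+x. (\<integral>\<^sup>+t. indicator {t. 0 \<le> t \<and> t < \<phi> x} t \<partial>lborel) \<partial>M)"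
  proof (intro nn_integral_cong)
    fix x assume "x \<in> space M"
    moreover have "{t. 0 \<le> t \<and> t < \<phi> x} = {0..<\<phi> x}" by auto
    ultimately show "ennreal (\<phi> x) = (\<integral>\<^sup>+t. indicator {t. 0 \<le> t \<and> t < \<phi> x} t \<partial>lborel)"
      using assms(3) by simp
  qed
  also have "\<dots> = (\<integral>\<^sup>+t. (\<integral>\<^sup>+x. indicator {t. 0 \<le> t \<and> t < \<phi> x} t \<partial>M) \<partial>lborel)"
    by (rule Fubini') (simp add: indicator_def case_prod_beta')
  also have "\<dots> = (\<integral>\<^sup>+t\<in>{0..}. emeasure M {x \<in> space M. t < \<phi> x} \<partial>lborel)"
  proof (intro nn_integral_cong)
    fix t :: real
    have "(\<integral>\<^sup>+x. indicator {t. 0 \<le> t \<and> t < \<phi> x} t \<partial>M) =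
        (\<integral>\<^sup>+x. indicator {x \<in> space M. t < \<phi> x} x * indicator {0..} t \<partial>M)"
      by (intro nn_integral_cong) (auto split: split_indicator)
    thus "(\<integral>\<^sup>+x. indicator {t. 0 \<le> t \<and> t < \<phi> x} t \<partial>M) = emeasure M {x \<in> space M. t < \<phi> x} * indicator {0..} t"
      by (simp add: nn_integral_multc)
  qed
  finally show ?thesis .
qed

text \<open>Superlevel sets of a nondecreasing function on [0,1) are of this kind.\<close>

lemma upper_set_cases:
  fixes A :: "real set"
  assumes "A \<subseteq> {0..<1}" and "\<And>x y. x \<in> A \<Longrightarrow> x \<le> y \<Longrightarrow> y < 1 \<Longrightarrow> y \<in> A"
  obtains "A = {}" | a where "a \<in> {0..<1}" "A = {a..<1}"
    | a where "a \<in> {0..<1}" "A = {a<..<1}"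
proof (cases "A = {}")
  case False
  define a where "a = Inf A"
  have bdd: "bdd_below A" using assms(1) by (intro bdd_belowI[of _ 0]) auto
  have a: "a \<in> {0..<1}"
  proof -
    obtain x where "x \<in> A" using False by auto
    hence "a \<le> x" "x < 1" using bdd assms(1) by (auto simp: a_def intro: cInf_lower)
    moreover have "0 \<le> a" unfolding a_def using False assms(1) by (intro cInf_greatest) auto
    ultimately show ?thesis by auto
  qed
  have le: "x \<in> A \<Longrightarrow> a \<le> x" for x using bdd by (auto simp: a_def intro: cInf_lower)
  have gt: "x \<in> A" if "a < x" "x < 1" for x
    using that cInf_lessD[OF False, of x] assms(2) unfolding a_def by (meson less_imp_le)
  show thesis
  proof (cases "a \<in> A")
    case True
    hence "A = {a..<1}" using le gt assms(1) by (force simp: le_less)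
    thus ?thesis using a that by blast
  next
    case False
    hence "A = {a<..<1}" using le gt assms(1) by (force simp: le_less)
    thus ?thesis using a that by blast
  qed
qed (use that in blast)

text \<open>By the layer cake formula only superlevel sets of \<phi> matter, and monotonicity makes
  these intervals [a,1) or (a,1). The theorem serves for the doubling of moments, with \<phi> a
  power, and for the Carleson embeddings, with \<phi> the maximum modulus.\<close>

theorem nn_integral_mono_tail_dominated:
  fixes \<phi> :: "real \<Rightarrow> real" and \<mu> \<nu> :: "real measure"
  assumes "sigma_finite_measure \<mu>" "sigma_finite_measure \<nu>"
    and sets [measurable_cong]: "sets \<mu> = sets borel" "sets \<nu> = sets borel"
    and tail: "\<And>a. a \<in> {0..<1} \<Longrightarrow> emeasure \<mu> {a..<1} \<le> c * emeasure \<nu> {a..<1}"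
    and mono: "\<And>x y. 0 \<le> x \<Longrightarrow> x \<le> y \<Longrightarrow> y < 1 \<Longrightarrow> \<phi> x \<le> \<phi> y"
    and nonneg: "\<And>x. 0 \<le> x \<Longrightarrow> x < 1 \<Longrightarrow> 0 \<le> \<phi> x"
  shows "(\<integral>\<^sup>+x\<in>{0..<1}. ennreal (\<phi> x) \<partial>\<mu>) \<le> c * (\<integral>\<^sup>+x\<in>{0..<1}. ennreal (\<phi> x) \<partial>\<nu>)"
proof -
  interpret \<mu>: sigma_finite_measure \<mu> by fact
  interpret \<nu>: sigma_finite_measure \<nu> by fact
  define \<psi> where "\<psi> x = \<phi> x * indicator {0..<1} x" for x
  have \<psi>0: "0 \<le> \<psi> x" for x using nonneg by (auto simp: \<psi>_def split: split_indicator)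
  have space: "space \<mu> = UNIV" "space \<nu> = UNIV"
    using sets[THEN sets_eq_imp_space_eq] by auto
  have up: "{x. t < \<psi> x} \<subseteq> {0..<1} \<and> (\<forall>x y. x \<in> {x. t < \<psi> x} \<longrightarrow> x \<le> y \<longrightarrow> y < 1 \<longrightarrow> y \<in> {x. t < \<psi> x})"
    if "0 \<le> t" for t
    using that mono by (force simp: \<psi>_def split: split_indicator if_splits)
  \<comment> \<open>Measurability comes from monotonicity, as every superlevel set is an interval or
    the whole line.\<close>
  have \<psi>_meas: "\<psi> \<in> borel_measurable borel"
  proof (rule borel_measurableI_greater)
    fix t :: real
    show "{x \<in> space borel. t < \<psi> x} \<in> sets borel"
    proof (cases "0 \<le> t")
      case True
      from up[OF this] have "{x. t < \<psi> x} \<subseteq> {0..<1}"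
        "\<And>x y. x \<in> {x. t < \<psi> x} \<Longrightarrow> x \<le> y \<Longrightarrow> y < 1 \<Longrightarrow> y \<in> {x. t < \<psi> x}" by blast+
      thus ?thesis by (rule upper_set_cases[of "{x. t < \<psi> x}"]) auto
    next
      case False
      hence "t < \<psi> x" for x using \<psi>0[of x] by linarith
      thus ?thesis by simp
    qed
  qed
  have le: "emeasure \<mu> {x. t < \<psi> x} \<le> c * emeasure \<nu> {x. t < \<psi> x}" if "0 \<le> t" for t
  proof -
    from up[OF that] have "{x. t < \<psi> x} \<subseteq> {0..<1}"
      "\<And>x y. x \<in> {x. t < \<psi> x} \<Longrightarrow> x \<le> y \<Longrightarrow> y < 1 \<Longrightarrow> y \<in> {x. t < \<psi> x}" by blast+
    thus ?thesis
    proof (rule upper_set_cases[of "{x. t < \<psi> x}"])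
      fix a assume opened: "a \<in> {0..<1}" "{x. t < \<psi> x} = {a<..<1}"
      hence a: "0 \<le> a" "a < 1" by simp_all
      \<comment> \<open>The hypothesis speaks of half-closed tails only, so (a,1) is exhausted by
        them; the denominators start at 2 to keep the left endpoints below 1.\<close>
      have *: "{a<..<1} = (\<Union>n. {a + (1 - a) / real (Suc (Suc n))..<1})"
      proof safe
        fix x assume x: "x \<in> {a<..<1}"
        obtain n where "(1 - a) / (x - a) < real n" using reals_Archimedean2 by blast
        hence "(1 - a) / real (Suc (Suc n)) \<le> x - a"
          using x by (auto simp: field_simps)
        thus "x \<in> (\<Union>n. {a + (1 - a) / real (Suc (Suc n))..<1})" using x by (auto intro!: exI[of _ n])
      next
        fix n x assume "x \<in> {a + (1 - a) / real (Suc (Suc n))..<1}"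
        moreover have "(1 - a) / real (Suc (Suc n)) > 0" using a by simp
        ultimately show "x \<in> {a<..<1}" by (auto simp del: of_nat_Suc)
      qed
      have inc: "incseq (\<lambda>n. {a + (1 - a) / real (Suc (Suc n))..<1})"
      proof (intro incseq_SucI)
        fix n
        have "(1 - a) / real (Suc (Suc (Suc n))) \<le> (1 - a) / real (Suc (Suc n))"
          using a by (intro divide_left_mono) auto
        thus "{a + (1 - a) / real (Suc (Suc n))..<1} \<subseteq> {a + (1 - a) / real (Suc (Suc (Suc n)))..<1}"
          by (auto simp del: of_nat_Suc)
      qed
      have lt: "a + (1 - a) / real (Suc (Suc n)) \<in> {0..<1}" for n
      proof -
        have "(1 - a) / real (Suc (Suc n)) < 1 - a" using a by (simp add: divide_less_eq)
        moreover have "0 \<le> (1 - a) / real (Suc (Suc n))" using a by simp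
        ultimately show ?thesis using a by (simp del: of_nat_Suc)
      qed
      have "emeasure \<mu> {a<..<1} = (SUP n. emeasure \<mu> {a + (1 - a) / real (Suc (Suc n))..<1})"
        unfolding * using inc by (intro SUP_emeasure_incseq[symmetric]) (auto simp: sets)
      also have "\<dots> \<le> c * emeasure \<nu> {a<..<1}"
      proof (rule SUP_least)
        fix n
        have "emeasure \<mu> {a + (1 - a) / real (Suc (Suc n))..<1} \<le> c * emeasure \<nu> {a + (1 - a) / real (Suc (Suc n))..<1}"
          by (rule tail[OF lt])
        also have "\<dots> \<le> c * emeasure \<nu> {a<..<1}"
          unfolding * by (intro mult_left_mono emeasure_mono) (auto simp: sets)
        finally show "emeasure \<mu> {a + (1 - a) / real (Suc (Suc n))..<1} \<le> c * emeasure \<nu> {a<..<1}" .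
      qed
      finally show ?thesis by (simp only: opened)
    qed (use tail in auto)
  qed
  have conv: "(\<integral>\<^sup>+x\<in>{0..<1}. ennreal (\<phi> x) \<partial>M) = (\<integral>\<^sup>+x. ennreal (\<psi> x) \<partial>M)" for M
    by (intro nn_integral_cong) (auto simp: \<psi>_def split: split_indicator)
  have [measurable]: "\<psi> \<in> borel_measurable \<mu>" "\<psi> \<in> borel_measurable \<nu>"
    using \<psi>_meas by (simp_all add: measurable_cong_sets[OF sets(1) refl] measurable_cong_sets[OF sets(2) refl])
  have "(\<integral>\<^sup>+x. ennreal (\<psi> x) \<partial>\<mu>) \<le> (\<integral>\<^sup>+t. c * (emeasure \<nu> {x. t < \<psi> x} * indicator {0..} t) \<partial>lborel)"
    by (subst nn_integral_layer_cake) (auto simp: \<psi>0 space le intro!: nn_integral_mono \<mu>.sigma_finite_measure_axioms split: split_indicator)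
  also have "\<dots> = c * (\<integral>\<^sup>+t. emeasure \<nu> {x. t < \<psi> x} * indicator {0..} t \<partial>lborel)"
  proof (rule nn_integral_cmult)
    interpret P: pair_sigma_finite lborel \<nu> ..
    have "{p \<in> space (lborel \<Otimes>\<^sub>M \<nu>). fst p < \<psi> (snd p)} \<in> sets (lborel \<Otimes>\<^sub>M \<nu>)"
      by measurable
    from \<nu>.measurable_emeasure_Pair[OF this]
    have "(\<lambda>t. emeasure \<nu> {x. t < \<psi> x}) \<in> borel_measurable lborel"
      by (simp add: space_pair_measure space vimage_def)
    thus "(\<lambda>t. emeasure \<nu> {x. t < \<psi> x} * indicator {0..} t) \<in> borel_measurable lborel"
      by simp
  qed
  also have "(\<integral>\<^sup>+t. emeasure \<nu> {x. t < \<psi> x} * indicator {0..} t \<partial>lborel) = (\<integral>\<^sup>+x. ennreal (\<psi> x) \<partial>\<nu>)"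
    by (subst nn_integral_layer_cake) (auto simp: \<psi>0 space intro!: \<nu>.sigma_finite_measure_axioms)
  finally show ?thesis by (simp add: conv)
qed

section \<open>Norms on spaces of analytic functions\<close>

lemma taylor_sums:
  assumes "f holomorphic_on ball 0 1" "norm z < 1"
  shows "(\<lambda>n. taylor_coeff f n * z ^ n) sums f z"
  using holomorphic_power_series[OF assms(1), of z] assms(2) by (simp add: taylor_coeff_def)

lemma summable_norm_powser_disc:
  fixes a :: "nat \<Rightarrow> complex"
  assumes "\<And>z. norm z < 1 \<Longrightarrow> summable (\<lambda>n. a n * z ^ n)" "0 \<le> r" "r < 1"
  shows "summable (\<lambda>n. norm (a n) * r ^ n)"
proof -
  have "summable (\<lambda>n. norm (a n * complex_of_real r ^ n))"
    using assms by (intro powser_insidea[where x="complex_of_real ((1 + r) / 2)"] assms(1)) (auto simp del: of_real_add of_real_divide)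
  thus ?thesis using assms(2) by (simp add: norm_mult norm_power)
qed

lemma summable_norm_taylor:
  assumes "f holomorphic_on ball 0 1" "0 \<le> r" "r < 1"
  shows "summable (\<lambda>n. norm (taylor_coeff f n) * r ^ n)"
  using assms taylor_sums by (intro summable_norm_powser_disc) (auto simp: sums_iff)

lemma sums_imp_trig_series:
  assumes "\<And>z. norm z < 1 \<Longrightarrow> (\<lambda>n. a n * z ^ n) sums f z" "0 \<le> r" "r < 1"
  shows "f (rcis r \<theta>) = trig_series (\<lambda>n. a n * of_real r ^ n) \<theta>"
    and "summable (\<lambda>n. norm (a n * of_real r ^ n))"
proof -
  have "(\<lambda>n. a n * rcis r \<theta> ^ n) sums f (rcis r \<theta>)" using assms by auto
  thus "f (rcis r \<theta>) = trig_series (\<lambda>n. a n * of_real r ^ n) \<theta>"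
    unfolding trig_series_def rcis_def power_mult_distrib
    by (simp add: sums_iff mult.assoc)
  show "summable (\<lambda>n. norm (a n * of_real r ^ n))"
    using summable_norm_powser_disc[of a r] assms by (simp add: norm_mult norm_power sums_iff)
qed

lemma norm_rcis_eq [simp]: "norm (rcis r \<theta>) = \<bar>r\<bar>"
  by (simp add: rcis_def norm_mult)

lemma rcis_measurable [measurable]: "(\<lambda>\<theta>. rcis r \<theta>) \<in> borel_measurable borel"
  unfolding rcis_def cis_conv_exp by measurable

lemma continuous_on_rcis: "continuous_on A (rcis r)"
  unfolding rcis_def by (intro continuous_intros)

lemma rcis_Arg2pi: "z = rcis (norm z) (Arg2pi z)"
  using Arg2pi_eq[of z] by (simp add: rcis_def cis_conv_exp)

lemma bdd_above_circle:
  assumes "f holomorphic_on ball 0 1" "0 \<le> r" "r < 1"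
  shows "bdd_above ((\<lambda>\<theta>. norm (f (rcis r \<theta>))) ` {0..2*pi})"
proof -
  have "continuous_on {0..2*pi} (\<lambda>\<theta>. norm (f (rcis r \<theta>)))"
    using assms
    by (intro continuous_intros continuous_on_compose2[OF holomorphic_on_imp_continuous_on continuous_on_rcis]) auto
  thus ?thesis
    by (intro bounded_imp_bdd_above compact_imp_bounded compact_continuous_image) auto
qed

lemma norm_le_M_inf:
  assumes "f holomorphic_on ball 0 1" "norm z < 1"
  shows "norm (f z) \<le> M_inf (norm z) f"
proof -
  have "norm (f (rcis (norm z) (Arg2pi z))) \<le> M_inf (norm z) f"
    unfolding M_inf_def using Arg2pi[of z] assms
    by (intro cSUP_upper bdd_above_circle) auto
  thus ?thesis by (simp flip: rcis_Arg2pi)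
qed

lemma M_inf_nonneg:
  assumes "f holomorphic_on ball 0 1" "0 \<le> r" "r < 1"
  shows "0 \<le> M_inf r f"
  using norm_le_M_inf[OF assms(1), of "of_real r"] assms order.trans[OF norm_ge_zero] by auto

lemma M_inf_le:
  assumes "\<And>\<theta>. norm (f (rcis r \<theta>)) \<le> B"
  shows "M_inf r f \<le> B"
  unfolding M_inf_def using assms by (intro cSUP_least) auto

text \<open>The maximum principle on the closed disc of radius y. Monotonicity is what qualifies the
  maximum modulus as an integrand for \<open>nn_integral_mono_tail_dominated\<close>.\<close>

lemma M_inf_mono:
  assumes f: "f holomorphic_on ball 0 1" and xy: "0 \<le> x" "x \<le> y" "y < 1"
  shows "M_inf x f \<le> M_inf y f"
proof (rule M_inf_le)
  fix \<theta>
  have sub: "cball 0 y \<subseteq> ball 0 (1::real)" "cball (0::complex) y \<subseteq> ball 0 1" using xy by auto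
  show "norm (f (rcis x \<theta>)) \<le> M_inf y f"
  proof (rule maximum_modulus_frontier[where S="cball 0 y" and f=f])
    show "f holomorphic_on interior (cball 0 y)"
      using sub(2) interior_subset by (blast intro: holomorphic_on_subset[OF f])
    show "continuous_on (closure (cball 0 y)) f"
      using sub(2) by (auto intro: holomorphic_on_imp_continuous_on holomorphic_on_subset[OF f])
    show "norm (f z) \<le> M_inf y f" if "z \<in> frontier (cball 0 y)" for z
    proof -
      have "norm z = y" using that xy by (cases "y = 0") (auto simp: frontier_def)
      thus ?thesis using norm_le_M_inf[OF f, of z] xy by simp
    qed
  qed (use xy in auto)
qed

lemma suminf_ennreal_norm:
  fixes a :: "nat \<Rightarrow> real"
  assumes "summable a" "\<And>n. 0 \<le> a n"
  shows "(\<Sum>n. ennreal (a n)) = ennreal (suminf a)"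
  using assms by (intro suminf_ennreal2) auto

lemma nn_integral_power_01: "(\<integral>\<^sup>+r\<in>{0..<1}. ennreal (r ^ n) \<partial>lborel) = ennreal (1 / real (n + 1))"
proof -
  have "(\<integral>\<^sup>+r\<in>{0..<1}. ennreal (r ^ n) \<partial>lborel) = (\<integral>\<^sup>+r\<in>{0..1}. ennreal (r ^ n) \<partial>lborel)"
    by (rule nn_integral_cong_AE) (use AE_lborel_singleton[of 1] in eventually_elim, auto split: split_indicator)
  also have "\<dots> = ennreal (1 ^ (n + 1) / real (n + 1) - 0 ^ (n + 1) / real (n + 1))"
  proof (intro nn_integral_FTC_Icc)
    fix x :: real
    have "((\<lambda>x. x ^ (n + 1) / real (n + 1)) has_real_derivative (real (n + 1) * x ^ n) / real (n + 1)) (at x)"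
      using DERIV_power_Suc[of "\<lambda>x. x" 1 x UNIV n] by (intro DERIV_cdivide) (simp add: algebra_simps)
    thus "((\<lambda>x. x ^ (n + 1) / real (n + 1)) has_real_derivative x ^ n) (at x)"
      by simp
  qed auto
  finally show ?thesis by simp
qed

text \<open>This links the norms of H(\<infinity>,1) and HL(1): for nonnegative coefficients the
  series at r is the maximum modulus on the circle of radius r, and in general it majorises it. Both
  uses occur below.\<close>

lemma nn_integral_powser_01:
  assumes "\<And>n. 0 \<le> a n"
  shows "(\<integral>\<^sup>+r\<in>{0..<1}. (\<Sum>n. ennreal (a n * r ^ n)) \<partial>lborel) = (\<Sum>n. ennreal (a n / real (n + 1)))"
proof -
  have "(\<integral>\<^sup>+r\<in>{0..<1}. (\<Sum>n. ennreal (a n * r ^ n)) \<partial>lborel)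
      = (\<integral>\<^sup>+r. (\<Sum>n. ennreal (a n * r ^ n) * indicator {0..<1} r) \<partial>lborel)"
    by (simp add: ennreal_suminf_multc)
  also have "\<dots> = (\<Sum>n. \<integral>\<^sup>+r. ennreal (a n * r ^ n) * indicator {0..<1} r \<partial>lborel)"
    by (intro nn_integral_suminf) auto
  also have "\<dots> = (\<Sum>n. ennreal (a n) * (\<integral>\<^sup>+r\<in>{0..<1}. ennreal (r ^ n) \<partial>lborel))"
    using assms by (intro suminf_cong, subst nn_integral_cmult[symmetric])
      (auto intro!: nn_integral_cong simp: ennreal_mult split: split_indicator)
  also have "\<dots> = (\<Sum>n. ennreal (a n / real (n + 1)))"
    unfolding nn_integral_power_01 using assms by (intro suminf_cong) (simp add: ennreal_mult[symmetric])
  finally show ?thesis .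
qed

theorem norm_Hinf1_le_norm_HL1:
  assumes f: "f holomorphic_on ball 0 1"
  shows "norm_Hinf1 f \<le> norm_HL1 f"
proof -
  have "norm_Hinf1 f \<le> (\<integral>\<^sup>+r\<in>{0..<1}. (\<Sum>n. ennreal (norm (taylor_coeff f n) * r ^ n)) \<partial>lborel)"
    unfolding norm_Hinf1_def
  proof (intro nn_integral_mono)
    fix r :: real
    show "ennreal (M_inf r f) * indicator {0..<1} r \<le>
      (\<Sum>n. ennreal (norm (taylor_coeff f n) * r ^ n)) * indicator {0..<1} r"
    proof (cases "r \<in> {0..<1}")
      case True
      hence s: "summable (\<lambda>n. norm (taylor_coeff f n) * r ^ n)" using summable_norm_taylor[OF f] by auto
      have "M_inf r f \<le> (\<Sum>n. norm (taylor_coeff f n) * r ^ n)"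
      proof (rule M_inf_le)
        fix \<theta>
        have "f (rcis r \<theta>) = trig_series (\<lambda>n. taylor_coeff f n * of_real r ^ n) \<theta>"
          "summable (\<lambda>n. norm (taylor_coeff f n * of_real r ^ n))"
          using sums_imp_trig_series[OF taylor_sums[OF f], of r] True by auto
        from norm_trig_series_le[OF this(2), of \<theta>] this(1)
        show "norm (f (rcis r \<theta>)) \<le> (\<Sum>n. norm (taylor_coeff f n) * r ^ n)"
          using True by (simp add: norm_mult norm_power)
      qed
      thus ?thesis using True s by (simp add: suminf_ennreal_norm ennreal_leI)
    qed simp
  qed
  also have "\<dots> = norm_HL1 f"
    unfolding norm_HL1_def by (rule nn_integral_powser_01) simp
  finally show ?thesis .
qed

section \<open>Hardy's inequality\<close>

text \<open>The row sum bound in Schur's test for the Hilbert matrix with weights sqrt(j + 1). The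
  range k <= j and the range k > j contribute at most 2 each.\<close>

lemma schur_test_hilbert:
  "(\<Sum>k<M. sqrt (real j + 1) / (sqrt (real k + 1) * real (j + k + 1))) \<le> 4"
proof -
  define u where "u = sqrt (real j + 1)"
  have u: "u > 0" "0 \<le> u" "u * u = real j + 1" by (simp_all add: u_def)
  \<comment> \<open>A discrete primitive of the majorant that results from j + k + 1 >= j + 1 when k
    <= j and from j + k + 1 >= k + 1 when k > j. Both branches have the value 2 at m = j + 1, and
    the second one stays below 4.\<close>
  define F where "F m = (if m \<le> j + 1 then 2 * sqrt (real m) / u else 4 - 2 * u / sqrt (real m))" for m
  have step: "u / (sqrt (real k + 1) * real (j + k + 1)) \<le> F (Suc k) - F k" for k
  proof -
    define x y where "x = sqrt (real k)" and "y = sqrt (real k + 1)"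
    have xy: "0 \<le> x" "0 < y" "x \<le> y" "x * x = real k" "y * y = real k + 1"
      by (simp_all add: x_def y_def)
    have d: "1 = (y - x) * (y + x)" using xy by (simp add: algebra_simps)
    show ?thesis
    proof (cases "k \<le> j")
      case True
      have "u / (y * real (j + k + 1)) \<le> u / (y * (u * u))"
        using u xy by (intro divide_left_mono mult_left_mono mult_pos_pos) (auto simp: u)
      also have "\<dots> = 1 / (y * u)" using u(1) by (simp add: field_simps)
      also have "\<dots> \<le> 2 * (y - x) / u"
      proof -
        have "(y - x) * (y + x) \<le> (y - x) * (2 * y)" using xy by (intro mult_left_mono) auto
        hence "1 / (y * u) \<le> (y - x) * (2 * y) / (y * u)"
          using xy u(1) d by (intro divide_right_mono) auto
        also have "\<dots> = 2 * (y - x) / u" using xy(2) by simp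
        finally show ?thesis .
      qed
      also have "\<dots> = F (Suc k) - F k"
        using True by (simp add: F_def x_def y_def diff_divide_distrib right_diff_distrib add.commute)
      finally show ?thesis by (simp add: y_def)
    next
      case False
      hence x0: "x > 0" by (simp add: x_def)
      have "u / (y * real (j + k + 1)) \<le> u / (y * (y * y))"
        using u xy by (intro divide_left_mono mult_left_mono mult_pos_pos) auto
      also have "\<dots> \<le> 2 * u / x - 2 * u / y"
      proof -
        have "x * 1 \<le> (y - x) * (2 * (y * y))"
        proof -
          have "x * 1 = x * ((y - x) * (y + x))" by (simp only: d[symmetric])
          also have "\<dots> = (y - x) * (x * (y + x))" by (simp only: mult_ac)
          also have "\<dots> \<le> (y - x) * (2 * (y * y))"
          proof (intro mult_left_mono)
            have "x * (y + x) \<le> y * (y + y)" using xy by (intro mult_mono) auto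
            thus "x * (y + x) \<le> 2 * (y * y)" by simp
          qed (use xy in auto)
          finally show ?thesis .
        qed
        hence "u * (x / (x * y * y * y)) \<le> u * ((y - x) * (2 * (y * y)) / (x * y * y * y))"
          using u xy x0 by (intro mult_left_mono divide_right_mono) auto
        moreover have "x / (x * y * y * y) = 1 / (y * (y * y))" "(y - x) * (2 * (y * y)) / (x * y * y * y) = 2 / x - 2 / y"
          using xy(2) x0 by (simp_all add: field_simps)
        ultimately show ?thesis by (simp only: right_diff_distrib) (simp add: mult.commute)
      qed
      also have "\<dots> = F (Suc k) - F k"
      proof (cases "k = j + 1")
        case True
        hence "F k = 4 - 2 * u / x"
          using u by (simp add: F_def x_def u_def add.commute)
        thus ?thesis using True False by (simp add: F_def y_def add.commute)
      qed (use False in \<open>simp add: F_def x_def y_def add.commute\<close>)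
      finally show ?thesis by (simp add: y_def)
    qed
  qed
  have "(\<Sum>k<M. u / (sqrt (real k + 1) * real (j + k + 1))) \<le> (\<Sum>k<M. F (Suc k) - F k)"
    by (intro sum_mono step)
  also have "\<dots> = F M" by (subst sum_lessThan_telescope) (simp add: F_def)
  also have "\<dots> \<le> 4"
  proof (cases "M \<le> j + 1")
    case True
    hence "sqrt (real M) \<le> u" by (simp add: u_def)
    thus ?thesis using True u by (simp add: F_def field_simps)
  qed (use u in \<open>simp add: F_def\<close>)
  finally show ?thesis by (simp add: u_def)
qed

text \<open>Schur's test: each product x_j y_k is split by the weighted inequality between
  arithmetic and geometric mean with weight sqrt((j + 1) / (k + 1)), and the resulting row and
  column sums are at most 4.\<close>

theorem hilbert_inequality:
  fixes x y :: "nat \<Rightarrow> real"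
  assumes "\<And>n. 0 \<le> x n" "\<And>n. 0 \<le> y n"
  shows "(\<Sum>j<M. \<Sum>k<M. x j * y k / real (j + k + 1)) \<le> 2 * ((\<Sum>j<M. (x j)\<^sup>2) + (\<Sum>k<M. (y k)\<^sup>2))"
proof -
  let ?w = "\<lambda>j k. sqrt (real j + 1) / (sqrt (real k + 1) * real (j + k + 1))"
  have le: "x j * y k / real (j + k + 1) \<le> ((x j)\<^sup>2 * ?w j k + (y k)\<^sup>2 * ?w k j) / 2" for j k
  proof -
    define p q d where "p = sqrt (real j + 1)" and "q = sqrt (real k + 1)" and "d = real (j + k + 1)"
    have pq: "p > 0" "q > 0" "d > 0" by (simp_all add: p_def q_def d_def)
    have d': "real (k + j + 1) = d" by (simp add: d_def)
    have "0 \<le> (x j * p - y k * q)\<^sup>2 / (2 * p * q)" using pq by simp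
    also have "\<dots> = ((x j)\<^sup>2 * (p / q) + (y k)\<^sup>2 * (q / p)) / 2 - x j * y k"
      using pq by (simp add: power2_eq_square field_simps)
    finally have "x j * y k \<le> ((x j)\<^sup>2 * (p / q) + (y k)\<^sup>2 * (q / p)) / 2" by simp
    hence "x j * y k / d \<le> ((x j)\<^sup>2 * (p / q) + (y k)\<^sup>2 * (q / p)) / 2 / d"
      using pq by (intro divide_right_mono) auto
    also have "\<dots> = ((x j)\<^sup>2 * (p / (q * d)) + (y k)\<^sup>2 * (q / (p * d))) / 2"
      using pq by (simp add: field_simps)
    finally show ?thesis unfolding d' by (simp only: p_def q_def d_def)
  qed
  have "(\<Sum>j<M. \<Sum>k<M. x j * y k / real (j + k + 1)) \<le> (\<Sum>j<M. \<Sum>k<M. ((x j)\<^sup>2 * ?w j k + (y k)\<^sup>2 * ?w k j) / 2)"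
    by (intro sum_mono le)
  also have "\<dots> = ((\<Sum>j<M. \<Sum>k<M. (x j)\<^sup>2 * ?w j k) + (\<Sum>j<M. \<Sum>k<M. (y k)\<^sup>2 * ?w k j)) / 2"
    by (simp only: sum_divide_distrib[symmetric] sum.distrib)
  also have "(\<Sum>j<M. \<Sum>k<M. (y k)\<^sup>2 * ?w k j) = (\<Sum>k<M. \<Sum>j<M. (y k)\<^sup>2 * ?w k j)"
    by (rule sum.swap)
  also have "((\<Sum>j<M. \<Sum>k<M. (x j)\<^sup>2 * ?w j k) + (\<Sum>k<M. \<Sum>j<M. (y k)\<^sup>2 * ?w k j)) / 2
      \<le> ((\<Sum>j<M. (x j)\<^sup>2 * 4) + (\<Sum>k<M. (y k)\<^sup>2 * 4)) / 2"
    unfolding sum_distrib_left[symmetric]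
    by (intro divide_right_mono add_mono sum_mono mult_left_mono schur_test_hilbert) auto
  also have "\<dots> = 2 * ((\<Sum>j<M. (x j)\<^sup>2) + (\<Sum>k<M. (y k)\<^sup>2))"
    by (simp only: sum_distrib_right[symmetric]) simp
  finally show ?thesis .
qed

section \<open>Blaschke factorisation and Hardy's inequality\<close>

lemma divide_out_zero:
  assumes f: "f holomorphic_on ball 0 R" and a: "a \<in> ball 0 R" "f a = 0"
    and nz: "\<exists>z\<in>ball 0 R. f z \<noteq> 0"
  obtains g n where "g holomorphic_on ball 0 R" "g a \<noteq> 0" "\<And>z. z \<in> ball 0 R \<Longrightarrow> f z = (z - a) ^ n * g z"
proof -
  obtain z0 where z0: "z0 \<in> ball 0 R" "f z0 \<noteq> 0" using nz by blast
  have "\<not> f constant_on ball 0 R"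
    using z0 a unfolding constant_on_def by metis
  then obtain g0 r n where r: "0 < n" "0 < r" "ball a r \<subseteq> ball 0 R" "g0 holomorphic_on ball a r"
      "\<And>w. w \<in> ball a r \<Longrightarrow> f w = (w - a) ^ n * g0 w" "\<And>w. w \<in> ball a r \<Longrightarrow> g0 w \<noteq> 0"
    by (rule holomorphic_factor_zero_nonconstant[OF f open_ball connected_ball a(1,2)]) iprover
  \<comment> \<open>The whole multiplicity is divided out at once, so that the set of zeros loses
    the point a; the local factor fills the removable singularity.\<close>
  define g where "g z = (if z \<in> ball a r then g0 z else f z / (z - a) ^ n)" for z
  have g2: "g z = f z / (z - a) ^ n" if "z \<noteq> a" for z
  proof (cases "z \<in> ball a r")
    case True
    have "(z - a) ^ n \<noteq> 0" using that by simp
    thus ?thesis unfolding g_def if_P[OF True] r(5)[OF True] by (rule nonzero_mult_div_cancel_left[symmetric])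
  next
    case False
    show ?thesis unfolding g_def if_not_P[OF False] ..
  qed
  have "g holomorphic_on ball a r \<union> (ball 0 R - {a})"
  proof (rule holomorphic_on_Un)
    show "g holomorphic_on ball a r"
      using r(4) by (rule holomorphic_transform) (simp add: g_def)
    show "g holomorphic_on ball 0 R - {a}"
      by (rule holomorphic_transform[of "\<lambda>z. f z / (z - a) ^ n"])
        (auto intro!: holomorphic_intros holomorphic_on_subset[OF f] simp: g2)
  qed auto
  moreover have "ball a r \<union> (ball 0 R - {a}) = ball 0 R" using r by auto
  ultimately have "g holomorphic_on ball 0 R" by simp
  moreover have "g a \<noteq> 0" using r by (simp add: g_def)
  moreover have "f z = (z - a) ^ n * g z" if "z \<in> ball 0 R" for z
    using r(1) by (cases "z = a") (simp_all add: g2 a(2))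
  ultimately show thesis using that by blast
qed

text \<open>On the unit circle 1 = z cnj z, so the factor (z - a) / (1 - cnj a z) is unimodular
  there.\<close>

lemma norm_blaschke_factor:
  fixes a z :: complex
  assumes "norm z = 1"
  shows "norm (1 - cnj a * z) = norm (z - a)"
proof -
  have "z * cnj z = 1" using assms by (simp add: complex_norm_square[symmetric])
  hence "1 - cnj a * z = z * cnj (z - a)" by (simp add: algebra_simps)
  thus ?thesis using assms by (simp only: norm_mult complex_mod_cnj mult_1_left)
qed

text \<open>Induction on the number of distinct zeros in the closed disc, which is finite because
  \<open>f\<close> is holomorphic past the unit circle and does not vanish on it. The radius shrinks
  along the way, to avoid the poles of the Blaschke factors and, in the base case, the zeros outside
  the closed disc.\<close>

lemma blaschke_factorization:
  assumes "f holomorphic_on ball 0 R" "R > 1" "\<And>z. norm z = 1 \<Longrightarrow> f z \<noteq> 0"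
  shows "\<exists>R'>1. \<exists>B g. B holomorphic_on ball 0 R' \<and> g holomorphic_on ball 0 R' \<and>
    (\<forall>z\<in>ball 0 R'. g z \<noteq> 0 \<and> f z = B z * g z) \<and> (\<forall>z. norm z = 1 \<longrightarrow> norm (B z) = 1)"
  using assms
proof (induction "card {z \<in> cball 0 1. f z = 0}" arbitrary: f R)
  case (0 f R)
  have sub: "cball 0 1 \<subseteq> ball (0::complex) R" using 0 by auto
  have fin: "finite {z \<in> cball 0 1. f z = 0}"
  proof (cases "f constant_on ball 0 R")
    case True
    then obtain c where c: "f z = c" if "z \<in> ball 0 R" for z
      unfolding constant_on_def by blast
    have "c \<noteq> 0" using 0(4)[of 1] c[of 1] 0(3) by simp
    hence "{z \<in> cball 0 1. f z = 0} = {}" using c sub by blast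
    thus ?thesis by (simp only: finite.emptyI)
  next
    case False
    thus ?thesis
      by (intro holomorphic_compact_finite_zeros[OF 0(2) open_ball connected_ball compact_cball sub])
  qed
  hence Z: "{z \<in> cball 0 1. f z = 0} = {}" using 0 by simp
  have op: "open {z \<in> ball 0 R. f z \<noteq> 0}"
    using continuous_open_preimage[OF holomorphic_on_imp_continuous_on[OF 0(2)] open_ball, of "- {0}"]
    by (simp add: vimage_def Int_def open_Compl)
  \<comment> \<open>By compactness the set where f does not vanish contains a neighbourhood of the
    closed disc of uniform width e, so f itself can be the zero-free factor, with B = 1.\<close>
  obtain e where e: "e > 0" "(\<Union>x\<in>cball 0 1. ball x e) \<subseteq> {z \<in> ball 0 R. f z \<noteq> 0}"
    using compact_subset_open_imp_ball_epsilon_subset[OF compact_cball op, of 0 1] Z sub by blast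
  have nz: "f z \<noteq> 0 \<and> z \<in> ball 0 R" if "z \<in> ball 0 (1 + e)" for z
  proof -
    have "\<exists>x\<in>cball 0 1. z \<in> ball x e"
    proof (cases "norm z \<le> 1")
      case True
      thus ?thesis using e(1) by (intro bexI[of _ z]) auto
    next
      case False
      define t where "t = norm z"
      have t: "t > 1" "norm z = t" using False by (simp_all add: t_def)
      have "z / t - z = of_real (1 - t) * (z / t)"
        using t(1) by (simp add: field_simps)
      hence "dist (z / norm z) z = \<bar>1 - t\<bar> * (norm z / t)"
        using t by (simp only: dist_norm norm_mult norm_of_real norm_divide)
      also have "\<dots> = norm z - 1" using t by simp
      finally have "dist (z / norm z) z < e" using that by simp
      thus ?thesis using False by (intro bexI[of _ "z / norm z"]) (auto simp: norm_divide)
    qed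
    thus ?thesis using e(2) by blast
  qed
  show ?case
  proof (rule exI[of _ "1 + e"], rule conjI[OF _ exI[of _ "\<lambda>_. 1", OF exI[of _ f]]], goal_cases)
    case 2
    have "f holomorphic_on ball 0 (1 + e)" using nz by (intro holomorphic_on_subset[OF 0(2)]) auto
    thus ?case using nz by (auto intro: holomorphic_intros)
  qed (use e in auto)
next
  case (Suc m f R)
  let ?Z = "{z \<in> cball 0 1. f z = 0}"
  have finZ: "finite ?Z" using Suc(2) by (intro card_ge_0_finite) simp
  have "?Z \<noteq> {}" using Suc(2) by (metis card.empty nat.distinct(1))
  then obtain a where a: "a \<in> ?Z" by blast
  hence a1: "norm a < 1" using Suc.prems(3)[of a] by (auto simp: le_less)
  have aR: "a \<in> ball 0 R" using a1 Suc by simp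
  have "\<exists>z\<in>ball 0 R. f z \<noteq> 0" using Suc.prems(3)[of 1] Suc.prems(2) by (intro bexI[of _ 1]) auto
  from divide_out_zero[OF Suc.prems(1) aR _ this] a
  obtain g n where g: "g holomorphic_on ball 0 R" "g a \<noteq> 0" "\<And>z. z \<in> ball 0 R \<Longrightarrow> f z = (z - a) ^ n * g z"
    by auto
  \<comment> \<open>The only zero of 1 - cnj a z has modulus 1 / |a| > 1, and there is none if a =
    0.\<close>
  define R1 where "R1 = (if a = 0 then R else min R (1 / norm a))"
  have R1: "R1 > 1" "R1 \<le> R" using Suc.prems(2) a1 by (auto simp: R1_def)
  have ne: "1 - cnj a * z \<noteq> 0" if "z \<in> ball 0 R1" for z
  proof
    assume "1 - cnj a * z = 0"
    hence "norm (cnj a * z) = 1" by (metis eq_iff_diff_eq_0 norm_one)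
    hence *: "norm a * norm z = 1" by (simp add: norm_mult)
    hence "a \<noteq> 0" by auto
    hence "norm z < 1 / norm a" using that by (simp add: R1_def)
    thus False using * \<open>a \<noteq> 0\<close> by (simp add: field_simps)
  qed
  \<comment> \<open>Multiplying by the zero-free power of 1 - cnj a z compensates the denominator of
    the Blaschke factor and adds no zero, so the zeros of h in the closed disc are those of f other
    than a.\<close>
  define h where "h z = g z * (1 - cnj a * z) ^ n" for z
  have h: "h holomorphic_on ball 0 R1"
    unfolding h_def using R1 by (intro holomorphic_intros holomorphic_on_subset[OF g(1)]) auto
  have fh: "f z = ((z - a) / (1 - cnj a * z)) ^ n * h z" if "z \<in> ball 0 R1" for z
  proof -
    have "z \<in> ball 0 R" using that R1 by auto
    thus ?thesis using ne[OF that] g(3)[of z] by (simp add: h_def power_divide)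
  qed
  have hnz: "h z \<noteq> 0" if "norm z = 1" for z
    using Suc.prems(3)[OF that] fh[of z] that R1 by auto
  have "{z \<in> cball 0 1. h z = 0} = ?Z - {a}"
  proof (intro set_eqI iffI)
    fix z assume z: "z \<in> {z \<in> cball 0 1. h z = 0}"
    hence zR: "z \<in> ball 0 R1" "z \<in> ball 0 R" using R1 by auto
    have "g z = 0" using z ne[OF zR(1)] by (auto simp: h_def)
    thus "z \<in> ?Z - {a}" using z g zR by auto
  next
    fix z assume z: "z \<in> ?Z - {a}"
    hence zR: "z \<in> ball 0 R1" "z \<in> ball 0 R" using R1 by auto
    thus "z \<in> {z \<in> cball 0 1. h z = 0}" using z g(3)[OF zR(2)] by (auto simp: h_def)
  qed
  hence card: "m = card {z \<in> cball 0 1. h z = 0}"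
    using Suc(2) a finZ by (simp add: card_Diff_singleton)
  from Suc.hyps(1)[OF card h R1(1) hnz]
  obtain R' B k where R': "R' > 1" "B holomorphic_on ball 0 R'" "k holomorphic_on ball 0 R'"
     "\<forall>z\<in>ball 0 R'. k z \<noteq> 0 \<and> h z = B z * k z" "\<forall>z. norm z = 1 \<longrightarrow> norm (B z) = 1"
    by auto
  define R2 where "R2 = min R1 R'"
  have R2: "R2 > 1" "ball 0 R2 \<subseteq> ball (0::complex) R1" "ball 0 R2 \<subseteq> ball (0::complex) R'"
    using R1 R' by (auto simp: R2_def)
  show ?case
  proof (rule exI[of _ R2], rule conjI[OF _ exI[of _ "\<lambda>z. ((z - a) / (1 - cnj a * z)) ^ n * B z", OF exI[of _ k]]],
      rule R2(1), intro conjI ballI allI impI)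
    show "(\<lambda>z. ((z - a) / (1 - cnj a * z)) ^ n * B z) holomorphic_on ball 0 R2"
      using R2 ne by (intro holomorphic_intros holomorphic_on_subset[OF R'(2)]) auto
    show "k holomorphic_on ball 0 R2" by (intro holomorphic_on_subset[OF R'(3)] R2)
    fix z :: complex assume z: "z \<in> ball 0 R2"
    hence zz: "z \<in> ball 0 R1" "z \<in> ball 0 R'" using R2 by blast+
    thus "k z \<noteq> 0" using R' by blast
    show "f z = ((z - a) / (1 - cnj a * z)) ^ n * B z * k z"
      using fh[OF zz(1)] R'(4) zz(2) by simp
  next
    fix z :: complex assume z: "norm z = 1"
    hence "norm (1 - cnj a * z) = norm (z - a)" "1 - cnj a * z \<noteq> 0"
      using norm_blaschke_factor ne[of z] R1 by auto
    hence "norm ((z - a) / (1 - cnj a * z)) = 1" by (metis norm_divide divide_self norm_eq_zero)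
    thus "norm (((z - a) / (1 - cnj a * z)) ^ n * B z) = 1"
      using R'(5) z by (simp only: norm_mult norm_power power_one mult_1_left)
  qed
qed

lemma bessel_inequality:
  assumes f: "f holomorphic_on ball 0 R" "R > 1"
  shows "ennreal (2 * pi * (\<Sum>n<M. (norm (taylor_coeff f n))\<^sup>2)) \<le>
    (\<integral>\<^sup>+\<theta>\<in>{0..2*pi}. ennreal ((norm (f (cis \<theta>)))\<^sup>2) \<partial>lborel)"
proof -
  have s: "(\<lambda>n. taylor_coeff f n * z ^ n) sums f z" if "norm z < R" for z
    using holomorphic_power_series[OF f(1), of z] that by (simp add: taylor_coeff_def)
  have "summable (\<lambda>n. taylor_coeff f n * (complex_of_real ((1 + R) / 2)) ^ n)"
    using s[of "complex_of_real ((1 + R) / 2)"] f(2) by (auto simp: sums_iff simp del: of_real_add of_real_divide)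
  hence "summable (\<lambda>n. norm (taylor_coeff f n * 1 ^ n))"
    by (rule powser_insidea) (use f(2) in \<open>simp del: of_real_add of_real_divide\<close>)
  hence sm: "summable (\<lambda>n. norm (taylor_coeff f n))" by simp
  have "f (cis \<theta>) = trig_series (taylor_coeff f) \<theta>" for \<theta>
    using s[of "cis \<theta>"] f(2) by (simp add: trig_series_def sums_iff)
  hence "(\<integral>\<^sup>+\<theta>\<in>{0..2*pi}. ennreal ((norm (f (cis \<theta>)))\<^sup>2) \<partial>lborel) = ennreal (2 * pi * (\<Sum>n. (norm (taylor_coeff f n))\<^sup>2))"
    using parseval[OF sm] by simp
  moreover have "(\<Sum>n<M. (norm (taylor_coeff f n))\<^sup>2) \<le> (\<Sum>n. (norm (taylor_coeff f n))\<^sup>2)"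
    by (intro sum_le_suminf summable_norm_square sm) auto
  ultimately show ?thesis by (simp add: ennreal_leI)
qed

lemma taylor_coeff_mult:
  assumes "f holomorphic_on ball 0 R" "g holomorphic_on ball 0 R" "R > 0"
  shows "taylor_coeff (\<lambda>z. f z * g z) n = (\<Sum>i=0..n. taylor_coeff f i * taylor_coeff g (n - i))"
proof -
  have "taylor_coeff (\<lambda>z. f z * g z) n = (\<Sum>i = 0..n. of_nat (n choose i) * (deriv ^^ i) f 0 * (deriv ^^ (n-i)) g 0 / fact n)"
    unfolding taylor_coeff_def sum_divide_distrib[symmetric]
    using higher_deriv_mult[OF assms(1,2) open_ball, of 0 n] assms(3) by simp
  also have "\<dots> = (\<Sum>i=0..n. taylor_coeff f i * taylor_coeff g (n - i))"
  proof (intro sum.cong refl)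
    fix i assume "i \<in> {0..n}"
    hence "(of_nat (n choose i) :: complex) = fact n / (fact i * fact (n - i))"
      by (intro binomial_fact) auto
    thus "of_nat (n choose i) * (deriv ^^ i) f 0 * (deriv ^^ (n-i)) g 0 / fact n = taylor_coeff f i * taylor_coeff g (n - i)"
      by (simp add: taylor_coeff_def)
  qed
  finally show ?thesis .
qed

text \<open>The zero-free factor has a square root h, so f = (B h) h with both factors of squared
  modulus |f| on the circle. Coefficients of f are convolutions of those of the factors, Hilbert's
  inequality bounds the weighted sum by their squared l^2 norms, and Parseval returns the mean of
  |f|. The constant 4 is Hilbert's 2 applied to two equal bounds.\<close>

lemma hardy_inequality_circle:
  assumes f: "f holomorphic_on ball 0 R" "R > 1" and nz: "\<And>z. norm z = 1 \<Longrightarrow> f z \<noteq> 0"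
  shows "ennreal (\<Sum>n<M. norm (taylor_coeff f n) / real (n + 1)) \<le>
    4 * (ennreal (1 / (2 * pi)) * (\<integral>\<^sup>+\<theta>\<in>{0..2*pi}. ennreal (norm (f (cis \<theta>))) \<partial>lborel))"
proof -
  obtain R' B g where R': "R' > 1" and B: "B holomorphic_on ball 0 R'" and g: "g holomorphic_on ball 0 R'"
    and fac: "\<And>z. z \<in> ball 0 R' \<Longrightarrow> g z \<noteq> 0 \<and> f z = B z * g z" and B1: "\<And>z. norm z = 1 \<Longrightarrow> norm (B z) = 1"
    using blaschke_factorization[OF f nz] by blast
  obtain h where h: "h holomorphic_on ball 0 R'" and gh: "\<And>z. z \<in> ball 0 R' \<Longrightarrow> g z = h z ^ 2"
    using contractible_imp_holomorphic_sqrt[OF g convex_imp_contractible[OF convex_ball]] fac by metis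
  define k where "k z = B z * h z" for z
  have k: "k holomorphic_on ball 0 R'" unfolding k_def by (intro holomorphic_intros B h)
  have fkh: "f z = k z * h z" if "z \<in> ball 0 R'" for z
    using fac[OF that] gh[OF that] by (simp add: k_def power2_eq_square)
  have nk: "(norm (k (cis \<theta>)))\<^sup>2 = norm (f (cis \<theta>))" "(norm (h (cis \<theta>)))\<^sup>2 = norm (f (cis \<theta>))" for \<theta>
    using fac[of "cis \<theta>"] gh[of "cis \<theta>"] R' B1[of "cis \<theta>"] by (simp_all add: k_def norm_mult norm_power)
  define N where "N = (\<integral>\<^sup>+\<theta>\<in>{0..2*pi}. ennreal (norm (f (cis \<theta>))) \<partial>lborel)"
  define x y where "x n = norm (taylor_coeff k n)" and "y n = norm (taylor_coeff h n)" for n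
  have xN: "ennreal (2 * pi * (\<Sum>n<M. (x n)\<^sup>2)) \<le> N" "ennreal (2 * pi * (\<Sum>n<M. (y n)\<^sup>2)) \<le> N"
    using bessel_inequality[OF k R', of M] bessel_inequality[OF h R', of M] by (simp_all add: nk x_def y_def N_def)
  have coeff: "norm (taylor_coeff f n) \<le> (\<Sum>i=0..n. x i * y (n - i))" for n
  proof -
    have "taylor_coeff f n = taylor_coeff (\<lambda>z. k z * h z) n"
      unfolding taylor_coeff_def
    proof (intro arg_cong2[where f="(/)"] higher_deriv_cong_ev refl)
      show "eventually (\<lambda>z. f z = k z * h z) (nhds 0)"
        using eventually_nhds_in_open[of "ball 0 R'" 0] R' by (auto elim: eventually_mono simp: fkh)
    qed
    also have "\<dots> = (\<Sum>i=0..n. taylor_coeff k i * taylor_coeff h (n - i))"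
      using R' by (intro taylor_coeff_mult[OF k h]) simp
    also have "norm \<dots> \<le> (\<Sum>i=0..n. x i * y (n - i))"
      by (rule order.trans[OF norm_sum]) (simp add: norm_mult x_def y_def)
    finally show ?thesis .
  qed
  have "(\<Sum>n<M. norm (taylor_coeff f n) / real (n + 1)) \<le> (\<Sum>n<M. \<Sum>i=0..n. x i * y (n - i) / real (n + 1))"
    unfolding sum_divide_distrib[symmetric] by (intro sum_mono divide_right_mono coeff) auto
  also have "\<dots> = (\<Sum>(n, i)\<in>Sigma {..<M} (\<lambda>n. {0..n}). x i * y (n - i) / real (n + 1))"
    by (rule sum.Sigma) auto
  \<comment> \<open>Putting n = j + l turns the convolutions into a sum over a triangle, and
    nonnegativity allows enlarging it to the square.\<close>
  also have "\<dots> = (\<Sum>(j, l)\<in>{(j, l). j + l < M}. x j * y l / real (j + l + 1))"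
    by (rule sum.reindex_bij_witness[of _ "\<lambda>(j, l). (j + l, j)" "\<lambda>(n, i). (i, n - i)"]) auto
  also have "\<dots> \<le> (\<Sum>(j, l)\<in>{..<M} \<times> {..<M}. x j * y l / real (j + l + 1))"
    by (intro sum_mono2) (auto simp: x_def y_def)
  also have "\<dots> = (\<Sum>j<M. \<Sum>l<M. x j * y l / real (j + l + 1))"
    by (rule sum.cartesian_product[symmetric])
  also have "\<dots> \<le> 2 * ((\<Sum>j<M. (x j)\<^sup>2) + (\<Sum>l<M. (y l)\<^sup>2))"
    by (rule hilbert_inequality) (auto simp: x_def y_def)
  finally have "ennreal (\<Sum>n<M. norm (taylor_coeff f n) / real (n + 1)) \<le> ennreal (2 * ((\<Sum>j<M. (x j)\<^sup>2) + (\<Sum>l<M. (y l)\<^sup>2)))"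
    by (rule ennreal_leI)
  also have "\<dots> = ennreal (2 / (2 * pi)) * (ennreal (2 * pi * (\<Sum>n<M. (x n)\<^sup>2)) + ennreal (2 * pi * (\<Sum>n<M. (y n)\<^sup>2)))"
  proof -
    define X Y where "X = (\<Sum>n<M. (x n)\<^sup>2)" and "Y = (\<Sum>n<M. (y n)\<^sup>2)"
    have "0 \<le> X" "0 \<le> Y" by (simp_all add: X_def Y_def sum_nonneg)
    hence "ennreal (2 / (2 * pi)) * (ennreal (2 * pi * X) + ennreal (2 * pi * Y)) = ennreal (2 / (2 * pi) * (2 * pi * X + 2 * pi * Y))"
      by (subst ennreal_plus[symmetric], simp, simp, subst ennreal_mult[symmetric]) auto
    also have "2 / (2 * pi) * (2 * pi * X + 2 * pi * Y) = 2 * (X + Y)" by (simp add: field_simps)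
    finally show ?thesis by (simp only: X_def Y_def)
  qed
  also have "\<dots> \<le> ennreal (2 / (2 * pi)) * (N + N)"
    by (intro mult_left_mono add_mono xN) auto
  also have "\<dots> = ennreal (2 / (2 * pi)) * (ennreal 2 * N)"
    by (simp add: mult_2[symmetric])
  also have "\<dots> = ennreal (2 / (2 * pi) * 2) * N"
    by (subst ennreal_mult) (simp_all add: mult.assoc)
  also have "2 / (2 * pi) * 2 = 4 * (1 / (2 * pi))" by simp
  also have "ennreal \<dots> * N = 4 * (ennreal (1 / (2 * pi)) * N)"
    by (subst ennreal_mult) (simp_all add: mult.assoc)
  finally show ?thesis by (simp only: N_def)
qed

lemma taylor_coeff_scale:
  assumes "f holomorphic_on ball 0 1" "0 < r"
  shows "taylor_coeff (\<lambda>z. f (of_real r * z)) n = of_real r ^ n * taylor_coeff f n"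
proof -
  have "(deriv ^^ n) (\<lambda>z. f (of_real r * z)) 0 = of_real r ^ n * (deriv ^^ n) f (of_real r * 0)"
    using assms by (intro higher_deriv_compose_linear[where S="ball 0 (1 / r)" and T="ball 0 1"])
      (auto simp: norm_mult field_simps)
  thus ?thesis by (simp add: taylor_coeff_def)
qed

text \<open>The zeros in a smaller closed disc are finite in number, hence so are their moduli,
  while there are infinitely many radii to choose from.\<close>

lemma nonvanishing_circle_exists:
  assumes f: "f holomorphic_on ball 0 1" and nz: "z0 \<in> ball 0 1" "f z0 \<noteq> 0" and r: "0 < r" "r < 1"
  obtains s where "r < s" "s < 1" "\<And>z. norm z = s \<Longrightarrow> f z \<noteq> 0"
proof -
  define t where "t = (1 + r) / 2"
  have t: "r < t" "t < 1" using r by (auto simp: t_def)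
  let ?Z = "{z \<in> cball 0 t. f z = 0}"
  have fin: "finite ?Z"
  proof (cases "f constant_on ball 0 1")
    case True
    then obtain c where c: "f z = c" if "z \<in> ball 0 1" for z unfolding constant_on_def by blast
    hence "f z \<noteq> 0" if "z \<in> ball 0 1" for z using nz that by metis
    moreover have "cball 0 t \<subseteq> ball (0::complex) 1" using t by auto
    ultimately have "?Z = {}" by blast
    thus ?thesis by (simp only: finite.emptyI)
  next
    case False
    have "cball 0 t \<subseteq> ball (0::complex) 1" using t by auto
    thus ?thesis by (intro holomorphic_compact_finite_zeros[OF f open_ball connected_ball compact_cball _ False])
  qed
  have "infinite {r<..<t}" using t by simp
  hence "\<not> {r<..<t} \<subseteq> norm ` ?Z" using fin finite_subset by blast
  then obtain s where "s \<in> {r<..<t}" and s3: "s \<notin> norm ` ?Z" by blast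
  hence s: "r < s" "s < t" by auto
  have "f z \<noteq> 0" if "norm z = s" for z
    using s3 s(2) that by auto
  thus thesis using s t that[of s] by simp
qed

text \<open>Hardy's inequality. The circle version is applied to dilations of f by radii whose
  circles carry no zero; the zero function is split off since every circle is bad for it.\<close>

theorem norm_HL1_le_norm_H1:
  assumes f: "f holomorphic_on ball 0 1"
  shows "norm_HL1 f \<le> 4 * norm_H1 f"
proof (cases "norm_H1 f = \<infinity> \<or> (\<forall>z\<in>ball 0 1. f z = 0)")
  case True
  thus ?thesis
  proof
    assume "norm_H1 f = \<infinity>"
    thus ?thesis by (simp add: ennreal_mult_top)
  next
    assume *: "\<forall>z\<in>ball 0 1. f z = 0"
    have "(deriv ^^ n) f 0 = (deriv ^^ n) (\<lambda>_. 0) 0" for n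
      using * eventually_nhds_in_open[of "ball 0 1" "0::complex"]
      by (intro higher_deriv_cong_ev) (auto elim: eventually_mono)
    hence "taylor_coeff f n = 0" for n by (simp add: taylor_coeff_def)
    thus ?thesis by (simp add: norm_HL1_def)
  qed
next
  case False
  then obtain z0 where z0: "z0 \<in> ball 0 1" "f z0 \<noteq> 0" by blast
  obtain N where N: "norm_H1 f = ennreal N" "N \<ge> 0" using False by (cases "norm_H1 f") auto
  have *: "(\<Sum>n<M. norm (taylor_coeff f n) * r ^ n / real (n + 1)) \<le> 4 * N" if r: "0 < r" "r < 1" for r M
  proof -
    obtain s where s: "r < s" "s < 1" "\<And>z. norm z = s \<Longrightarrow> f z \<noteq> 0"
      using nonvanishing_circle_exists[OF f z0 r] by metis
    have s0: "0 < s" using s r by simp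
    have "(\<lambda>z. f (of_real s * z)) holomorphic_on ball 0 (1 / s)"
      using s0 s by (intro holomorphic_on_compose_gen[OF _ f, unfolded o_def] holomorphic_intros)
         (auto simp: norm_mult field_simps)
    from hardy_inequality_circle[OF this]
    have "ennreal (\<Sum>n<M. norm (taylor_coeff (\<lambda>z. f (of_real s * z)) n) / real (n + 1)) \<le>
        4 * (ennreal (1 / (2 * pi)) * (\<integral>\<^sup>+\<theta>\<in>{0..2*pi}. ennreal (norm (f (rcis s \<theta>))) \<partial>lborel))"
      using s s0 by (simp add: rcis_def norm_mult)
    also have "\<dots> \<le> 4 * norm_H1 f"
      unfolding norm_H1_def using s s0 by (intro mult_left_mono SUP_upper) auto
    also have "\<dots> = ennreal (4 * N)" using N by (simp add: ennreal_mult)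
    finally have le: "ennreal (\<Sum>n<M. norm (taylor_coeff (\<lambda>z. f (of_real s * z)) n) / real (n + 1)) \<le> ennreal (4 * N)" .
    have "(\<Sum>n<M. norm (taylor_coeff f n) * s ^ n / real (n + 1)) \<le> 4 * N"
    proof -
      have "norm (taylor_coeff (\<lambda>z. f (of_real s * z)) n) = norm (taylor_coeff f n) * s ^ n" for n
        using s0 by (simp only: taylor_coeff_scale[OF f s0]) (simp add: norm_mult norm_power)
      thus ?thesis using le N by simp
    qed
    moreover have "(\<Sum>n<M. norm (taylor_coeff f n) * r ^ n / real (n + 1)) \<le> (\<Sum>n<M. norm (taylor_coeff f n) * s ^ n / real (n + 1))"
      using s r by (intro sum_mono divide_right_mono mult_left_mono power_mono) auto
    ultimately show ?thesis by linarith
  qed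
  \<comment> \<open>For fixed M the left side at radius r is a polynomial in r, so r can tend to 1
    without a convergence question.\<close>
  have "(\<Sum>n<M. norm (taylor_coeff f n) / real (n + 1)) \<le> 4 * N" for M
  proof (rule tendsto_upperbound)
    have "((\<lambda>r. \<Sum>n<M. norm (taylor_coeff f n) * r ^ n / real (n + 1)) \<longlongrightarrow>
        (\<Sum>n<M. norm (taylor_coeff f n) * 1 ^ n / real (n + 1))) (at_left (1::real))"
      by (intro tendsto_intros) auto
    thus "((\<lambda>r. \<Sum>n<M. norm (taylor_coeff f n) * r ^ n / real (n + 1)) \<longlongrightarrow>
        (\<Sum>n<M. norm (taylor_coeff f n) / real (n + 1))) (at_left (1::real))" by simp
    show "\<forall>\<^sub>F r in at_left 1. (\<Sum>n<M. norm (taylor_coeff f n) * r ^ n / real (n + 1)) \<le> 4 * N"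
      using eventually_at_left_real[OF zero_less_one]
    proof eventually_elim
      case (elim r)
      thus ?case using *[of r M] by simp
    qed
  qed auto
  hence "(\<Sum>n<M. ennreal (norm (taylor_coeff f n) / real (n + 1))) \<le> ennreal (4 * N)" for M
    by (subst sum_ennreal) (auto intro: ennreal_leI)
  hence "norm_HL1 f \<le> ennreal (4 * N)"
    unfolding norm_HL1_def by (intro suminf_le_const) auto
  also have "\<dots> = 4 * norm_H1 f" using N by (simp add: ennreal_mult)
  finally show ?thesis .
qed

section \<open>Area integrals of derivatives\<close>

lemma borel_measurable_norm_indicator_ball:
  assumes "f holomorphic_on ball 0 1"
  shows "(\<lambda>z. ennreal (norm (f z)) * indicator (ball 0 1) z) \<in> borel_measurable borel"
proof -
  have "(\<lambda>z. indicator (ball 0 1) z *\<^sub>R f z) \<in> borel_measurable borel"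
    using assms by (intro borel_measurable_continuous_on_indicator holomorphic_on_imp_continuous_on) auto
  hence "(\<lambda>z. ennreal (norm (indicator (ball 0 1) z *\<^sub>R f z))) \<in> borel_measurable borel"
    by measurable
  also have "(\<lambda>z. ennreal (norm (indicator (ball 0 1) z *\<^sub>R f z))) = (\<lambda>z. ennreal (norm (f z)) * indicator (ball 0 1) z)"
    by (auto split: split_indicator)
  finally show ?thesis .
qed

lemma rcis_pair_measurable [measurable]: "(\<lambda>p. rcis (fst p) (snd p)) \<in> borel_measurable (borel \<Otimes>\<^sub>M borel)"
  unfolding rcis_def cis_conv_exp by measurable

lemma rcis_measurable_radius [measurable]: "(\<lambda>r. rcis r \<theta>) \<in> borel_measurable borel"
  unfolding rcis_def by measurable

lemma nn_integral_ball_eq_polar: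
  assumes "f holomorphic_on ball 0 1"
  shows "(\<integral>\<^sup>+z\<in>ball 0 1. ennreal (norm (f z)) \<partial>lborel) =
    (\<integral>\<^sup>+r\<in>{0<..<1}. ennreal r * (\<integral>\<^sup>+\<theta>\<in>{0..2*pi}. ennreal (norm (f (rcis r \<theta>))) \<partial>lborel) \<partial>lborel)"
  by (rule nn_integral_polar_ball) (rule borel_measurable_norm_indicator_ball[OF assms])

lemma taylor_coeff_deriv: "taylor_coeff (deriv f) n = of_nat (Suc n) * taylor_coeff f (Suc n)"
  by (simp add: taylor_coeff_def funpow_swap1 field_simps del: of_nat_Suc)

lemma nn_integral_power_01': "(\<integral>\<^sup>+r\<in>{0<..<1}. ennreal (r ^ Suc n) \<partial>lborel) = ennreal (1 / real (n + 2))"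
proof -
  have "(\<integral>\<^sup>+r\<in>{0<..<1}. ennreal (r ^ Suc n) \<partial>lborel) = (\<integral>\<^sup>+r\<in>{0..<1}. ennreal (r ^ Suc n) \<partial>lborel)"
    by (rule nn_integral_cong) (auto split: split_indicator simp: le_less)
  thus ?thesis using nn_integral_power_01[of "Suc n"] by simp
qed

text \<open>On each circle the mean of |f'| dominates (n + 1) times the coefficient of f times r^n.
  Integration against 2 r dr gives the factor 2 (n + 1) / (n + 2), which is at least 1.\<close>

lemma taylor_coeff_le_nn_integral_deriv:
  assumes f: "f holomorphic_on ball 0 1"
  shows "ennreal (norm (taylor_coeff f (Suc n))) \<le> ennreal (1 / pi) * (\<integral>\<^sup>+z\<in>ball 0 1. ennreal (norm (deriv f z)) \<partial>lborel)"
proof -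
  let ?e = "norm (taylor_coeff (deriv f) n)"
  have g: "deriv f holomorphic_on ball 0 1" using f by (rule holomorphic_deriv) simp
  have le: "ennreal (2 * pi * ?e) * ennreal (r ^ n) \<le> (\<integral>\<^sup>+\<theta>\<in>{0..2*pi}. ennreal (norm (deriv f (rcis r \<theta>))) \<partial>lborel)"
    if r: "0 < r" "r < 1" for r
  proof -
    note t = sums_imp_trig_series[OF taylor_sums[OF g], of r]
    have "ennreal (2 * pi * norm (taylor_coeff (deriv f) n * of_real r ^ n)) \<le>
        (\<integral>\<^sup>+\<theta>\<in>{0..2*pi}. ennreal (norm (trig_series (\<lambda>n. taylor_coeff (deriv f) n * of_real r ^ n) \<theta>)) \<partial>lborel)"
      using t r by (intro coeff_le_nn_integral_trig_series) auto
    thus ?thesis using t r by (simp add: norm_mult norm_power ennreal_mult[symmetric] mult.assoc)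
  qed
  have "ennreal (2 * pi * ?e) * ennreal (1 / real (n + 2)) = (\<integral>\<^sup>+r\<in>{0<..<1}. ennreal (2 * pi * ?e) * ennreal (r ^ Suc n) \<partial>lborel)"
    unfolding nn_integral_power_01'[symmetric]
    by (subst nn_integral_cmult[symmetric]) (auto simp: mult.assoc)
  also have "\<dots> \<le> (\<integral>\<^sup>+z\<in>ball 0 1. ennreal (norm (deriv f z)) \<partial>lborel)"
    unfolding nn_integral_ball_eq_polar[OF g]
  proof (intro nn_integral_mono)
    fix r :: real
    show "ennreal (2 * pi * ?e) * ennreal (r ^ Suc n) * indicator {0<..<1} r \<le>
      ennreal r * (\<integral>\<^sup>+\<theta>\<in>{0..2*pi}. ennreal (norm (deriv f (rcis r \<theta>))) \<partial>lborel) * indicator {0<..<1} r"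
    proof (cases "r \<in> {0<..<1}")
      case True
      hence "ennreal (2 * pi * ?e) * ennreal (r ^ Suc n) = ennreal r * (ennreal (2 * pi * ?e) * ennreal (r ^ n))"
        by (simp add: ennreal_mult mult_ac)
      thus ?thesis using True le[of r] by (simp add: mult_left_mono)
    qed simp
  qed
  finally have "ennreal (2 * pi * ?e) * ennreal (1 / real (n + 2)) \<le> (\<integral>\<^sup>+z\<in>ball 0 1. ennreal (norm (deriv f z)) \<partial>lborel)" .
  hence "ennreal (1 / pi) * (ennreal (2 * pi * ?e) * ennreal (1 / real (n + 2))) \<le>
      ennreal (1 / pi) * (\<integral>\<^sup>+z\<in>ball 0 1. ennreal (norm (deriv f z)) \<partial>lborel)"
    by (intro mult_left_mono) auto
  moreover have "norm (taylor_coeff f (Suc n)) \<le> 1 / pi * (2 * pi * ?e * (1 / real (n + 2)))"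
    by (simp add: taylor_coeff_deriv norm_mult field_simps del: of_nat_Suc) (simp add: algebra_simps mult_right_mono)
  ultimately show ?thesis
    by (subst (asm) ennreal_mult[symmetric], simp, simp, subst (asm) ennreal_mult[symmetric], simp, simp)
       (meson ennreal_leI order.trans)
qed

lemma norm_diff_le_nn_integral_deriv:
  assumes f: "f holomorphic_on ball 0 1" and ab: "0 \<le> a" "a \<le> b" "b < 1"
  shows "ennreal (norm (f (rcis b \<theta>) - f (rcis a \<theta>))) \<le> (\<integral>\<^sup>+s\<in>{a..b}. ennreal (norm (deriv f (rcis s \<theta>))) \<partial>lborel)"
proof -
  have g: "deriv f holomorphic_on ball 0 1" using f by (rule holomorphic_deriv) simp
  have c: "continuous_on {a..b} (\<lambda>s. deriv f (rcis s \<theta>) * cis \<theta>)"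
    using ab unfolding rcis_def
    by (intro continuous_intros continuous_on_compose2[OF holomorphic_on_imp_continuous_on[OF g]])
       (auto simp: norm_mult)
  have "((\<lambda>s. f (rcis s \<theta>)) has_vector_derivative deriv f (rcis s \<theta>) * cis \<theta>) (at s within {a..b})"
    if "a \<le> s" "s \<le> b" for s
  proof -
    have d: "(f has_field_derivative deriv f (rcis s \<theta>)) (at (rcis s \<theta>))"
      using f that ab by (intro holomorphic_derivI[of f "ball 0 1"]) auto
    have "((\<lambda>s. rcis s \<theta>) has_vector_derivative cis \<theta>) (at s within {a..b})"
      unfolding rcis_def by (auto intro!: derivative_eq_intros simp: has_vector_derivative_complex_iff)
    from field_vector_diff_chain_within[OF this has_field_derivative_at_within[OF d]] show ?thesis
      by (simp add: o_def mult.commute)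
  qed
  hence "integral\<^sup>L lborel (\<lambda>s. indicator {a..b} s *\<^sub>R (deriv f (rcis s \<theta>) * cis \<theta>)) = f (rcis b \<theta>) - f (rcis a \<theta>)"
    using ab c by (intro integral_FTC_atLeastAtMost) auto
  moreover have "ennreal (norm (integral\<^sup>L lborel (\<lambda>s. indicator {a..b} s *\<^sub>R (deriv f (rcis s \<theta>) * cis \<theta>)))) \<le>
     (\<integral>\<^sup>+s. ennreal (norm (indicator {a..b} s *\<^sub>R (deriv f (rcis s \<theta>) * cis \<theta>))) \<partial>lborel)"
    using borel_integrable_atLeastAtMost'[OF c] unfolding set_integrable_def
    by (intro integral_norm_bound_ennreal)
  moreover have "(\<integral>\<^sup>+s. ennreal (norm (indicator {a..b} s *\<^sub>R (deriv f (rcis s \<theta>) * cis \<theta>))) \<partial>lborel)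
     = (\<integral>\<^sup>+s\<in>{a..b}. ennreal (norm (deriv f (rcis s \<theta>))) \<partial>lborel)"
    by (intro nn_integral_cong) (simp add: norm_mult split: split_indicator)
  ultimately show ?thesis by simp
qed

text \<open>Integrating f' along radii meets the area element r dr, which degenerates at the origin.
  So the radial integration starts at 1/2, where 1 <= 2 r, and the inner disc is controlled by the
  Taylor coefficients and a geometric series.\<close>

theorem norm_H1_le_norm_D10:
  assumes f: "f holomorphic_on ball 0 1"
  shows "norm_H1 f \<le> 2 * norm_D10 f"
proof (cases "norm_D10 f = \<infinity>")
  case True
  thus ?thesis by (simp add: ennreal_mult_top)
next
  case False
  have g: "deriv f holomorphic_on ball 0 1" using f by (rule holomorphic_deriv) simp
  define A where "A = (\<integral>\<^sup>+z\<in>ball 0 1. ennreal (norm (deriv f z)) \<partial>lborel)"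
  have D: "norm_D10 f = ennreal (norm (f 0)) + ennreal (1 / pi) * A" by (simp add: norm_D10_def A_def)
  hence "ennreal (1 / pi) * A \<noteq> \<infinity>" using False by auto
  then obtain B where B: "ennreal (1 / pi) * A = ennreal B" "B \<ge> 0"
    by (cases "ennreal (1 / pi) * A") auto
  have small: "norm (f z) \<le> norm (f 0) + B" if z: "norm z \<le> 1 / 2" for z
  proof -
    have c: "norm (taylor_coeff f (Suc n)) \<le> B" for n
      using taylor_coeff_le_nn_integral_deriv[OF f, of n] B by (simp add: A_def)
    have "(\<lambda>n. taylor_coeff f n * z ^ n) sums f z" using z by (intro taylor_sums[OF f]) auto
    hence "(\<lambda>n. taylor_coeff f (Suc n) * z ^ Suc n) sums (f z - f 0)"
      by (subst sums_Suc_iff) (simp add: taylor_coeff_def)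
    moreover have le: "norm (taylor_coeff f (Suc n) * z ^ Suc n) \<le> B * (1 / 2) ^ Suc n" for n
      unfolding norm_mult norm_power using z c B by (intro mult_mono power_mono) auto
    moreover have gs: "(\<lambda>n. B * (1 / 2) ^ Suc n) sums (B * 1)"
      using power_half_series by (rule sums_mult)
    ultimately have "norm (f z - f 0) \<le> B"
      by (metis (no_types, lifting) mult_1_right norm_suminf_le sums_iff)
    thus ?thesis using norm_triangle_sub[of "f z" "f 0"] by linarith
  qed
  have meas[measurable]: "(\<lambda>z. ennreal (norm (deriv f z)) * indicator (ball 0 1) z) \<in> borel_measurable borel"
    by (rule borel_measurable_norm_indicator_ball[OF g])
  have pt: "ennreal (norm (f (rcis r \<theta>))) \<le> ennreal (norm (f 0) + B) +
     (\<integral>\<^sup>+s. ennreal (norm (deriv f (rcis s \<theta>))) * indicator (ball 0 1) (rcis s \<theta>) * indicator {1/2..<1} s \<partial>lborel)"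
    if r: "0 < r" "r < 1" for r \<theta>
  proof (cases "r \<le> 1 / 2")
    case True
    hence "ennreal (norm (f (rcis r \<theta>))) \<le> ennreal (norm (f 0) + B)" using r by (intro ennreal_leI small) auto
    thus ?thesis by (rule order.trans) simp
  next
    case False
    have "norm (f (rcis r \<theta>)) \<le> norm (f (rcis (1/2) \<theta>)) + norm (f (rcis r \<theta>) - f (rcis (1/2) \<theta>))"
      by (rule norm_triangle_sub)
    also have "norm (f (rcis (1/2) \<theta>)) \<le> norm (f 0) + B" by (intro small) auto
    finally have "ennreal (norm (f (rcis r \<theta>))) \<le> ennreal (norm (f 0) + B) + ennreal (norm (f (rcis r \<theta>) - f (rcis (1/2) \<theta>)))"
      using B by (subst ennreal_plus[symmetric]) (auto intro!: ennreal_leI simp del: ennreal_plus)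
    also have "ennreal (norm (f (rcis r \<theta>) - f (rcis (1/2) \<theta>))) \<le> (\<integral>\<^sup>+s\<in>{1/2..r}. ennreal (norm (deriv f (rcis s \<theta>))) \<partial>lborel)"
      using False r by (intro norm_diff_le_nn_integral_deriv[OF f]) auto
    also have "\<dots> \<le> (\<integral>\<^sup>+s. ennreal (norm (deriv f (rcis s \<theta>))) * indicator (ball 0 1) (rcis s \<theta>) * indicator {1/2..<1} s \<partial>lborel)"
      using r by (intro nn_integral_mono) (auto split: split_indicator)
    finally show ?thesis by (simp add: add_left_mono)
  qed
  have "ennreal (1 / (2 * pi)) * (\<integral>\<^sup>+\<theta>\<in>{0..2*pi}. ennreal (norm (f (rcis r \<theta>))) \<partial>lborel) \<le> 2 * norm_D10 f"
    if r: "0 < r" "r < 1" for r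
  proof -
    \<comment> \<open>The indicator has the value 1 on the radii in question; it is carried along to
      keep the integrand Borel on the whole plane.\<close>
    let ?G = "\<lambda>s \<theta>. ennreal (norm (deriv f (rcis s \<theta>))) * indicator (ball 0 1) (rcis s \<theta>)"
    have m2: "(\<lambda>p. ?G (fst p) (snd p)) \<in> borel_measurable (borel \<Otimes>\<^sub>M borel)"
      using measurable_compose[OF rcis_pair_measurable meas] .
    have m3[measurable]: "(\<lambda>p. ?G (snd p) (fst p)) \<in> borel_measurable (borel \<Otimes>\<^sub>M borel)"
      using measurable_compose[OF measurable_pair_swap' m2] by (simp add: case_prod_beta')
    have m4[measurable]: "(\<lambda>\<theta>. ?G s \<theta>) \<in> borel_measurable borel" for s
      using measurable_compose[OF rcis_measurable meas] .
    have m5[measurable]: "(\<lambda>s. ?G s \<theta>) \<in> borel_measurable borel" for \<theta>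
      using measurable_compose[OF rcis_measurable_radius meas] .
    have "(\<integral>\<^sup>+\<theta>\<in>{0..2*pi}. ennreal (norm (f (rcis r \<theta>))) \<partial>lborel) \<le>
       (\<integral>\<^sup>+\<theta>. ennreal (norm (f 0) + B) * indicator {0..2*pi} \<theta> +
          (\<integral>\<^sup>+s. ?G s \<theta> * indicator {1/2..<1} s \<partial>lborel) * indicator {0..2*pi} \<theta> \<partial>lborel)"
      by (intro nn_integral_mono) (auto split: split_indicator intro!: pt r)
    also have "\<dots> = (\<integral>\<^sup>+\<theta>. ennreal (norm (f 0) + B) * indicator {0..2*pi} \<theta> \<partial>lborel) +
        (\<integral>\<^sup>+\<theta>. (\<integral>\<^sup>+s. ?G s \<theta> * indicator {1/2..<1} s \<partial>lborel) * indicator {0..2*pi} \<theta> \<partial>lborel)"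
      by (rule nn_integral_add) measurable
    also have "(\<integral>\<^sup>+\<theta>. ennreal (norm (f 0) + B) * indicator {0..2*pi} \<theta> \<partial>lborel) = ennreal (norm (f 0) + B) * ennreal (2 * pi)"
      by (simp add: nn_integral_cmult_indicator)
    also have "(\<integral>\<^sup>+\<theta>. (\<integral>\<^sup>+s. ?G s \<theta> * indicator {1/2..<1} s \<partial>lborel) * indicator {0..2*pi} \<theta> \<partial>lborel)
        = (\<integral>\<^sup>+\<theta>. (\<integral>\<^sup>+s. ?G s \<theta> * indicator {1/2..<1} s * indicator {0..2*pi} \<theta> \<partial>lborel) \<partial>lborel)"
      by (subst nn_integral_multc) auto
    also have "\<dots> = (\<integral>\<^sup>+s. (\<integral>\<^sup>+\<theta>. ?G s \<theta> * indicator {1/2..<1} s * indicator {0..2*pi} \<theta> \<partial>lborel) \<partial>lborel)"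
      by (rule lborel_pair.Fubini') measurable
    also have "\<dots> \<le> (\<integral>\<^sup>+s. ennreal 2 * (ennreal s * (\<integral>\<^sup>+\<theta>\<in>{0..2*pi}. ennreal (norm (deriv f (rcis s \<theta>))) \<partial>lborel) * indicator {0<..<1} s) \<partial>lborel)"
    proof (intro nn_integral_mono)
      fix s :: real
      show "(\<integral>\<^sup>+\<theta>. ?G s \<theta> * indicator {1/2..<1} s * indicator {0..2*pi} \<theta> \<partial>lborel)
        \<le> ennreal 2 * (ennreal s * (\<integral>\<^sup>+\<theta>\<in>{0..2*pi}. ennreal (norm (deriv f (rcis s \<theta>))) \<partial>lborel) * indicator {0<..<1} s)"
      proof (cases "s \<in> {1/2..<1}")
        case True
        have "(\<integral>\<^sup>+\<theta>. ?G s \<theta> * indicator {1/2..<1} s * indicator {0..2*pi} \<theta> \<partial>lborel) =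
            1 * (\<integral>\<^sup>+\<theta>\<in>{0..2*pi}. ennreal (norm (deriv f (rcis s \<theta>))) \<partial>lborel)"
          using True by simp
        also have "\<dots> \<le> ennreal (2 * s) * (\<integral>\<^sup>+\<theta>\<in>{0..2*pi}. ennreal (norm (deriv f (rcis s \<theta>))) \<partial>lborel)"
          using True by (intro mult_right_mono) (auto simp: ennreal_1[symmetric] simp del: ennreal_1 intro!: ennreal_leI)
        finally show ?thesis using True by (simp add: ennreal_mult mult.assoc)
      qed simp
    qed
    also have "\<dots> = ennreal 2 * (\<integral>\<^sup>+s. ennreal s * (\<integral>\<^sup>+\<theta>\<in>{0..2*pi}. ennreal (norm (deriv f (rcis s \<theta>))) \<partial>lborel) * indicator {0<..<1} s \<partial>lborel)"
    proof (rule nn_integral_cmult)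
      have "(\<lambda>s. ennreal s * (\<integral>\<^sup>+\<theta>. ?G s \<theta> * indicator {0..2*pi} \<theta> \<partial>lborel) * indicator {0<..<1} s) \<in> borel_measurable lborel"
        using m2 by measurable
      also have "(\<lambda>s. ennreal s * (\<integral>\<^sup>+\<theta>. ?G s \<theta> * indicator {0..2*pi} \<theta> \<partial>lborel) * indicator {0<..<1} s)
        = (\<lambda>s. ennreal s * (\<integral>\<^sup>+\<theta>\<in>{0..2*pi}. ennreal (norm (deriv f (rcis s \<theta>))) \<partial>lborel) * indicator {0<..<1} s)"
        by (auto split: split_indicator)
      finally show "\<dots> \<in> borel_measurable lborel" .
    qed
    also have "\<dots> = ennreal 2 * A" unfolding A_def nn_integral_ball_eq_polar[OF g] ..
    finally have "ennreal (1 / (2 * pi)) * (\<integral>\<^sup>+\<theta>\<in>{0..2*pi}. ennreal (norm (f (rcis r \<theta>))) \<partial>lborel) \<le>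
       ennreal (1 / (2 * pi)) * (ennreal (norm (f 0) + B) * ennreal (2 * pi) + ennreal 2 * A)"
      by (simp add: add_left_mono mult_left_mono)
    also have "\<dots> = ennreal (norm (f 0) + B) + ennreal (1 / pi) * A"
    proof -
      have "ennreal (1 / (2 * pi)) * (ennreal (norm (f 0) + B) * ennreal (2 * pi)) = ennreal (norm (f 0) + B)"
        using B by (subst ennreal_mult[symmetric], simp, simp, subst ennreal_mult[symmetric]) auto
      moreover have "ennreal (1 / (2 * pi)) * (ennreal 2 * A) = ennreal (1 / pi) * A"
        by (subst mult.assoc[symmetric], subst ennreal_mult[symmetric]) auto
      ultimately show ?thesis by (simp only: distrib_left)
    qed
    also have "\<dots> = ennreal (norm (f 0) + 2 * B)"
      using B by (simp add: ennreal_plus[symmetric] del: ennreal_plus)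
    also have "\<dots> \<le> ennreal (2 * (norm (f 0) + B))" by (intro ennreal_leI) simp
    also have "\<dots> = 2 * norm_D10 f" unfolding D B(1) using B(2) by (simp add: ennreal_mult)
    finally show ?thesis .
  qed
  thus ?thesis unfolding norm_H1_def by (intro SUP_least) auto
qed

section \<open>Test functions\<close>

definition test_fun :: "real \<Rightarrow> complex \<Rightarrow> complex" where
  "test_fun a z = of_real ((1 - a\<^sup>2)\<^sup>2) / (1 - of_real a * z) ^ 3"

context
  fixes a :: real
  assumes a: "0 \<le> a" "a < 1"
begin

lemma test_fun_denom: "norm z < 1 \<Longrightarrow> 1 - of_real a * z \<noteq> (0 :: complex)"
proof
  assume z: "norm z < 1" and "1 - of_real a * z = 0"
  hence "norm (of_real a * z) = 1" by (metis eq_iff_diff_eq_0 norm_one)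
  moreover have "a * norm z \<le> 1 * norm z" using a by (intro mult_right_mono) auto
  ultimately show False using a z by (simp add: norm_mult)
qed

lemma holomorphic_test_fun: "test_fun a holomorphic_on ball 0 1"
  unfolding test_fun_def using test_fun_denom by (intro holomorphic_intros) auto

text \<open>The exponent 3 is chosen so that the derivative is a multiple of a perfect square: its
  L^1 means are then squared L^2 means of (1 - a z)^(-2), whose coefficients are explicit.\<close>

lemma deriv_test_fun:
  assumes "norm z < 1"
  shows "deriv (test_fun a) z = of_real (3 * a * (1 - a\<^sup>2)\<^sup>2) * (1 / (1 - of_real a * z)\<^sup>2)\<^sup>2"
proof -
  let ?d = "1 - of_real a * z"
  have d: "?d \<noteq> 0" by (rule test_fun_denom[OF assms])
  have "(test_fun a has_field_derivative
      (0 * ?d ^ 3 - of_real ((1 - a\<^sup>2)\<^sup>2) * (of_nat 3 * ((- of_real a) * ?d ^ 2))) / (?d ^ 3 * ?d ^ 3)) (at z)"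
    unfolding test_fun_def[abs_def] using d by (auto intro!: derivative_eq_intros)
  hence "deriv (test_fun a) z = (0 * ?d ^ 3 - of_real ((1 - a\<^sup>2)\<^sup>2) * (of_nat 3 * ((- of_real a) * ?d ^ 2))) / (?d ^ 3 * ?d ^ 3)"
    by (rule DERIV_imp_deriv)
  also have "\<dots> = of_real (3 * a * (1 - a\<^sup>2)\<^sup>2) * (1 / ?d\<^sup>2)\<^sup>2"
  proof -
    have "(0 * x ^ 3 - c * (of_nat 3 * ((- b) * x ^ 2))) / (x ^ 3 * x ^ 3) = 3 * b * c * (1 / x\<^sup>2)\<^sup>2"
      if "x \<noteq> 0" for x b c :: complex
      using that by (simp add: field_simps eval_nat_numeral)
    from this[OF d] show ?thesis by (simp only: of_real_mult of_real_power of_real_numeral)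
  qed
  finally show ?thesis .
qed

text \<open>Parseval computes the integral exactly. The factor (1 - a^2)^2 in
  \<open>test_fun\<close> is what the final series contributes in the denominator, so the norm stays
  bounded as a tends to 1.\<close>

lemma nn_integral_norm_deriv_test_fun:
  "(\<integral>\<^sup>+z\<in>ball 0 1. ennreal (norm (deriv (test_fun a) z)) \<partial>lborel) = ennreal (3 * pi * a)"
proof -
  have a2: "norm (a\<^sup>2) < 1" using a by (simp add: power_less_one_iff)
  have g: "deriv (test_fun a) holomorphic_on ball 0 1"
    using holomorphic_test_fun by (rule holomorphic_deriv) simp
  define c where "c = 3 * a * (1 - a\<^sup>2)\<^sup>2"
  let ?b = "\<lambda>n. 2 * pi * (c * (real (Suc n) * a ^ n)\<^sup>2)"
  have c0: "c \<ge> 0" using a by (simp add: c_def)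
  have inner: "(\<integral>\<^sup>+\<theta>\<in>{0..2*pi}. ennreal (norm (deriv (test_fun a) (rcis r \<theta>))) \<partial>lborel)
      = (\<Sum>n. ennreal (?b n * r ^ (2 * n)))" if r: "0 < r" "r < 1" for r
  proof -
    define t :: "nat \<Rightarrow> complex" where "t = (\<lambda>n. of_nat (Suc n) * of_real (a * r) ^ n)"
    have ar: "norm (complex_of_real (a * r)) < 1"
    proof -
      have "a * r \<le> 1 * r" using a r by (intro mult_right_mono) auto
      thus ?thesis using a r by (simp only: norm_of_real abs_of_nonneg mult_nonneg_nonneg less_imp_le)
    qed
    have sm: "summable (\<lambda>n. norm (t n))"
      using sums_summable[OF geometric_deriv_sums[of "a * r"]] ar a r
      by (simp add: t_def norm_mult norm_power del: of_nat_Suc)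
    have ts: "1 / (1 - of_real a * rcis r \<theta>)\<^sup>2 = trig_series t \<theta>" for \<theta>
    proof -
      have "norm (of_real a * rcis r \<theta>) < 1" using ar r by (simp add: norm_mult)
      from geometric_deriv_sums[OF this] show ?thesis
        by (simp add: t_def trig_series_def sums_iff rcis_def power_mult_distrib mult_ac)
    qed
    have "(\<integral>\<^sup>+\<theta>\<in>{0..2*pi}. ennreal (norm (deriv (test_fun a) (rcis r \<theta>))) \<partial>lborel)
       = (\<integral>\<^sup>+\<theta>. ennreal c * (ennreal ((norm (trig_series t \<theta>))\<^sup>2) * indicator {0..2*pi} \<theta>) \<partial>lborel)"
    proof (intro nn_integral_cong)
      fix \<theta> :: real
      have "deriv (test_fun a) (rcis r \<theta>) = of_real c * (trig_series t \<theta>)\<^sup>2"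
        using r by (subst deriv_test_fun) (auto simp only: norm_rcis_eq ts c_def)
      hence "norm (deriv (test_fun a) (rcis r \<theta>)) = c * (norm (trig_series t \<theta>))\<^sup>2"
        using c0 by (simp only: norm_mult norm_power norm_of_real abs_of_nonneg)
      thus "ennreal (norm (deriv (test_fun a) (rcis r \<theta>))) * indicator {0..2*pi} \<theta>
         = ennreal c * (ennreal ((norm (trig_series t \<theta>))\<^sup>2) * indicator {0..2*pi} \<theta>)"
        using ennreal_mult[OF c0 zero_le_power2] by (simp only: mult.assoc)
    qed
    also have "\<dots> = ennreal c * ennreal (2 * pi * (\<Sum>n. (norm (t n))\<^sup>2))"
      using trig_series_borel[OF sm] by (subst nn_integral_cmult) (auto simp: parseval[OF sm])
    also have "\<dots> = ennreal (\<Sum>n. c * (2 * pi * (norm (t n))\<^sup>2))"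
      using c0 summable_norm_square[OF sm]
      by (subst ennreal_mult[symmetric]) (auto simp: suminf_mult summable_mult suminf_nonneg)
    also have "\<dots> = (\<Sum>n. ennreal (c * (2 * pi * (norm (t n))\<^sup>2)))"
      using c0 summable_norm_square[OF sm]
      by (intro suminf_ennreal_norm[symmetric] summable_mult) auto
    also have "\<dots> = (\<Sum>n. ennreal (?b n * r ^ (2 * n)))"
      using a r by (intro suminf_cong arg_cong[where f=ennreal])
        (simp add: t_def norm_mult norm_power power_mult_distrib power_mult[symmetric] mult_ac del: of_nat_Suc)
    finally show ?thesis .
  qed
  have "(\<integral>\<^sup>+z\<in>ball 0 1. ennreal (norm (deriv (test_fun a) z)) \<partial>lborel)
      = (\<integral>\<^sup>+r. (\<Sum>n. ennreal (?b n) * (ennreal (r ^ Suc (2 * n)) * indicator {0<..<1} r)) \<partial>lborel)"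
    unfolding nn_integral_ball_eq_polar[OF g]
  proof (intro nn_integral_cong)
    fix r :: real
    show "ennreal r * (\<integral>\<^sup>+\<theta>\<in>{0..2*pi}. ennreal (norm (deriv (test_fun a) (rcis r \<theta>))) \<partial>lborel) * indicator {0<..<1} r
      = (\<Sum>n. ennreal (?b n) * (ennreal (r ^ Suc (2 * n)) * indicator {0<..<1} r))"
    proof (cases "r \<in> {0<..<1}")
      case True
      hence "ennreal r * (\<Sum>n. ennreal (?b n * r ^ (2 * n))) = (\<Sum>n. ennreal (?b n) * ennreal (r ^ Suc (2 * n)))"
        using c0 unfolding ennreal_suminf_cmult[symmetric]
        by (intro suminf_cong) (simp add: ennreal_mult[symmetric] mult_ac del: of_nat_Suc)
      thus ?thesis using True inner[of r] by simp
    qed simp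
  qed
  also have "\<dots> = (\<Sum>n. ennreal (?b n) * ennreal (1 / real (2 * n + 2)))"
    by (subst nn_integral_suminf) (auto simp: nn_integral_cmult nn_integral_power_01' simp del: power_Suc)
  \<comment> \<open>Integration over r cancels one of the two factors n + 1, and what remains is the
    derivative of a geometric series in a^2.\<close>
  also have "\<dots> = (\<Sum>n. ennreal (pi * c * (real (Suc n) * (a\<^sup>2) ^ n)))"
  proof (intro suminf_cong)
    fix n
    have "?b n * (1 / real (2 * n + 2)) = pi * c * (real (Suc n) * (a\<^sup>2) ^ n)"
      by (simp add: field_simps power2_eq_square power_mult_distrib)
    thus "ennreal (?b n) * ennreal (1 / real (2 * n + 2)) = ennreal (pi * c * (real (Suc n) * (a\<^sup>2) ^ n))"
      using c0 by (subst ennreal_mult[symmetric]) auto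
  qed
  also have "\<dots> = ennreal (\<Sum>n. pi * c * (real (Suc n) * (a\<^sup>2) ^ n))"
    using c0 sums_summable[OF geometric_deriv_sums[OF a2]]
    by (intro suminf_ennreal_norm summable_mult) auto
  also have "(\<Sum>n. pi * c * (real (Suc n) * (a\<^sup>2) ^ n)) = pi * c * (1 / (1 - a\<^sup>2)\<^sup>2)"
    using sums_mult[OF geometric_deriv_sums[OF a2]] by (simp only: sums_iff)
  also have "\<dots> = 3 * pi * a" using a2 by (simp add: c_def)
  finally show ?thesis .
qed

lemma norm_D10_test_fun_le: "norm_D10 (test_fun a) \<le> 4"
proof -
  have "norm_D10 (test_fun a) = ennreal ((1 - a\<^sup>2)\<^sup>2) + ennreal (3 * a)"
  proof -
    have "test_fun a 0 = of_real ((1 - a\<^sup>2)\<^sup>2)" by (simp add: test_fun_def)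
    hence "norm (test_fun a 0) = (1 - a\<^sup>2)\<^sup>2" by (simp only: norm_of_real abs_of_nonneg zero_le_power2)
    moreover have "ennreal (1 / pi) * ennreal (3 * pi * a) = ennreal (3 * a)"
      using a by (subst ennreal_mult[symmetric]) auto
    ultimately show ?thesis unfolding norm_D10_def nn_integral_norm_deriv_test_fun by simp
  qed
  also have "\<dots> = ennreal ((1 - a\<^sup>2)\<^sup>2 + 3 * a)" using a by (subst ennreal_plus) auto
  also have "\<dots> \<le> ennreal 4"
  proof (rule ennreal_leI)
    have "(1 - a\<^sup>2)\<^sup>2 \<le> 1" using a by (intro power_le_one) (auto simp: power_le_one)
    thus "(1 - a\<^sup>2)\<^sup>2 + 3 * a \<le> 4" using a by linarith
  qed
  finally show ?thesis by simp
qed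

text \<open>For t >= a the denominator is at most (1 - a^2)^3. This lower bound lets the test
  function detect the mass of a measure on [a,1).\<close>

lemma test_fun_ge:
  assumes "a \<le> t" "t < 1"
  shows "1 / (2 * (1 - a)) \<le> (1 - a\<^sup>2)\<^sup>2 / (1 - a * t) ^ 3"
proof -
  have "a * a \<le> a * t" using assms a by (intro mult_left_mono) auto
  moreover have "a * t \<le> 1 * t" using assms a by (intro mult_right_mono) auto
  hence "a * t < 1" using assms by simp
  ultimately have d: "0 < 1 - a * t" "1 - a * t \<le> 1 - a\<^sup>2" by (auto simp: power2_eq_square)
  have "1 / (2 * (1 - a)) \<le> 1 / (1 - a\<^sup>2)"
  proof (rule divide_left_mono)
    have "(1 - a) * (1 + a) \<le> (1 - a) * 2" using a by (intro mult_left_mono) auto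
    thus "1 - a\<^sup>2 \<le> 2 * (1 - a)" by (simp add: algebra_simps power2_eq_square)
  qed (use a d in auto)
  also have "\<dots> = (1 - a\<^sup>2)\<^sup>2 / (1 - a\<^sup>2) ^ 3" using d by (simp add: eval_nat_numeral)
  also have "\<dots> \<le> (1 - a\<^sup>2)\<^sup>2 / (1 - a * t) ^ 3"
    using d by (intro divide_left_mono power_mono mult_pos_pos zero_less_power) auto
  finally show ?thesis .
qed

lemma test_fun_nonneg:
  assumes "0 \<le> t" "t < 1"
  shows "0 \<le> (1 - a\<^sup>2)\<^sup>2 / (1 - a * t) ^ 3"
proof -
  have "a * t \<le> 1" using assms a by (intro mult_le_one) auto
  thus ?thesis by simp
qed

end

text \<open>With \<open>u = N (1 - t)\<close> one has \<open>1 - a t \<le> (1 + u) / N\<close>, \<open>(1 + u)\<^sup>3 \<le> exp (3 u)\<close> and \<open>t \<le> exp (t - 1)\<close>.\<close>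

lemma test_fun_ge_power:
  assumes N: "N \<ge> 1" and t: "0 \<le> t" "t < 1" and a: "a = 1 - 1 / real N"
  shows "real N * t ^ (3 * N) \<le> (1 - a\<^sup>2)\<^sup>2 / (1 - a * t) ^ 3"
proof -
  define u where "u = real N * (1 - t)"
  have u: "u \<ge> 0" using t by (simp add: u_def)
  have a01: "0 \<le> a" "a < 1" using N by (auto simp: a)
  have "a * t \<le> 1 * t" using a01 t by (intro mult_right_mono) auto
  hence d: "0 < 1 - a * t" using t by simp
  have "1 - a * t = (1 - a) + a * (1 - t)" by (simp add: algebra_simps)
  also have "\<dots> \<le> (1 - a) + 1 * (1 - t)" using a01 t by (intro add_left_mono mult_right_mono) auto
  also have "\<dots> = (1 + u) / real N" using N by (simp add: a u_def field_simps)
  finally have le: "1 - a * t \<le> (1 + u) / real N" .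
  have "t \<le> exp (t - 1)" using exp_ge_add_one_self[of "t - 1"] by simp
  hence "t ^ (3 * N) \<le> exp (t - 1) ^ (3 * N)" using t by (intro power_mono) auto
  also have "\<dots> = exp (- u) ^ 3"
    by (simp add: exp_of_nat_mult[symmetric] u_def algebra_simps)
  finally have tu: "t ^ (3 * N) \<le> exp (- u) ^ 3" .
  have "(1 + u) * exp (- u) \<le> exp u * exp (- u)"
    using exp_ge_add_one_self[of u] by (intro mult_right_mono) auto
  hence "((1 + u) * exp (- u)) ^ 3 \<le> 1"
    using u by (intro power_le_one mult_nonneg_nonneg) (auto simp flip: exp_add)
  hence e: "(1 + u) ^ 3 * exp (- u) ^ 3 \<le> 1" by (simp add: power_mult_distrib)
  have "real N * t ^ (3 * N) * (1 - a * t) ^ 3 \<le> real N * exp (- u) ^ 3 * ((1 + u) / real N) ^ 3"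
    using tu le d t by (intro mult_mono power_mono mult_nonneg_nonneg) auto
  also have "\<dots> = (1 / real N)\<^sup>2 * ((1 + u) ^ 3 * exp (- u) ^ 3)"
    using N by (simp add: field_simps eval_nat_numeral)
  also have "\<dots> \<le> (1 / real N)\<^sup>2 * 1" by (intro mult_left_mono e) auto
  also have "\<dots> = (1 - a)\<^sup>2" by (simp add: a)
  also have "\<dots> \<le> (1 - a\<^sup>2)\<^sup>2"
    using a01 by (intro power_mono) (auto simp: power2_eq_square mult_left_le)
  finally show ?thesis using d by (simp add: pos_le_divide_eq)
qed

section \<open>Moments and tails of radial weights\<close>

text \<open>The finite measure \<omega>(t) dt on [0,1), placed on the Borel sets of the line. The
  weight is only Lebesgue measurable, so the density is taken over \<open>lebesgue\<close> and then
  pushed forward by the identity; from there on all product measurability is Borel.\<close>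

definition weight_measure :: "(real \<Rightarrow> real) \<Rightarrow> real measure" where
  "weight_measure \<omega> = distr (density lebesgue (\<lambda>t. ennreal (indicator {0..<1} t * \<omega> t))) borel (\<lambda>x. x)"

locale weight =
  fixes \<omega> :: "real \<Rightarrow> real"
  assumes rw: "radial_weight \<omega>"
begin

abbreviation "\<nu> \<equiv> weight_measure \<omega>"

text \<open>The set \<open>{s..}\<close> gives the same mass as [s,1) and makes \<open>W\<close>
  total and antitone on the whole line.\<close>

definition W :: "real \<Rightarrow> real" where "W s = measure \<nu> {s..}"

definition m :: "nat \<Rightarrow> real" where "m n = (\<integral>t. t ^ n \<partial>\<nu>)"

text \<open>The extended-valued form of \<open>inv_tail_int\<close>: total and monotone on the whole
  line, so that Tonelli applies without integrability conditions.\<close>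

definition J :: "real \<Rightarrow> ennreal" where "J t = (\<integral>\<^sup>+s\<in>{0..<t}. ennreal (1 / W s) \<partial>lborel)"

lemma nonneg: "t \<in> {0..<1} \<Longrightarrow> 0 \<le> \<omega> t"
  using rw by (simp add: radial_weight_def)

lemma integrable_weight: "integrable lebesgue (\<lambda>t. indicator {0..<1} t * \<omega> t)"
  using rw by (simp add: radial_weight_def set_integrable_def)

lemma weight_measurable [measurable]: "(\<lambda>t. indicator {0..<1} t * \<omega> t) \<in> borel_measurable lebesgue"
  using integrable_weight by (rule borel_measurable_integrable)

lemma ind_nonneg: "0 \<le> indicator {0..<1} t * \<omega> t"
  using nonneg by (simp split: split_indicator)

lemma id_measurable: "(\<lambda>x. x) \<in> measurable (density lebesgue f) borel"
  by (auto intro!: measurable_completion)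

lemma sets_weight [simp, measurable_cong]: "sets \<nu> = sets borel"
  by (simp add: weight_measure_def)

lemma space_weight [simp]: "space \<nu> = UNIV"
  by (simp add: weight_measure_def)

lemma nn_integral_weight:
  assumes [measurable]: "h \<in> borel_measurable borel"
  shows "(\<integral>\<^sup>+t. h t \<partial>\<nu>) = (\<integral>\<^sup>+t\<in>{0..<1}. h t * ennreal (\<omega> t) \<partial>lebesgue)"
proof -
  have "h \<in> borel_measurable lebesgue" using assms by (rule measurable_completion[of h lborel, simplified])
  thus ?thesis
    unfolding weight_measure_def
    by (subst nn_integral_distr[OF id_measurable]; simp add: nn_integral_density)
       (auto intro!: nn_integral_cong simp: mult.commute split: split_indicator)
qed

lemma finite_measure_weight: "finite_measure \<nu>"
proof (rule finite_measureI)
  have "emeasure \<nu> (space \<nu>) = (\<integral>\<^sup>+t. 1 \<partial>\<nu>)" by simp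
  also have "\<dots> = (\<integral>\<^sup>+t. ennreal (indicator {0..<1} t * \<omega> t) \<partial>lebesgue)"
    by (subst nn_integral_weight) (auto intro!: nn_integral_cong split: split_indicator)
  also have "\<dots> < \<infinity>" using integrable_weight ind_nonneg by (subst nn_integral_eq_integral) auto
  finally show "emeasure \<nu> (space \<nu>) \<noteq> \<infinity>" by simp
qed

sublocale finite_measure \<nu> by (rule finite_measure_weight)

lemma integral_weight:
  fixes h :: "real \<Rightarrow> 'a::{banach, second_countable_topology}"
  assumes [measurable]: "h \<in> borel_measurable borel"
  shows "integrable \<nu> h \<longleftrightarrow> set_integrable lebesgue {0..<1} (\<lambda>t. \<omega> t *\<^sub>R h t)"
    and "integral\<^sup>L \<nu> h = (LINT t:{0..<1}|lebesgue. \<omega> t *\<^sub>R h t)"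
proof -
  have h: "h \<in> borel_measurable lebesgue" using assms by (rule measurable_completion[of h lborel, simplified])
  show "integrable \<nu> h \<longleftrightarrow> set_integrable lebesgue {0..<1} (\<lambda>t. \<omega> t *\<^sub>R h t)"
    unfolding weight_measure_def set_integrable_def using h
    by (subst integrable_distr_eq[OF id_measurable assms], subst integrable_density) (auto simp: ind_nonneg)
  show "integral\<^sup>L \<nu> h = (LINT t:{0..<1}|lebesgue. \<omega> t *\<^sub>R h t)"
    unfolding weight_measure_def set_lebesgue_integral_def using h
    by (subst integral_distr[OF id_measurable assms], subst integral_density) (auto simp: ind_nonneg)
qed

text \<open>The point 0 is discarded along with the complement of [0,1), since the bound for the
  kernel is stated for t > 0.\<close>

lemma AE_weight: "AE t in \<nu>. 0 < t \<and> t < 1"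
proof -
  have "emeasure \<nu> {t. \<not> (0 < t \<and> t < 1)} = (\<integral>\<^sup>+t. indicator {t. \<not> (0 < t \<and> t < 1)} t \<partial>\<nu>)" by simp
  also have "\<dots> = (\<integral>\<^sup>+t\<in>{0..<1}. indicator {t. \<not> (0 < t \<and> t < 1)} t * ennreal (\<omega> t) \<partial>lebesgue)"
    by (rule nn_integral_weight) simp
  also have "\<dots> = integral\<^sup>N lebesgue (\<lambda>t::real. 0)"
  proof (rule nn_integral_cong_AE)
    have "AE t in lebesgue. t \<noteq> (0::real)"
      using AE_lborel_singleton[of 0] by (rule AE_completion)
    thus "AE t in lebesgue. indicator {t. \<not> (0 < t \<and> t < 1)} t * ennreal (\<omega> t) * indicator {0..<1} t = 0"
      by eventually_elim (auto split: split_indicator)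
  qed
  finally show ?thesis by (intro AE_I'[where N="{t. \<not> (0 < t \<and> t < 1)}"]) (auto simp: null_sets_def)
qed

lemma emeasure_atLeastLessThan_1: "emeasure \<nu> {s..<1} = ennreal (W s)"
  unfolding W_def emeasure_eq_measure[symmetric]
  by (rule emeasure_eq_AE) (use AE_weight in \<open>auto elim: eventually_mono\<close>)

lemma tail_int_eq: "0 \<le> s \<Longrightarrow> tail_int \<omega> s = W s"
proof -
  assume s: "0 \<le> s"
  have "W s = (\<integral>t. indicator {s..} t \<partial>\<nu>)" by (simp add: W_def)
  also have "\<dots> = (LINT t:{0..<1}|lebesgue. \<omega> t *\<^sub>R indicator {s..} t)" by (rule integral_weight) simp
  also have "\<dots> = tail_int \<omega> s"
    unfolding tail_int_def set_lebesgue_integral_def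
    by (intro Bochner_Integration.integral_cong refl) (use s in \<open>auto split: split_indicator\<close>)
  finally show ?thesis ..
qed

lemma W_pos: "s < 1 \<Longrightarrow> 0 < W s"
proof -
  assume "s < 1"
  hence "max 0 s \<in> {0..<1}" by auto
  moreover have "\<forall>r\<in>{0..<1}. 0 < tail_int \<omega> r" using rw by (simp add: radial_weight_def)
  ultimately have "0 < tail_int \<omega> (max 0 s)" by blast
  hence "0 < W (max 0 s)" by (simp only: tail_int_eq max.cobounded1)
  also have "\<dots> \<le> W s" unfolding W_def by (intro finite_measure_mono) auto
  finally show ?thesis .
qed

lemma W_antimono: "s \<le> t \<Longrightarrow> W t \<le> W s"
  unfolding W_def by (intro finite_measure_mono) auto

lemma W_nonneg: "0 \<le> W s" by (simp add: W_def)

lemma W_measurable [measurable]: "W \<in> borel_measurable borel"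
proof -
  have "(\<lambda>s. - W s) \<in> borel_measurable borel"
    by (rule borel_measurable_mono) (auto simp: mono_def W_antimono)
  thus ?thesis by (simp add: borel_measurable_uminus_eq)
qed

lemma integrable_power: "integrable \<nu> (\<lambda>t. t ^ n)"
  by (rule integrable_const_bound[where B=1], use AE_weight in eventually_elim) (auto simp: power_le_one)

text \<open>The real power and the natural power disagree only at t = 0, where 0 powr 0 = 0 but 0^0
  = 1.\<close>

lemma moment_eq: "moment \<omega> (real n) = m n"
proof -
  have "m n = (LINT t:{0..<1}|lebesgue. \<omega> t *\<^sub>R t ^ n)" unfolding m_def by (rule integral_weight) simp
  also have "\<dots> = moment \<omega> (real n)"
    unfolding moment_def set_lebesgue_integral_def
  proof (rule integral_cong_AE)
    have "AE t in lebesgue. t \<noteq> (0::real)"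
      using AE_lborel_singleton[of 0] by (rule AE_completion)
    thus "AE t in lebesgue. indicator {0..<1} t *\<^sub>R \<omega> t *\<^sub>R t ^ n = indicator {0..<1} t *\<^sub>R (t powr real n * \<omega> t)"
      by eventually_elim (auto simp: powr_realpow split: split_indicator)
    have p: "(\<lambda>t::real. t ^ n) \<in> borel_measurable lebesgue" "(\<lambda>t::real. t powr real n) \<in> borel_measurable lebesgue"
      by (rule measurable_completion, simp)+
    have m: "(\<lambda>t. t ^ n * (indicator {0..<1} t * \<omega> t)) \<in> borel_measurable lebesgue"
      "(\<lambda>t. t powr real n * (indicator {0..<1} t * \<omega> t)) \<in> borel_measurable lebesgue"
      by (intro borel_measurable_times weight_measurable p)+
    show "(\<lambda>t. indicator {0..<1} t *\<^sub>R \<omega> t *\<^sub>R t ^ n) \<in> borel_measurable lebesgue"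
      "(\<lambda>t. indicator {0..<1} t *\<^sub>R (t powr real n * \<omega> t)) \<in> borel_measurable lebesgue"
      using m by (simp_all add: mult_ac)
  qed
  finally show ?thesis ..
qed

lemma m_antimono: "k \<le> n \<Longrightarrow> m n \<le> m k"
  unfolding m_def
  by (rule integral_mono_AE[OF integrable_power integrable_power], use AE_weight in eventually_elim)
     (auto intro: power_decreasing)

lemma m_0: "m 0 = W 0"
proof -
  have "measure \<nu> UNIV = measure \<nu> {0..}"
    by (rule measure_eq_AE) (use AE_weight in \<open>auto elim: eventually_mono\<close>)
  thus ?thesis by (simp add: m_def W_def)
qed

lemma m_ge: "0 \<le> r \<Longrightarrow> r ^ n * W r \<le> m n"
proof -
  assume r: "0 \<le> r"
  have "r ^ n * W r = (\<integral>t. r ^ n * indicator {r..} t \<partial>\<nu>)" by (simp add: W_def)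
  also have "\<dots> \<le> m n"
    unfolding m_def
  proof (rule integral_mono_AE)
    show "integrable \<nu> (\<lambda>t. r ^ n * indicator {r..} t)"
      by (intro integrable_mult_right integrable_real_indicator) (auto simp: emeasure_eq_measure)
    show "AE t in \<nu>. r ^ n * indicator {r..} t \<le> t ^ n"
      using AE_weight by eventually_elim (use r in \<open>auto split: split_indicator intro: power_mono\<close>)
  qed (rule integrable_power)
  finally show ?thesis .
qed

lemma m_pos: "0 < m n"
  using m_ge[of "1/2" n] W_pos[of "1/2"] by (auto intro: less_le_trans[rotated])

lemma m_nonneg [simp]: "0 \<le> m n" using m_pos[of n] by simp

lemma nn_integral_power: "(\<integral>\<^sup>+t. ennreal (t ^ n) \<partial>\<nu>) = ennreal (m n)"
  unfolding m_def
  by (rule nn_integral_eq_integral[OF integrable_power], use AE_weight in eventually_elim) auto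

lemma J_eq: "0 \<le> t \<Longrightarrow> t < 1 \<Longrightarrow> J t = ennreal (inv_tail_int \<omega> t)"
proof -
  assume t: "0 \<le> t" "t < 1"
  have m: "(\<lambda>s. indicator {0..<t} s * (1 / W s)) \<in> borel_measurable borel" by measurable
  have b: "norm (indicator {0..<t} s * (1 / W s)) \<le> (1 / W t) * indicator {0..<t} s" for s
  proof (cases "s \<in> {0..<t}")
    case True
    hence "1 / W s \<le> 1 / W t" using t W_pos[of s] W_pos[of t] by (intro divide_left_mono W_antimono) auto
    thus ?thesis using True by (simp add: W_nonneg)
  qed simp
  have int: "integrable lborel (\<lambda>s. indicator {0..<t} s * (1 / W s))"
  proof (rule Bochner_Integration.integrable_bound)
    show "integrable lborel (\<lambda>s. (1 / W t) * indicator {0..<t} s)"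
      by (intro integrable_mult_right integrable_real_indicator) (use t in auto)
    show "AE s in lborel. norm (indicator {0..<t} s * (1 / W s)) \<le> norm ((1 / W t) * indicator {0..<t} s :: real)"
      using b by (intro AE_I2) (metis abs_ge_self order.trans real_norm_def)
  qed (use m in simp)
  have "inv_tail_int \<omega> t = integral\<^sup>L lebesgue (\<lambda>s. indicator {0..<t} s * (1 / W s))"
    unfolding inv_tail_int_def set_lebesgue_integral_def
    by (intro Bochner_Integration.integral_cong refl) (auto simp: tail_int_eq split: split_indicator)
  also have "\<dots> = integral\<^sup>L lborel (\<lambda>s. indicator {0..<t} s * (1 / W s))"
    using m by (intro integral_completion) simp
  finally have "ennreal (inv_tail_int \<omega> t) = (\<integral>\<^sup>+s. ennreal (indicator {0..<t} s * (1 / W s)) \<partial>lborel)"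
    using int by (subst nn_integral_eq_integral) (auto simp: W_nonneg)
  also have "\<dots> = J t" unfolding J_def by (intro nn_integral_cong) (auto split: split_indicator)
  finally show ?thesis ..
qed

lemma inv_tail_int_nonneg: "0 \<le> inv_tail_int \<omega> t"
  unfolding inv_tail_int_def set_lebesgue_integral_def
  by (intro integral_nonneg_AE AE_I2) (auto simp: tail_int_eq W_nonneg split: split_indicator)

lemma J_mono: "s \<le> t \<Longrightarrow> J s \<le> J t"
  unfolding J_def by (intro nn_integral_mono) (auto split: split_indicator)

lemma J_measurable [measurable]: "J \<in> borel_measurable borel"
proof -
  have "J = (\<lambda>t. \<integral>\<^sup>+s. (if 0 \<le> s \<and> s < t then ennreal (1 / W s) else 0) \<partial>lborel)"
    unfolding J_def by (intro ext nn_integral_cong) auto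
  thus ?thesis by simp
qed

section \<open>The doubling condition in terms of moments\<close>

definition doubling :: "real \<Rightarrow> bool" where
  "doubling C \<longleftrightarrow> C > 1 \<and> (\<forall>r\<in>{0..<1}. W r \<le> C * W ((1 + r) / 2))"

lemma Dhat_iff: "\<omega> \<in> Dhat \<longleftrightarrow> (\<exists>C. doubling C)"
proof -
  have "\<omega> \<in> Dhat \<longleftrightarrow> (\<exists>C>1. \<forall>r\<in>{0..<1}. tail_int \<omega> r \<le> C * tail_int \<omega> ((1 + r) / 2))"
    using rw by (simp add: Dhat_def)
  also have "\<dots> \<longleftrightarrow> (\<exists>C. doubling C)"
    unfolding doubling_def by (intro ex_cong1 conj_cong ball_cong refl) (auto simp: tail_int_eq)
  finally show ?thesis .
qed

text \<open>The map x to max 0 (2 x - 1) inverts r to (1 + r) / 2, so the doubling condition says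
  that the tails of \<nu> are dominated by those of its image measure. Integrating the n-th power
  and using 2 x - 1 <= x^2 gives the claim.\<close>

lemma m_doubling:
  assumes C: "doubling C" and n: "n \<ge> 1"
  shows "m n \<le> C * m (2 * n)"
proof -
  let ?f = "\<lambda>x::real. max 0 (2 * x - 1)"
  have f[measurable]: "?f \<in> measurable \<nu> borel" by (simp add: measurable_cong_sets[OF sets_weight refl])
  have "(\<integral>\<^sup>+x\<in>{0..<1}. ennreal (x ^ n) \<partial>\<nu>) \<le> ennreal C * (\<integral>\<^sup>+x\<in>{0..<1}. ennreal (x ^ n) \<partial>distr \<nu> borel ?f)"
  proof (rule nn_integral_mono_tail_dominated)
    show "sigma_finite_measure \<nu>" by (rule sigma_finite_measure_axioms)
    show "sigma_finite_measure (distr \<nu> borel ?f)"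
    proof -
      interpret D: finite_measure "distr \<nu> borel ?f" by (rule finite_measure_distr[OF f])
      show ?thesis by (rule D.sigma_finite_measure_axioms)
    qed
    fix a :: real assume a: "a \<in> {0..<1}"
    have "emeasure \<nu> {a..<1} = ennreal (W a)" by (rule emeasure_atLeastLessThan_1)
    also have "\<dots> \<le> ennreal (C * W ((1 + a) / 2))" using C a by (intro ennreal_leI) (auto simp: doubling_def)
    also have "\<dots> = ennreal C * emeasure \<nu> {(1 + a) / 2..<1}"
      using C W_nonneg by (simp add: emeasure_atLeastLessThan_1 ennreal_mult doubling_def)
    also have "\<dots> \<le> ennreal C * emeasure (distr \<nu> borel ?f) {a..<1}"
    proof -
      have "?f -` {a..<1} \<in> sets \<nu>" using measurable_sets[OF f, of "{a..<1}"] by simp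
      thus ?thesis
        using a by (subst emeasure_distr[OF f]) (auto intro!: mult_left_mono emeasure_mono)
    qed
    finally show "emeasure \<nu> {a..<1} \<le> ennreal C * emeasure (distr \<nu> borel ?f) {a..<1}" .
  qed (auto intro: power_mono)
  also have "(\<integral>\<^sup>+x\<in>{0..<1}. ennreal (x ^ n) \<partial>distr \<nu> borel ?f) = (\<integral>\<^sup>+x. ennreal (?f x ^ n) * indicator {0..<1} (?f x) \<partial>\<nu>)"
    by (rule nn_integral_distr[OF f]) simp
  also have "\<dots> \<le> (\<integral>\<^sup>+x. ennreal (x ^ (2 * n)) \<partial>\<nu>)"
  proof (intro nn_integral_mono_AE)
    show "AE x in \<nu>. ennreal (?f x ^ n) * indicator {0..<1} (?f x) \<le> ennreal (x ^ (2 * n))"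
      using AE_weight
    proof eventually_elim
      case (elim x)
      have "0 \<le> (x - 1)\<^sup>2" by simp
      hence "2 * x - 1 \<le> x\<^sup>2" by (simp add: power2_eq_square algebra_simps)
      hence "?f x \<le> x\<^sup>2" by simp
      hence "?f x ^ n \<le> (x\<^sup>2) ^ n" by (intro power_mono) auto
      thus ?case by (auto simp: power_mult split: split_indicator intro: ennreal_leI)
    qed
  qed
  also have "(\<integral>\<^sup>+x\<in>{0..<1}. ennreal (x ^ n) \<partial>\<nu>) = (\<integral>\<^sup>+x. ennreal (x ^ n) \<partial>\<nu>)"
    by (rule nn_integral_cong_AE, use AE_weight in eventually_elim) auto
  finally have "ennreal (m n) \<le> ennreal C * ennreal (m (2 * n))"
    by (simp add: nn_integral_power mult_left_mono)
  thus ?thesis using C m_pos[of "2 * n"] by (simp add: ennreal_mult[symmetric] doubling_def)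
qed

text \<open>Iteration bounds m n by C^k m (2^k n). In that moment the part of the integral below
  \<rho> = 1 - 1/(2 n) is at most exp(-(2^k - 1) / 2) times m n; for large k it is absorbed into the
  left side, and only the tail at \<rho> is left.\<close>

lemma tail_ge_moment:
  assumes D: "\<And>n. n \<ge> 1 \<Longrightarrow> m n \<le> C * m (2 * n)" and "C > 1"
  obtains K where "K > 0" "\<And>n. n \<ge> 1 \<Longrightarrow> m n \<le> K * W (1 - 1 / (2 * real n))"
proof -
  have iter: "m n \<le> C ^ k * m (2 ^ k * n)" if "n \<ge> 1" for n k
  proof (induction k)
    case (Suc k)
    have "m (2 ^ k * n) \<le> C * m (2 * (2 ^ k * n))" using that by (intro D) (simp add: Suc_leI)
    hence "C ^ k * m (2 ^ k * n) \<le> C ^ k * (C * m (2 * (2 ^ k * n)))"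
      using \<open>C > 1\<close> by (intro mult_left_mono) auto
    with Suc show ?case by (simp add: mult_ac)
  qed simp
  \<comment> \<open>The double exponential in k beats C^k, so one k serves all n.\<close>
  have "(\<lambda>k::nat. C ^ k * exp (- ((2 ^ k - 1) / 2))) \<longlonglongrightarrow> 0"
    using \<open>C > 1\<close> by real_asymp
  from order_tendstoD(2)[OF this, of "1/2"] obtain k where k: "C ^ k * exp (- ((2 ^ k - 1) / 2)) < 1 / 2"
    by (auto simp: eventually_sequentially)
  have "m n \<le> 2 * C ^ k * W (1 - 1 / (2 * real n))" if n: "n \<ge> 1" for n
  proof -
    define \<rho> where "\<rho> = 1 - 1 / (2 * real n)"
    have \<rho>: "0 \<le> \<rho>" "\<rho> < 1" using n by (auto simp: \<rho>_def field_simps)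
    have split: "2 ^ k * n = (2 ^ k - 1) * n + n"
    proof -
      have "(2 ^ k - 1) * n + n = ((2 ^ k - 1) + 1) * n" by (simp only: distrib_right mult_1)
      thus ?thesis by simp
    qed
    have "m (2 ^ k * n) \<le> (\<integral>t. \<rho> ^ ((2 ^ k - 1) * n) * t ^ n + indicator {\<rho>..} t \<partial>\<nu>)"
      unfolding m_def
    proof (rule integral_mono_AE)
      show "integrable \<nu> (\<lambda>t. \<rho> ^ ((2 ^ k - 1) * n) * t ^ n + indicator {\<rho>..} t)"
        by (intro Bochner_Integration.integrable_add integrable_mult_right integrable_power integrable_real_indicator)
           (auto simp: emeasure_eq_measure)
      show "AE t in \<nu>. t ^ (2 ^ k * n) \<le> \<rho> ^ ((2 ^ k - 1) * n) * t ^ n + indicator {\<rho>..} t"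
        using AE_weight
      proof eventually_elim
        case (elim t)
        show ?case
        proof (cases "\<rho> \<le> t")
          case True
          have "t ^ (2 ^ k * n) \<le> 1" using elim by (intro power_le_one) auto
          thus ?thesis using True \<rho> elim by (simp add: add_increasing)
        next
          case False
          hence "t ^ ((2 ^ k - 1) * n) \<le> \<rho> ^ ((2 ^ k - 1) * n)" using elim by (intro power_mono) auto
          hence "t ^ ((2 ^ k - 1) * n) * t ^ n \<le> \<rho> ^ ((2 ^ k - 1) * n) * t ^ n"
            using elim by (intro mult_right_mono) auto
          thus ?thesis using False by (subst split) (simp add: power_add)
        qed
      qed
    qed (rule integrable_power)
    also have "\<dots> = \<rho> ^ ((2 ^ k - 1) * n) * m n + W \<rho>"
      by (subst Bochner_Integration.integral_add)
        (auto simp: m_def W_def emeasure_eq_measure intro!: integrable_mult_right integrable_power integrable_real_indicator)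
    finally have le: "m (2 ^ k * n) \<le> \<rho> ^ ((2 ^ k - 1) * n) * m n + W \<rho>" .
    have "\<rho> \<le> exp (- (1 / (2 * real n)))"
      unfolding \<rho>_def using exp_ge_add_one_self[of "- (1 / (2 * real n))"] by simp
    hence "\<rho> ^ ((2 ^ k - 1) * n) \<le> exp (- (1 / (2 * real n))) ^ ((2 ^ k - 1) * n)"
      using \<rho> by (intro power_mono) auto
    also have "\<dots> = exp (- ((2 ^ k - 1) / 2))"
      using n by (simp add: exp_of_nat_mult[symmetric] of_nat_diff)
    finally have "C ^ k * \<rho> ^ ((2 ^ k - 1) * n) \<le> C ^ k * exp (- ((2 ^ k - 1) / 2))"
      using \<open>C > 1\<close> by (intro mult_left_mono) auto
    hence half: "C ^ k * \<rho> ^ ((2 ^ k - 1) * n) \<le> 1 / 2" using k by linarith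
    have "m n \<le> C ^ k * (\<rho> ^ ((2 ^ k - 1) * n) * m n + W \<rho>)"
      using iter[OF n, of k] le \<open>C > 1\<close> by (meson mult_left_mono order.trans zero_le_power less_imp_le zero_less_one order.strict_trans)
    also have "\<dots> = (C ^ k * \<rho> ^ ((2 ^ k - 1) * n)) * m n + C ^ k * W \<rho>" by (simp add: algebra_simps)
    also have "\<dots> \<le> 1 / 2 * m n + C ^ k * W \<rho>"
      using half m_pos[of n] by (intro add_right_mono mult_right_mono) auto
    finally show ?thesis by (simp add: \<rho>_def)
  qed
  thus thesis using that[of "2 * C ^ k"] \<open>C > 1\<close> by simp
qed

text \<open>For 0 < x <= 1/2 one has 1 / (1 - x) <= exp(x / (1 - x)) <= exp(2 x); here x = 1 / (n +
  1).\<close>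

lemma power_one_minus_ge:
  assumes "n \<ge> 1"
  shows "exp (- (2 * real k / real (n + 1))) \<le> (1 - 1 / real (n + 1)) ^ k"
proof -
  define x where "x = 1 / real (n + 1)"
  have x: "0 < x" "x \<le> 1 / 2" using assms by (auto simp: x_def field_simps)
  have "1 / (1 - x) = 1 + x / (1 - x)" using x by (simp add: field_simps)
  also have "\<dots> \<le> exp (x / (1 - x))" by (rule exp_ge_add_one_self)
  also have "\<dots> \<le> exp (2 * x)" using x by (simp add: field_simps)
  finally have "exp (- (2 * x)) \<le> 1 - x" using x by (simp add: exp_minus field_simps)
  hence "exp (- (2 * x)) ^ k \<le> (1 - x) ^ k" by (intro power_mono) auto
  thus ?thesis by (simp add: exp_of_nat_mult[symmetric] x_def mult_ac)
qed

text \<open>With n the integer part of 1 / (1 - r), the moment m n mediates between the two tails: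
  \<open>m_ge\<close> compares it with the tail at r, and moment doubling with
  \<open>tail_ge_moment\<close> compares it with the tail at (1 + r) / 2.\<close>

lemma Dhat_if_moment_doubling:
  assumes D: "\<And>n. n \<ge> 1 \<Longrightarrow> m n \<le> C * m (2 * n)" and C: "C > 1"
  shows "\<omega> \<in> Dhat"
proof -
  obtain K where K: "K > 0" "\<And>n. n \<ge> 1 \<Longrightarrow> m n \<le> K * W (1 - 1 / (2 * real n))"
    using tail_ge_moment[OF D C] by blast
  \<comment> \<open>The bound exp 4 works for n >= 2. For n = 1 the point 1 - 1/n is 0, whose powers
    vanish, and the ratio W 0 / m 1 takes over.\<close>
  define L where "L = max (exp 4) (W 0 / m 1)"
  have L: "L \<ge> exp 4" "L \<ge> W 0 / m 1" by (auto simp: L_def)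
  have L0: "L > 0" using L(1) by (meson exp_gt_zero less_le_trans)
  have main: "W r \<le> L * (C * K) * W ((1 + r) / 2)" if r: "0 \<le> r" "r < 1" for r
  proof -
    define n where "n = nat \<lfloor>1 / (1 - r)\<rfloor>"
    have fl: "1 \<le> \<lfloor>1 / (1 - r)\<rfloor>" using r by (simp add: le_floor_iff)
    have n1: "n \<ge> 1" using fl unfolding n_def by linarith
    have "real n = of_int \<lfloor>1 / (1 - r)\<rfloor>" unfolding n_def by (rule of_nat_nat) (use fl in linarith)
    hence rn: "real n \<le> 1 / (1 - r)" "1 / (1 - r) < real n + 1"
      by linarith+
    have r1: "1 - 1 / real n \<le> r" "1 / real (n + 1) < 1 - r"
      using rn n1 r by (auto simp: field_simps)
    have Wr: "W r \<le> L * m n"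
    proof (cases "n = 1")
      case True
      have "W r \<le> W 0" using r by (intro W_antimono)
      also have "\<dots> = W 0 / m 1 * m 1" using m_pos[of 1] by simp
      also have "\<dots> \<le> L * m 1" using L m_pos[of 1] by (intro mult_right_mono) auto
      finally show ?thesis using True by simp
    next
      case False
      define j where "j = n - 1"
      have j: "n = j + 1" "j \<ge> 1" using n1 False by (auto simp: j_def)
      have "exp (- 4) \<le> exp (- (2 * real n / real (j + 1)))" by (simp add: j field_simps)
      also have "\<dots> \<le> (1 - 1 / real n) ^ n" using power_one_minus_ge[OF j(2), of n] by (simp add: j)
      finally have e: "exp (- 4) \<le> (1 - 1 / real n) ^ n" .
      have "W r \<le> W (1 - 1 / real n)" by (intro W_antimono r1)
      also have "\<dots> = exp 4 * (exp (- 4) * W (1 - 1 / real n))" by (simp add: exp_minus)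
      also have "\<dots> \<le> exp 4 * ((1 - 1 / real n) ^ n * W (1 - 1 / real n))"
        using e W_nonneg by (intro mult_left_mono mult_right_mono) auto
      also have "\<dots> \<le> exp 4 * m n" using n1 by (intro mult_left_mono m_ge) (auto simp: field_simps)
      also have "\<dots> \<le> L * m n" using L m_pos[of n] by (intro mult_right_mono) auto
      finally show ?thesis .
    qed
    \<comment> \<open>Doubling is spent on passing from n to n + 1 <= 2 n: as 1/(n + 1) < 1 - r, the
      point 1 - 1/(2 (n + 1)) lies to the right of (1 + r) / 2.\<close>
    have "m n \<le> C * m (2 * n)" by (rule D[OF n1])
    also have "\<dots> \<le> C * m (n + 1)" using n1 C by (intro mult_left_mono m_antimono) auto
    also have "\<dots> \<le> C * (K * W (1 - 1 / (2 * real (n + 1))))" using C by (intro mult_left_mono K) auto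
    also have "\<dots> \<le> C * (K * W ((1 + r) / 2))"
      using r1 C K by (intro mult_left_mono W_antimono) (auto simp: field_simps)
    finally have "L * m n \<le> L * (C * (K * W ((1 + r) / 2)))" using L0 by (intro mult_left_mono) auto
    with Wr show ?thesis by (simp add: mult_ac)
  qed
  have "doubling (max 2 (L * (C * K)))"
    unfolding doubling_def
  proof (intro conjI ballI)
    fix r :: real assume r: "r \<in> {0..<1}"
    hence "W r \<le> L * (C * K) * W ((1 + r) / 2)" by (intro main) auto
    also have "\<dots> \<le> max 2 (L * (C * K)) * W ((1 + r) / 2)" by (intro mult_right_mono W_nonneg) auto
    finally show "W r \<le> max 2 (L * (C * K)) * W ((1 + r) / 2)" .
  qed simp
  thus ?thesis using Dhat_iff by blast
qed

section \<open>The constants\<close>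


abbreviation "I \<equiv> inv_tail_int \<omega>"

text \<open>W a * I a is the boundary term when the integral of \<omega> I over [a,1) is integrated
  by parts. This inequality is the form of the condition to which all the others are
  reduced.\<close>

definition parts_bound :: "real \<Rightarrow> bool" where
  "parts_bound M \<longleftrightarrow> (\<forall>a\<in>{0..<1}. W a * I a \<le> M * (1 - a))"

lemma parts_boundD: "parts_bound M \<Longrightarrow> 0 \<le> a \<Longrightarrow> a < 1 \<Longrightarrow> W a * I a \<le> M * (1 - a)"
  by (simp add: parts_bound_def)

lemma I_mono: "0 \<le> s \<Longrightarrow> s \<le> t \<Longrightarrow> t < 1 \<Longrightarrow> I s \<le> I t"
  using J_mono[of s t] J_eq[of s] J_eq[of t] inv_tail_int_nonneg[of t] by simp

lemma M1d_finite_iff: "M1d \<omega> < \<infinity> \<longleftrightarrow> (\<exists>M. parts_bound M)"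
proof
  assume "M1d \<omega> < \<infinity>"
  then obtain M where M: "M1d \<omega> = ennreal M" "M \<ge> 0" by (cases "M1d \<omega>") auto
  have "W a * I a \<le> M * (1 - a)" if a: "a \<in> {0..<1}" for a
  proof -
    have "ennreal (tail_int \<omega> a / (1 - a) * I a) \<le> ennreal M"
      unfolding M(1)[symmetric] M1d_def using a by (intro SUP_upper)
    hence "W a / (1 - a) * I a \<le> M" using M a by (simp add: tail_int_eq)
    thus ?thesis using a by (simp add: field_simps)
  qed
  thus "\<exists>M. parts_bound M" unfolding parts_bound_def by blast
next
  assume "\<exists>M. parts_bound M"
  then obtain M where M: "parts_bound M" by blast
  have "M1d \<omega> \<le> ennreal M"
    unfolding M1d_def
  proof (intro SUP_least ennreal_leI)
    fix a :: real assume a: "a \<in> {0..<1}"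
    hence "W a * I a \<le> M * (1 - a)" using M by (simp add: parts_bound_def)
    thus "tail_int \<omega> a / (1 - a) * I a \<le> M" using a by (simp add: tail_int_eq field_simps)
  qed
  thus "M1d \<omega> < \<infinity>" by (metis ennreal_less_top infinity_ennreal_def le_less_trans)
qed

lemma nn_integral_mu:
  assumes "0 \<le> a" and [measurable]: "h \<in> borel_measurable borel"
  shows "(\<integral>\<^sup>+t\<in>{a..<1}. h t * ennreal (\<omega> t * I t) \<partial>lebesgue) = (\<integral>\<^sup>+t\<in>{a..<1}. h t * J t \<partial>\<nu>)"
proof -
  have "(\<integral>\<^sup>+t\<in>{a..<1}. h t * J t \<partial>\<nu>) = (\<integral>\<^sup>+t\<in>{0..<1}. (h t * J t * indicator {a..<1} t) * ennreal (\<omega> t) \<partial>lebesgue)"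
    by (rule nn_integral_weight) simp
  also have "\<dots> = (\<integral>\<^sup>+t\<in>{a..<1}. h t * ennreal (\<omega> t * I t) \<partial>lebesgue)"
    using assms(1) by (intro nn_integral_cong)
      (auto simp: J_eq ennreal_mult inv_tail_int_nonneg nonneg mult_ac split: split_indicator)
  finally show ?thesis ..
qed

text \<open>Integration by parts in the form of Tonelli's theorem on s < t. Values s < a see the
  whole mass W a and give the boundary term; values s >= a see at most W s, which cancels 1 / W s
  and leaves the length 1 - a.\<close>

lemma nn_integral_J_le:
  assumes a: "0 \<le> a" "a < 1"
  shows "(\<integral>\<^sup>+t\<in>{a..<1}. J t \<partial>\<nu>) \<le> ennreal (W a) * J a + ennreal (1 - a)"
proof -
  interpret P: pair_sigma_finite lborel \<nu> ..
  let ?g = "\<lambda>s t. (if 0 \<le> s \<and> s < t \<and> a \<le> t \<and> t < 1 then ennreal (1 / W s) else 0)"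
  have "(\<integral>\<^sup>+t\<in>{a..<1}. J t \<partial>\<nu>) = (\<integral>\<^sup>+t. (\<integral>\<^sup>+s. ?g s t \<partial>lborel) \<partial>\<nu>)"
  proof (intro nn_integral_cong)
    fix t :: real
    show "J t * indicator {a..<1} t = (\<integral>\<^sup>+s. ?g s t \<partial>lborel)"
    proof (cases "t \<in> {a..<1}")
      case True
      thus ?thesis unfolding J_def by (auto intro!: nn_integral_cong split: split_indicator)
    qed auto
  qed
  also have "\<dots> = (\<integral>\<^sup>+s. (\<integral>\<^sup>+t. ?g s t \<partial>\<nu>) \<partial>lborel)"
    by (rule P.Fubini') (simp add: case_prod_beta')
  also have "\<dots> \<le> (\<integral>\<^sup>+s. ennreal (W a) * (ennreal (1 / W s) * indicator {0..<a} s) + indicator {a..<1} s \<partial>lborel)"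
  proof (intro nn_integral_mono)
    fix s :: real
    consider "s < 0 \<or> s \<ge> 1" | "0 \<le> s" "s < a" | "a \<le> s" "s < 1" by linarith
    thus "(\<integral>\<^sup>+t. ?g s t \<partial>\<nu>) \<le> ennreal (W a) * (ennreal (1 / W s) * indicator {0..<a} s) + indicator {a..<1} s"
    proof cases
      case 1
      hence "(\<integral>\<^sup>+t. ?g s t \<partial>\<nu>) = (\<integral>\<^sup>+t. 0 \<partial>\<nu>)" by (intro nn_integral_cong) auto
      thus ?thesis by simp
    next
      case 2
      have "(\<integral>\<^sup>+t. ?g s t \<partial>\<nu>) = (\<integral>\<^sup>+t. ennreal (1 / W s) * indicator {a..<1} t \<partial>\<nu>)"
        using 2 by (intro nn_integral_cong) (auto split: split_indicator)
      also have "\<dots> = ennreal (1 / W s) * ennreal (W a)"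
        by (subst nn_integral_cmult_indicator) (auto simp: emeasure_atLeastLessThan_1)
      finally show ?thesis using 2 by (simp add: mult.commute)
    next
      case 3
      have "(\<integral>\<^sup>+t. ?g s t \<partial>\<nu>) \<le> (\<integral>\<^sup>+t. ennreal (1 / W s) * indicator {s..<1} t \<partial>\<nu>)"
        using 3 by (intro nn_integral_mono) (auto split: split_indicator)
      also have "\<dots> = ennreal (1 / W s) * ennreal (W s)"
        by (subst nn_integral_cmult_indicator) (auto simp: emeasure_atLeastLessThan_1)
      also have "\<dots> = 1" using W_pos[OF 3(2)] by (simp add: ennreal_mult[symmetric])
      finally show ?thesis using 3 by simp
    qed
  qed
  also have "\<dots> = ennreal (W a) * J a + ennreal (1 - a)"
    unfolding J_def using a by (subst nn_integral_add) (auto simp: nn_integral_cmult)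
  finally show ?thesis .
qed

text \<open>One direction is monotonicity of J on [a,1); the other is
  \<open>nn_integral_J_le\<close>, whose extra term 1 - a only adds 1 to the constant.\<close>

lemma M1c_finite_iff: "M1c \<omega> < \<infinity> \<longleftrightarrow> (\<exists>M. parts_bound M)"
proof
  assume "M1c \<omega> < \<infinity>"
  then obtain M where M: "M1c \<omega> = ennreal M" "M \<ge> 0" by (cases "M1c \<omega>") auto
  have "W a * I a \<le> M * (1 - a)" if a: "a \<in> {0..<1}" for a
  proof -
    have "ennreal (W a * I a) = J a * emeasure \<nu> {a..<1}"
      using a J_eq[of a] by (simp add: emeasure_atLeastLessThan_1 ennreal_mult W_nonneg inv_tail_int_nonneg mult.commute)
    also have "\<dots> = (\<integral>\<^sup>+t. J a * indicator {a..<1} t \<partial>\<nu>)" by (simp add: nn_integral_cmult_indicator)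
    also have "\<dots> \<le> (\<integral>\<^sup>+t\<in>{a..<1}. J t \<partial>\<nu>)"
      by (intro nn_integral_mono) (auto split: split_indicator intro: J_mono)
    finally have "ennreal (1 / (1 - a)) * ennreal (W a * I a) \<le> ennreal (1 / (1 - a)) * (\<integral>\<^sup>+t\<in>{a..<1}. J t \<partial>\<nu>)"
      by (intro mult_left_mono) auto
    also have "\<dots> \<le> ennreal M"
      unfolding M(1)[symmetric] M1c_def
      using a nn_integral_mu[of a "\<lambda>_. 1"] by (intro SUP_upper2[OF a]) simp
    finally have "1 / (1 - a) * (W a * I a) \<le> M"
      using a M by (simp add: ennreal_mult[symmetric] W_nonneg inv_tail_int_nonneg)
    thus ?thesis using a by (simp add: field_simps)
  qed
  thus "\<exists>M. parts_bound M" unfolding parts_bound_def by blast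
next
  assume "\<exists>M. parts_bound M"
  then obtain M where M: "parts_bound M" by blast
  have "M1c \<omega> \<le> ennreal (M + 1)"
    unfolding M1c_def
  proof (intro SUP_least)
    fix a :: real assume a: "a \<in> {0..<1}"
    have "(\<integral>\<^sup>+t\<in>{a..<1}. ennreal (\<omega> t * I t) \<partial>lebesgue) \<le> ennreal (W a) * J a + ennreal (1 - a)"
      using a nn_integral_mu[of a "\<lambda>_. 1"] nn_integral_J_le[of a] by simp
    also have "\<dots> = ennreal (W a * I a + (1 - a))"
      using a J_eq[of a] by (simp add: ennreal_mult[symmetric] ennreal_plus[symmetric] W_nonneg inv_tail_int_nonneg del: ennreal_plus)
    also have "\<dots> \<le> ennreal ((M + 1) * (1 - a))"
      using M a by (intro ennreal_leI) (auto simp: parts_bound_def algebra_simps)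
    finally have "ennreal (1 / (1 - a)) * (\<integral>\<^sup>+t\<in>{a..<1}. ennreal (\<omega> t * I t) \<partial>lebesgue) \<le> ennreal (1 / (1 - a)) * ennreal ((M + 1) * (1 - a))"
      by (intro mult_left_mono) auto
    also have "\<dots> = ennreal (M + 1)" using a by (simp add: ennreal_mult'[symmetric])
    finally show "ennreal (1 / (1 - a)) * (\<integral>\<^sup>+t\<in>{a..<1}. ennreal (\<omega> t * I t) \<partial>lebesgue) \<le> ennreal (M + 1)" .
  qed
  thus "M1c \<omega> < \<infinity>" by (metis ennreal_less_top infinity_ennreal_def le_less_trans)
qed

text \<open>For r < a the integral I a is at least (a - r) / W r, so the hypothesis at a bounds the
  ratio W a / W r by M (1 - a) / (a - r).\<close>

lemma Dcheck_if_parts_bound: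
  assumes "parts_bound M"
  shows "\<omega> \<in> Dcheck"
proof -
  define C where "C = max M 1"
  have C: "C \<ge> M" "C \<ge> 1" by (auto simp: C_def)
  \<comment> \<open>With a = 1 - (1 - r) / K the ratio (a - r) / (1 - a) equals K - 1, and K - 1 = 2
    C turns the estimate into 2 W a <= W r.\<close>
  define K where "K = 1 + 2 * C"
  have K: "K > 1" using C by (simp add: K_def)
  have main: "2 * W (1 - (1 - r) / K) \<le> W r" if r: "0 \<le> r" "r < 1" for r
  proof -
    define a where "a = 1 - (1 - r) / K"
    have ra: "1 - a = (1 - r) / K" by (simp add: a_def)
    have "(1 - r) / K \<le> (1 - r) / 1" using r K by (intro divide_left_mono) auto
    hence a: "r \<le> a" by (simp add: a_def)
    have "0 < (1 - r) / K" using r K by simp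
    hence a1: "a < 1" "0 \<le> a" using a r by (auto simp: a_def)
    have "ennreal ((1 / W r) * (a - r)) = (\<integral>\<^sup>+s. ennreal (1 / W r) * indicator {r..<a} s \<partial>lborel)"
      using a W_nonneg[of r] by (subst nn_integral_cmult_indicator) (auto simp: ennreal_mult[symmetric])
    also have "\<dots> \<le> J a"
      unfolding J_def
    proof (intro nn_integral_mono)
      fix s :: real
      show "ennreal (1 / W r) * indicator {r..<a} s \<le> ennreal (1 / W s) * indicator {0..<a} s"
        using r a1 W_pos[of r] W_pos[of s] W_antimono[of r s]
        by (auto split: split_indicator intro!: ennreal_leI divide_left_mono)
    qed
    also have "\<dots> = ennreal (I a)" using a1 by (simp add: J_eq)
    finally have "(1 / W r) * (a - r) \<le> I a" by (simp add: inv_tail_int_nonneg)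
    hence "W a * ((1 / W r) * (a - r)) \<le> W a * I a" by (intro mult_left_mono W_nonneg)
    also have "\<dots> \<le> M * (1 - a)" using assms a1 by (simp add: parts_bound_def)
    also have "\<dots> \<le> C * (1 - a)" using C a1 by (intro mult_right_mono) auto
    finally have "W a * (a - r) \<le> C * (1 - a) * W r"
      using W_pos[of r] r by (simp add: field_simps)
    moreover have "a - r = (K - 1) * (1 - a)" using K by (simp add: ra) (simp add: a_def field_simps)
    ultimately have "W a * ((K - 1) * (1 - a)) \<le> C * (1 - a) * W r" by (simp only:)
    moreover have "W a * ((K - 1) * (1 - a)) = (W a * 2) * (C * (1 - a))" by (simp add: K_def)
    moreover have "C * (1 - a) * W r = W r * (C * (1 - a))" by (simp only: mult_ac)
    ultimately have "(W a * 2) * (C * (1 - a)) \<le> W r * (C * (1 - a))" by (simp only:)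
    moreover have "0 < C * (1 - a)" using C a1 by (intro mult_pos_pos) auto
    ultimately have "W a * 2 \<le> W r" by (rule mult_right_le_imp_le)
    thus ?thesis by (simp add: a_def)
  qed
  have "tail_int \<omega> r \<ge> 2 * tail_int \<omega> (1 - (1 - r) / K)" if r: "r \<in> {0..<1}" for r
  proof -
    have "(1 - r) / K \<le> 1" using r K by (simp add: divide_le_eq)
    thus ?thesis using main[of r] r by (simp add: tail_int_eq)
  qed
  thus ?thesis using rw K unfolding Dcheck_def by (intro CollectI conjI exI[of _ K] exI[of _ 2]) auto
qed

section \<open>Discretisation at the points 1 - 1/(k + 1)\<close>

definition node :: "nat \<Rightarrow> real" where "node k = 1 - 1 / real (k + 1)"

lemma node_bounds: "0 \<le> node k" "node k < 1" "node k < node (Suc k)"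
  by (auto simp: node_def field_simps)

lemma node_mono: "i \<le> k \<Longrightarrow> node i \<le> node k"
  by (auto simp: node_def intro!: divide_left_mono)

text \<open>The gaps have the size of the weights 1 / (k + 1)^2 in \<open>M1\<close>, which makes
  the sum there a Riemann sum for the integral of 1 / W.\<close>

lemma node_diff: "node (Suc k) - node k = 1 / (real (k + 1) * real (k + 2))"
  by (simp add: node_def field_simps)

lemma node_bucket:
  assumes "0 \<le> s" "s < 1"
  obtains k where "node k \<le> s" "s < node (Suc k)"
proof -
  have fl: "1 \<le> \<lfloor>1 / (1 - s)\<rfloor>" using assms by (simp add: le_floor_iff)
  define k where "k = nat (\<lfloor>1 / (1 - s)\<rfloor> - 1)"
  have "real k = of_int (\<lfloor>1 / (1 - s)\<rfloor> - 1)" unfolding k_def by (rule of_nat_nat) (use fl in linarith)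
  hence "real k + 1 \<le> 1 / (1 - s)" "1 / (1 - s) < real k + 2" by linarith+
  hence "node k \<le> s" "s < node (Suc k)" using assms by (auto simp: node_def field_simps)
  thus thesis by (rule that)
qed

text \<open>For k >= 1 this is \<open>tail_ge_moment\<close> at 2 k, since 1 - 1/(4 k) is not to the
  left of \<open>node (Suc k)\<close>. For k = 0 it is one doubling step, from 0 to
  \<open>node 1\<close> = 1/2.\<close>

lemma W_node_ge_moment:
  assumes "doubling C"
  obtains K where "K > 0" "\<And>k. m (2 * k) \<le> K * W (node (Suc k))"
proof -
  have C: "C > 1" "W 0 \<le> C * W ((1 + 0) / 2)" using assms unfolding doubling_def by force+
  obtain K where K: "K > 0" "\<And>n. n \<ge> 1 \<Longrightarrow> m n \<le> K * W (1 - 1 / (2 * real n))"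
    using tail_ge_moment[of C] m_doubling[OF assms] C by blast
  have "m (2 * k) \<le> (K + C) * W (node (Suc k))" for k
  proof (cases "k = 0")
    case True
    have "C * W (node (Suc 0)) \<le> (K + C) * W (node (Suc 0))"
      using K C by (intro mult_right_mono W_nonneg) auto
    thus ?thesis using C True by (simp add: m_0 node_def)
  next
    case False
    have "m (2 * k) \<le> K * W (1 - 1 / (2 * real (2 * k)))" using False by (intro K) simp
    also have "\<dots> \<le> K * W (node (Suc k))"
      using False K unfolding node_def by (intro mult_left_mono W_antimono diff_left_mono divide_left_mono) auto
    also have "\<dots> \<le> (K + C) * W (node (Suc k))" using C by (intro mult_right_mono W_nonneg) auto
    finally show ?thesis .
  qed
  thus thesis using that[of "K + C"] K C by simp
qed

lemma W_node_le_moment: "N \<ge> 1 \<Longrightarrow> W (node N) \<le> exp 4 * m (2 * N)"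
proof -
  assume N: "N \<ge> 1"
  have "exp (- 4) \<le> exp (- (2 * real (2 * N) / real (N + 1)))" by (simp add: field_simps)
  also have "\<dots> \<le> node N ^ (2 * N)" unfolding node_def by (rule power_one_minus_ge[OF N])
  finally have "exp (- 4) * W (node N) \<le> node N ^ (2 * N) * W (node N)" by (intro mult_right_mono W_nonneg)
  also have "\<dots> \<le> m (2 * N)" by (intro m_ge node_bounds)
  finally show ?thesis by (simp add: exp_minus field_simps)
qed

definition M1_sum :: "nat \<Rightarrow> real" where
  "M1_sum N = (\<Sum>k=0..N. 1 / (real (k + 1) ^ 2 * m (2 * k)))"

lemma M1_sum_nonneg: "0 \<le> M1_sum N"
  unfolding M1_sum_def by (intro sum_nonneg) auto

lemma M1_finite_iff: "M1 \<omega> < \<infinity> \<longleftrightarrow> (\<exists>M. \<forall>N\<ge>1. real (N + 1) * m (2 * N) * M1_sum N \<le> M)"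
proof -
  have mm: "moment \<omega> (2 * real k) = m (2 * k)" for k using moment_eq[of "2 * k"] by simp
  have M1: "M1 \<omega> = (SUP N\<in>{1::nat..}. ennreal (real (N + 1) * m (2 * N) * M1_sum N))"
    unfolding M1_def M1_sum_def mm ..
  have nn: "0 \<le> real (N + 1) * m (2 * N) * M1_sum N" for N
    by (intro mult_nonneg_nonneg M1_sum_nonneg) auto
  show ?thesis
  proof
    assume "M1 \<omega> < \<infinity>"
    then obtain M where M: "M1 \<omega> = ennreal M" "M \<ge> 0" by (cases "M1 \<omega>") auto
    have "real (N + 1) * m (2 * N) * M1_sum N \<le> M" if "N \<ge> 1" for N
    proof -
      have "ennreal (real (N + 1) * m (2 * N) * M1_sum N) \<le> ennreal M"
        unfolding M(1)[symmetric] M1 using that by (intro SUP_upper) simp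
      thus ?thesis using M by simp
    qed
    thus "\<exists>M. \<forall>N\<ge>1. real (N + 1) * m (2 * N) * M1_sum N \<le> M" by blast
  next
    assume "\<exists>M. \<forall>N\<ge>1. real (N + 1) * m (2 * N) * M1_sum N \<le> M"
    then obtain M where "\<forall>N\<ge>1. real (N + 1) * m (2 * N) * M1_sum N \<le> M" by blast
    hence "M1 \<omega> \<le> ennreal M" unfolding M1 by (intro SUP_least ennreal_leI) auto
    thus "M1 \<omega> < \<infinity>" by (metis ennreal_less_top infinity_ennreal_def le_less_trans)
  qed
qed

text \<open>On the k-th gap 1 / W s is at most K / m(2 k), so I a is at most a multiple of
  \<open>M1_sum N\<close> when a lies in the N-th gap. There W a is at most exp 4 times m(2 N), and
  1 - a is comparable to 1 / (N + 1).\<close>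

lemma parts_bound_if_M1:
  assumes C: "doubling C" and M: "\<And>N. N \<ge> 1 \<Longrightarrow> real (N + 1) * m (2 * N) * M1_sum N \<le> M"
  shows "\<exists>M'. parts_bound M'"
proof -
  obtain K where K: "K > 0" "\<And>k. m (2 * k) \<le> K * W (node (Suc k))" using W_node_ge_moment[OF C] by blast
  note sum0 = M1_sum_nonneg
  have "0 \<le> real (1 + 1) * m (2 * 1) * M1_sum 1" by (intro mult_nonneg_nonneg M1_sum_nonneg) auto
  hence M0: "0 \<le> M" using M[of 1] by linarith
  have Ia: "I a \<le> K * M1_sum N" if a: "0 \<le> a" "node N \<le> a" "a < node (Suc N)" for a N
  proof -
    have a1: "a < 1" using a node_bounds[of "Suc N"] by simp
    have "ennreal (I a) = J a" using a a1 by (simp add: J_eq)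
    also have "\<dots> \<le> (\<integral>\<^sup>+s. (\<Sum>k=0..N. ennreal (1 / W (node (Suc k))) * indicator {node k..<node (Suc k)} s) \<partial>lborel)"
      unfolding J_def
    proof (intro nn_integral_mono)
      fix s :: real
      show "ennreal (1 / W s) * indicator {0..<a} s \<le> (\<Sum>k=0..N. ennreal (1 / W (node (Suc k))) * indicator {node k..<node (Suc k)} s)"
      proof (cases "s \<in> {0..<a}")
        case True
        then obtain k where k: "node k \<le> s" "s < node (Suc k)" using node_bucket[of s] a1 by auto
        have "k \<le> N"
        proof (rule ccontr)
          assume "\<not> k \<le> N"
          hence "node (Suc N) \<le> node k" by (intro node_mono) auto
          thus False using k True a by simp
        qed
        have "1 / W s \<le> 1 / W (node (Suc k))"
          using k node_bounds[of "Suc k"] W_pos[of s] W_pos[of "node (Suc k)"] by (intro divide_left_mono W_antimono) auto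
        hence "ennreal (1 / W s) * indicator {0..<a} s \<le> ennreal (1 / W (node (Suc k))) * indicator {node k..<node (Suc k)} s"
          using k True by (simp add: ennreal_leI)
        also have "\<dots> \<le> (\<Sum>k=0..N. ennreal (1 / W (node (Suc k))) * indicator {node k..<node (Suc k)} s)"
          using \<open>k \<le> N\<close> by (intro member_le_sum) auto
        finally show ?thesis .
      qed auto
    qed
    also have "\<dots> = (\<Sum>k=0..N. ennreal (1 / W (node (Suc k))) * ennreal (node (Suc k) - node k))"
      using node_bounds(3) by (subst nn_integral_sum) (auto intro!: sum.cong simp: nn_integral_cmult_indicator less_imp_le)
    also have "\<dots> \<le> (\<Sum>k=0..N. ennreal (K * (1 / (real (k + 1) ^ 2 * m (2 * k)))))"
    proof (intro sum_mono)
      fix k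
      have Wp: "W (node (Suc k)) > 0" by (intro W_pos node_bounds)
      have "1 / W (node (Suc k)) \<le> K / m (2 * k)"
        using K(2)[of k] Wp m_pos[of "2 * k"] by (simp add: field_simps)
      moreover have "node (Suc k) - node k \<le> 1 / real (k + 1) ^ 2"
        unfolding node_diff power2_eq_square by (intro divide_left_mono mult_left_mono) auto
      ultimately have "(1 / W (node (Suc k))) * (node (Suc k) - node k) \<le> (K / m (2 * k)) * (1 / real (k + 1) ^ 2)"
        using K m_pos[of "2 * k"] node_bounds(3)[of k] by (intro mult_mono) auto
      thus "ennreal (1 / W (node (Suc k))) * ennreal (node (Suc k) - node k) \<le> ennreal (K * (1 / (real (k + 1) ^ 2 * m (2 * k))))"
        using Wp node_bounds(3)[of k] by (subst ennreal_mult[symmetric]) (auto intro!: ennreal_leI simp: mult.commute)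
    qed
    also have "\<dots> = ennreal (K * M1_sum N)"
      unfolding M1_sum_def using K m_pos
      by (subst sum_ennreal) (auto simp: sum_distrib_left intro!: mult_nonneg_nonneg less_imp_le[OF m_pos] divide_nonneg_nonneg)
    finally show ?thesis using K sum0[of N] by simp
  qed
  \<comment> \<open>The second summand of the constant covers a < 1/2, that is N = 0, an index
    absent from the supremum in \<open>M1\<close>. The factor 2 in the first comes from 1 - a > 1/(N
    + 2) >= 1/(2 (N + 1)).\<close>
  have "W a * I a \<le> (exp 4 * K * M * 2 + 2 * W 0 * I (1/2)) * (1 - a)" if a: "a \<in> {0..<1}" for a
  proof -
    obtain N where N: "node N \<le> a" "a < node (Suc N)" using node_bucket[of a] a by auto
    have c1: "0 \<le> exp 4 * K * M * 2 * (1 - a)" using K M0 a by simp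
    have c2: "0 \<le> 2 * W 0 * I (1/2) * (1 - a)" using a by (simp add: W_nonneg inv_tail_int_nonneg)
    show ?thesis
    proof (cases "N = 0")
      case True
      hence ah: "a < 1 / 2" using N by (simp add: node_def)
      hence "W a * I a \<le> 1 * (W 0 * I (1/2))" unfolding mult_1
        using a by (intro mult_mono W_antimono I_mono W_nonneg inv_tail_int_nonneg) auto
      also have "1 * (W 0 * I (1/2)) \<le> 2 * (1 - a) * (W 0 * I (1/2))"
        using ah by (intro mult_right_mono mult_nonneg_nonneg W_nonneg inv_tail_int_nonneg) auto
      finally show ?thesis using c1 by (simp add: algebra_simps)
    next
      case False
      have "W a * I a \<le> (exp 4 * m (2 * N)) * (K * M1_sum N)"
        using False N a Ia[of a N] W_node_le_moment[of N] W_antimono[OF N(1)] m_pos[of "2 * N"]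
        by (intro mult_mono inv_tail_int_nonneg) auto
      also have "\<dots> = exp 4 * K * (real (N + 1) * m (2 * N) * M1_sum N) / real (N + 1)" by (simp add: field_simps)
      also have "\<dots> \<le> exp 4 * K * M / real (N + 1)"
        using False K by (intro divide_right_mono mult_left_mono M) auto
      also have "\<dots> = exp 4 * K * M * (1 / real (N + 1))" by simp
      also have "\<dots> \<le> exp 4 * K * M * (2 * (1 - a))"
      proof (intro mult_left_mono)
        have "1 / real (N + 1) \<le> 2 * (1 / real (N + 2))" by (simp add: field_simps)
        also have "\<dots> \<le> 2 * (1 - a)" using N(2) by (simp add: node_def add.commute)
        finally show "1 / real (N + 1) \<le> 2 * (1 - a)" .
      qed (use K M0 in auto)
      finally show ?thesis using c2 by (simp add: algebra_simps)
    qed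
  qed
  thus ?thesis unfolding parts_bound_def by blast
qed

end

section \<open>The derivative of the kernel\<close>

text \<open>The power t^k is the smallest of the k + 1 terms of a geometric sum equal to (1 -
  t^(k+1)) / (1 - t) for t < 1.\<close>

lemma power_mult_one_minus_le:
  fixes t :: real
  assumes "0 \<le> t" "t \<le> 1"
  shows "t ^ k * (1 - t) \<le> 1 / real (k + 1)"
proof -
  have "(\<Sum>i<k+1. t ^ k) \<le> (\<Sum>i<k+1. t ^ i)" using assms by (intro sum_mono power_decreasing) auto
  hence "real (k + 1) * t ^ k * (1 - t) \<le> (1 - t) * (\<Sum>i<k+1. t ^ i)"
    using assms by (simp add: mult.commute mult_left_mono)
  also have "\<dots> = 1 - t ^ (k + 1)" by (rule one_diff_power_eq[symmetric])
  also have "\<dots> \<le> 1" using assms by simp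
  finally show ?thesis by (simp add: field_simps)
qed

context weight
begin

definition b :: "nat \<Rightarrow> real" where
  "b n = real (n + 1) / (2 * real (n + 2) * m (2 * n + 3))"

lemma b_nonneg: "0 \<le> b n"
  unfolding b_def by (intro divide_nonneg_nonneg mult_nonneg_nonneg) auto

lemma b_le: "b n \<le> 1 / m (2 * n + 3)"
proof -
  have "b n = real (n + 1) / (2 * real (n + 2)) * (1 / m (2 * n + 3))" by (simp add: b_def)
  also have "\<dots> \<le> 1 * (1 / m (2 * n + 3))"
    by (intro mult_right_mono) (auto simp: divide_le_eq)
  finally show ?thesis by simp
qed

text \<open>Regular growth: relative increments are O(1 / n). The rational factor contributes its
  explicit increment; for the moments, the difference m(2n+3) - m(2n+5) contains 1 - t^2, which
  gains 1 / (n + 2) against half of the available power of t.\<close>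

lemma b_diff:
  assumes C: "doubling C"
  shows "0 \<le> b (Suc n) - b n" "b (Suc n) - b n \<le> (2 * C + 1) * b (Suc n) / real (n + 2)"
proof -
  have C1: "C > 1" using C by (simp add: doubling_def)
  define p q where "p = real (n + 1) / (2 * real (n + 2))" and "q = real (n + 2) / (2 * real (n + 3))"
  define u v where "u = 1 / m (2 * n + 3)" and "v = 1 / m (2 * n + 5)"
  have bs: "b n = p * u" "b (Suc n) = q * v"
    by (simp_all add: b_def p_def q_def u_def v_def add.commute)
  have u: "0 < u" and uv: "u \<le> v"
    using m_antimono[of "2 * n + 3" "2 * n + 5"] m_pos by (auto simp: u_def v_def intro!: divide_left_mono)
  have p: "0 < p" and q: "0 < q" by (simp_all add: p_def q_def)
  have qp: "q - p = q / real (n + 2) ^ 2"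
  proof -
    define x where "x = real n + 2"
    have x: "x > 0" by (simp add: x_def)
    have px: "p = (x - 1) / (2 * x)" and qx: "q = x / (2 * (x + 1))" and nx: "real (n + 2) = x"
      by (simp_all add: p_def q_def x_def algebra_simps)
    define y where "y = x + 1"
    have y: "y > 0" using x by (simp add: y_def)
    have "q - p = 1 / (2 * x * y)"
      unfolding px qx y_def[symmetric] using x y by (simp add: field_simps) (simp add: y_def algebra_simps)
    also have "\<dots> = q / x\<^sup>2"
      unfolding qx y_def[symmetric] using x y by (simp add: field_simps power2_eq_square)
    finally show ?thesis unfolding nx .
  qed
  have qp0: "0 \<le> q - p" unfolding qp using q by simp
  have eq: "b (Suc n) - b n = q * (v - u) + (q - p) * u" by (simp add: bs algebra_simps)
  show "0 \<le> b (Suc n) - b n"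
    unfolding eq using u uv q qp0 by (intro add_nonneg_nonneg mult_nonneg_nonneg) auto
  have "m (2 * n + 3) - m (2 * n + 5) = (\<integral>t. t ^ (2 * n + 3) - t ^ (2 * n + 5) \<partial>\<nu>)"
    unfolding m_def by (rule Bochner_Integration.integral_diff[symmetric]) (rule integrable_power)+
  also have "\<dots> \<le> (\<integral>t. 2 / real (n + 2) * t ^ (n + 2) \<partial>\<nu>)"
  proof (rule integral_mono_AE)
    show "AE t in \<nu>. t ^ (2 * n + 3) - t ^ (2 * n + 5) \<le> 2 / real (n + 2) * t ^ (n + 2)"
      using AE_weight
    proof eventually_elim
      case (elim t)
      \<comment> \<open>The power t^(n+1) is spent on absorbing 1 - t. The rest leaves the moment of
        order n + 2, which doubling compares with that of order 2 n + 4.\<close>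
      have e: "2 * n + 3 = (n + 1) + (n + 2)" "2 * n + 5 = (n + 1) + (n + 2) + 2" by simp_all
      have "t ^ (2 * n + 3) - t ^ (2 * n + 5) = t ^ (n + 1) * (1 - t) * (1 + t) * t ^ (n + 2)"
        unfolding e power_add by (simp add: algebra_simps power2_eq_square)
      also have "\<dots> \<le> (1 / real (n + 1 + 1)) * 2 * t ^ (n + 2)"
        using elim by (intro mult_right_mono mult_mono power_mult_one_minus_le) auto
      finally show ?case by simp
    qed
  qed (intro Bochner_Integration.integrable_diff integrable_mult_right integrable_power)+
  also have "\<dots> = 2 / real (n + 2) * m (n + 2)" by (simp add: m_def)
  also have "\<dots> \<le> 2 / real (n + 2) * (C * m (2 * (n + 2)))"
    by (intro mult_left_mono m_doubling[OF C]) auto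
  also have "\<dots> \<le> 2 / real (n + 2) * (C * m (2 * n + 3))"
    using C1 by (intro mult_left_mono m_antimono) auto
  finally have "(m (2 * n + 3) - m (2 * n + 5)) * (u * v) \<le> 2 / real (n + 2) * (C * m (2 * n + 3)) * (u * v)"
    using u uv by (intro mult_right_mono) auto
  moreover have "(m (2 * n + 3) - m (2 * n + 5)) * (u * v) = v - u"
    using m_pos[of "2 * n + 3"] m_pos[of "2 * n + 5"] by (simp add: u_def v_def field_simps)
  moreover have "2 / real (n + 2) * (C * m (2 * n + 3)) * (u * v) = 2 * C * v / real (n + 2)"
    using m_pos[of "2 * n + 3"] by (simp add: u_def)
  ultimately have vu: "v - u \<le> 2 * C * v / real (n + 2)" by (simp only:)
  have "(q - p) * u \<le> q * v / real (n + 2)"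
  proof -
    have "q / real (n + 2) ^ 2 \<le> q / real (n + 2)"
      using q by (intro divide_left_mono) (auto simp: power2_eq_square)
    hence "(q - p) * u \<le> q / real (n + 2) * v" unfolding qp using u uv q by (intro mult_mono) auto
    thus ?thesis by simp
  qed
  moreover have "q * (v - u) \<le> q * (2 * C * v / real (n + 2))" using q vu by (intro mult_left_mono) auto
  ultimately have "b (Suc n) - b n \<le> q * (2 * C * v / real (n + 2)) + q * v / real (n + 2)"
    unfolding eq by linarith
  also have "\<dots> = (2 * C + 1) * b (Suc n) / real (n + 2)" by (simp add: bs algebra_simps add_divide_distrib)
  finally show "b (Suc n) - b n \<le> (2 * C + 1) * b (Suc n) / real (n + 2)" .
qed

lemma b_le_node: "b n \<le> exp 4 / W (node (Suc n))"
proof -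
  have "exp (- 4) \<le> exp (- (2 * real (2 * n + 3) / real (Suc n + 1)))" by (simp add: field_simps)
  also have "\<dots> \<le> node (Suc n) ^ (2 * n + 3)" unfolding node_def by (rule power_one_minus_ge) simp
  finally have "exp (- 4) * W (node (Suc n)) \<le> node (Suc n) ^ (2 * n + 3) * W (node (Suc n))" by (intro mult_right_mono W_nonneg)
  also have "\<dots> \<le> m (2 * n + 3)" by (intro m_ge node_bounds)
  finally have "1 / m (2 * n + 3) \<le> 1 / (exp (- 4) * W (node (Suc n)))"
    using W_pos[OF node_bounds(2)] m_pos by (intro divide_left_mono mult_pos_pos) auto
  thus ?thesis using b_le[of n] by (simp add: exp_minus field_simps)
qed

text \<open>With \<rho> = (1 + s) / 2 one has s <= \<rho>^2 and \<rho>^3 >= 1/8, hence s^n <= 8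
  \<rho>^(2n+3). The tail at \<rho> bounds the moment below, and one doubling step returns from
  \<rho> to s.\<close>

lemma b_power_le:
  assumes C: "doubling C" and s: "0 \<le> s" "s < 1"
  shows "b n * s ^ n \<le> 8 * C / W s"
proof -
  have C1: "C > 1" and CW: "W s \<le> C * W ((1 + s) / 2)" using C s by (auto simp: doubling_def)
  define \<rho> where "\<rho> = (1 + s) / 2"
  have \<rho>: "1 / 2 \<le> \<rho>" "\<rho> < 1" using s by (auto simp: \<rho>_def)
  have "0 \<le> (1 - s)\<^sup>2" by simp
  hence "s \<le> \<rho>\<^sup>2" by (simp add: \<rho>_def power2_eq_square field_simps)
  hence "s ^ n \<le> (\<rho>\<^sup>2) ^ n" using s by (intro power_mono)
  moreover have "(1 / 2) ^ 3 \<le> \<rho> ^ 3" using \<rho> by (intro power_mono) auto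
  ultimately have "s ^ n * (1 / 2) ^ 3 \<le> (\<rho>\<^sup>2) ^ n * \<rho> ^ 3" using s \<rho> by (intro mult_mono) auto
  also have "(\<rho>\<^sup>2) ^ n * \<rho> ^ 3 = \<rho> ^ (2 * n + 3)" by (simp only: power_add power_mult)
  finally have "s ^ n / 8 \<le> \<rho> ^ (2 * n + 3)" by (simp add: power_one_over)
  hence "s ^ n / 8 * (W s / C) \<le> \<rho> ^ (2 * n + 3) * W \<rho>"
    using CW C1 s \<rho> by (intro mult_mono) (auto simp: W_nonneg \<rho>_def field_simps)
  also have "\<dots> \<le> m (2 * n + 3)" using \<rho> by (intro m_ge) auto
  finally have "s ^ n * W s \<le> 8 * C * m (2 * n + 3)" using C1 by (simp add: field_simps)
  hence "1 / m (2 * n + 3) * s ^ n \<le> 8 * C / W s"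
    using W_pos[OF s(2)] m_pos[of "2 * n + 3"] by (simp add: field_simps)
  moreover have "b n * s ^ n \<le> 1 / m (2 * n + 3) * s ^ n" using s by (intro mult_right_mono b_le) auto
  ultimately show ?thesis by linarith
qed

text \<open>The lower bound \<open>m_ge\<close> at \<rho> with \<rho>^2 = (1 + r) / 2 > r yields a
  geometric majorant. It covers both coefficient sequences used for the operator, those of the
  kernel and those of \<open>F\<close>.\<close>

lemma summable_moment_powser:
  fixes a :: "nat \<Rightarrow> complex"
  assumes a: "\<And>n. norm (a n) \<le> 1 / m (2 * n + 3)" and r: "0 \<le> r" "r < 1"
  shows "summable (\<lambda>n. norm (a n) * r ^ n)"
proof -
  define \<rho> where "\<rho> = sqrt ((1 + r) / 2)"
  have \<rho>: "0 < \<rho>" "\<rho> < 1" "\<rho>\<^sup>2 = (1 + r) / 2" using r by (auto simp: \<rho>_def)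
  have W: "W \<rho> > 0" by (rule W_pos[OF \<rho>(2)])
  show ?thesis
  proof (rule summable_comparison_test'[of _ 0])
    have "r / \<rho>\<^sup>2 < 1" "0 \<le> r / \<rho>\<^sup>2" unfolding \<rho> using r by (auto simp: divide_less_eq)
    thus "summable (\<lambda>n. 1 / (\<rho> ^ 3 * W \<rho>) * (r / \<rho>\<^sup>2) ^ n)"
      by (intro summable_mult summable_geometric) auto
    fix n
    have "\<rho> ^ (2 * n + 3) * W \<rho> \<le> m (2 * n + 3)" using \<rho> by (intro m_ge) auto
    hence "1 / m (2 * n + 3) \<le> 1 / (\<rho> ^ (2 * n + 3) * W \<rho>)"
      using W \<rho> m_pos by (intro divide_left_mono mult_pos_pos) auto
    hence "norm (a n) * r ^ n \<le> 1 / (\<rho> ^ (2 * n + 3) * W \<rho>) * r ^ n"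
      using a[of n] r by (intro mult_right_mono) auto
    also have "\<dots> = 1 / (\<rho> ^ 3 * W \<rho>) * (r / \<rho>\<^sup>2) ^ n"
      by (simp add: power_add power_mult power_divide)
    finally show "norm (norm (a n) * r ^ n) \<le> 1 / (\<rho> ^ 3 * W \<rho>) * (r / \<rho>\<^sup>2) ^ n" using r by simp
  qed
qed

lemma summable_moment_powser':
  fixes a :: "nat \<Rightarrow> complex"
  assumes a: "\<And>n. norm (a n) \<le> 1 / m (2 * n + 3)" and z: "norm z < 1"
  shows "summable (\<lambda>n. a n * z ^ n)"
proof -
  have "summable (\<lambda>n. norm (a n * z ^ n))"
    using summable_moment_powser[OF a norm_ge_zero z] by (simp add: norm_mult norm_power)
  thus ?thesis by (rule summable_norm_cancel)
qed

text \<open>The intervals \<open>[node (n + 1), node (n + 2))\<close> are disjoint and have length at least \<open>1 / (6 (n + 1)\<^sup>2)\<close>;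
  on each of them \<open>b n s\<^sup>n\<close> is controlled by \<open>1 / W (min x s)\<close>, which turns the sum into an integral.\<close>

lemma suminf_b_le:
  assumes C: "doubling C" and M: "parts_bound M"
  shows "\<exists>K\<ge>0. \<forall>s. 0 \<le> s \<longrightarrow> s < 1 \<longrightarrow>
    summable (\<lambda>n. b n * s ^ n / real (n + 1) ^ 2) \<and> (\<Sum>n. b n * s ^ n / real (n + 1) ^ 2) \<le> K * (1 - s) / W s"
proof -
  have C1: "C > 1" using C by (simp add: doubling_def)
  define L where "L = max (exp 4) (8 * C)"
  have L: "exp 4 \<le> L" "8 * C \<le> L" "0 < L" using C1 by (auto simp: L_def)
  have M0: "0 \<le> M"
    using parts_boundD[OF M, of 0] W_nonneg[of 0] inv_tail_int_nonneg[of 0] by (auto intro: order.trans[rotated])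
  have main: "summable (\<lambda>n. b n * s ^ n / real (n + 1) ^ 2) \<and>
       (\<Sum>n. b n * s ^ n / real (n + 1) ^ 2) \<le> (6 * L * (M + 1)) * (1 - s) / W s" if s: "0 \<le> s" "s < 1" for s
  proof -
    have Ws: "W s > 0" using s W_pos by simp
    have t0: "0 \<le> b n * s ^ n / real (n + 1) ^ 2" for n using b_nonneg s by simp
    have trm: "ennreal (b n * s ^ n / real (n + 1) ^ 2) \<le>
       (\<integral>\<^sup>+x. ennreal (6 * L) * ennreal (1 / W (min x s)) * indicator {node (Suc n)..<node (Suc (Suc n))} x \<partial>lborel)" for n
    proof -
      have len: "1 / real (n + 1) ^ 2 \<le> 6 * (node (Suc (Suc n)) - node (Suc n))"
      proof -
        define x where "x = real n"
        have x: "x \<ge> 0" by (simp add: x_def)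
        have "1 / (x + 1) ^ 2 = 6 / (6 * (x + 1) ^ 2)" by simp
        also have "\<dots> \<le> 6 / ((x + 2) * (x + 3))"
        proof (intro divide_left_mono mult_pos_pos zero_less_power)
          show "(x + 2) * (x + 3) \<le> 6 * (x + 1)\<^sup>2"
            using x by (simp add: power2_eq_square algebra_simps)
        qed (use x in auto)
        finally show ?thesis unfolding node_diff by (simp add: x_def add_ac)
      qed
      have bs: "b n * s ^ n \<ge> 0" using b_nonneg s by simp
      have "ennreal (b n * s ^ n / real (n + 1) ^ 2) \<le> ennreal (6 * (b n * s ^ n) * (node (Suc (Suc n)) - node (Suc n)))"
        using mult_left_mono[OF len bs] by (intro ennreal_leI) (simp add: mult_ac)
      also have "\<dots> = (\<integral>\<^sup>+x. ennreal (6 * (b n * s ^ n)) * indicator {node (Suc n)..<node (Suc (Suc n))} x \<partial>lborel)"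
        using bs node_bounds(3)[of "Suc n"] by (subst nn_integral_cmult_indicator) (auto simp: ennreal_mult)
      also have "\<dots> \<le> (\<integral>\<^sup>+x. ennreal (6 * L) * ennreal (1 / W (min x s)) * indicator {node (Suc n)..<node (Suc (Suc n))} x \<partial>lborel)"
      proof (intro nn_integral_mono)
        fix x :: real
        show "ennreal (6 * (b n * s ^ n)) * indicator {node (Suc n)..<node (Suc (Suc n))} x \<le>
          ennreal (6 * L) * ennreal (1 / W (min x s)) * indicator {node (Suc n)..<node (Suc (Suc n))} x"
        proof (cases "x \<in> {node (Suc n)..<node (Suc (Suc n))}")
          case True
          hence x: "node (Suc n) \<le> x" "x < 1" using node_bounds(2)[of "Suc (Suc n)"] by auto
          have "b n * s ^ n \<le> L * (1 / W (min x s))"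
          \<comment> \<open>To the left of s the factor s^n is dropped and b n is compared with the
            tail at the left end of the gap; to the right of s the factor s^n is needed and the
            comparison is with W s.\<close>
          proof (cases "x \<le> s")
            case True
            have "b n * s ^ n \<le> b n * 1" using s b_nonneg by (intro mult_left_mono power_le_one) auto
            also have "\<dots> \<le> exp 4 / W (node (Suc n))" using b_le_node[of n] by simp
            also have "\<dots> \<le> L / W x"
              using L x W_pos[OF x(2)] by (intro frac_le W_antimono) auto
            finally show ?thesis using True by simp
          next
            case False
            have "b n * s ^ n \<le> 8 * C / W s" by (rule b_power_le[OF C s])
            also have "\<dots> \<le> L / W s" using L Ws by (intro divide_right_mono) auto
            finally show ?thesis using False by simp
          qed
          hence "ennreal (6 * (b n * s ^ n)) \<le> ennreal (6 * L * (1 / W (min x s)))"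
            by (intro ennreal_leI) simp
          also have "\<dots> = ennreal (6 * L) * ennreal (1 / W (min x s))"
            using L W_nonneg by (intro ennreal_mult) auto
          finally show ?thesis using True by simp
        qed simp
      qed
      finally show ?thesis .
    qed
    have disj: "(\<Sum>n. indicator {node (Suc n)..<node (Suc (Suc n))} x :: ennreal) \<le> indicator {0..<1} x" for x :: real
    proof -
      have "disjoint_family (\<lambda>n. {node (Suc n)..<node (Suc (Suc n))})"
        unfolding disjoint_family_on_def
      proof safe
        fix i j x assume "i \<noteq> j" "x \<in> {node (Suc i)..<node (Suc (Suc i))}" "x \<in> {node (Suc j)..<node (Suc (Suc j))}"
        moreover have "i < j \<Longrightarrow> node (Suc (Suc i)) \<le> node (Suc j)" "j < i \<Longrightarrow> node (Suc (Suc j)) \<le> node (Suc i)"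
          by (auto intro: node_mono)
        ultimately show "x \<in> {}" by (cases "i < j") auto
      qed
      hence "(\<Sum>n. indicator {node (Suc n)..<node (Suc (Suc n))} x :: ennreal) = indicator (\<Union>n. {node (Suc n)..<node (Suc (Suc n))}) x"
        by (rule suminf_indicator)
      also have "\<dots> \<le> indicator {0..<1} x"
        using node_bounds(1) node_bounds(2) by (auto split: split_indicator intro: order.trans less_trans)
      finally show ?thesis .
    qed
    have "(\<Sum>n. ennreal (b n * s ^ n / real (n + 1) ^ 2)) \<le>
      (\<Sum>n. \<integral>\<^sup>+x. ennreal (6 * L) * ennreal (1 / W (min x s)) * indicator {node (Suc n)..<node (Suc (Suc n))} x \<partial>lborel)"
      by (intro suminf_le trm) auto
    also have "\<dots> = (\<integral>\<^sup>+x. (\<Sum>n. ennreal (6 * L) * ennreal (1 / W (min x s)) * indicator {node (Suc n)..<node (Suc (Suc n))} x) \<partial>lborel)"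
      by (rule nn_integral_suminf[symmetric]) simp
    also have "\<dots> \<le> (\<integral>\<^sup>+x. ennreal (6 * L) * (ennreal (1 / W (min x s)) * indicator {0..<1} x) \<partial>lborel)"
      unfolding ennreal_suminf_cmult mult.assoc by (intro nn_integral_mono mult_left_mono disj) auto
    also have "\<dots> = ennreal (6 * L) * (\<integral>\<^sup>+x. ennreal (1 / W (min x s)) * indicator {0..<1} x \<partial>lborel)"
      by (rule nn_integral_cmult) simp
    also have "(\<integral>\<^sup>+x. ennreal (1 / W (min x s)) * indicator {0..<1} x \<partial>lborel)
       = (\<integral>\<^sup>+x. ennreal (1 / W x) * indicator {0..<s} x + ennreal (1 / W s) * indicator {s..<1} x \<partial>lborel)"
      using s by (intro nn_integral_cong) (auto split: split_indicator)
    also have "\<dots> = J s + ennreal (1 / W s) * ennreal (1 - s)"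
      unfolding J_def using s by (subst nn_integral_add) (auto simp: nn_integral_cmult_indicator)
    also have "\<dots> = ennreal (I s + (1 / W s) * (1 - s))"
      using s Ws by (simp add: J_eq ennreal_mult[symmetric] ennreal_plus[symmetric] inv_tail_int_nonneg del: ennreal_plus)
    also have "ennreal (6 * L) * \<dots> = ennreal (6 * L * (I s + (1 / W s) * (1 - s)))"
      using L s Ws inv_tail_int_nonneg by (intro ennreal_mult[symmetric] add_nonneg_nonneg) auto
    also have "\<dots> \<le> ennreal ((6 * L * (M + 1)) * (1 - s) / W s)"
    proof (intro ennreal_leI)
      \<comment> \<open>The sum has been bounded by I s + (1 - s) / W s, and the hypothesis brings
        the first term to the size of the second.\<close>
      have "I s \<le> M * (1 - s) / W s" using parts_boundD[OF M s] Ws by (simp add: field_simps)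
      hence "6 * L * (I s + (1 / W s) * (1 - s)) \<le> 6 * L * (M * (1 - s) / W s + (1 / W s) * (1 - s))"
        using L by (intro mult_left_mono) auto
      also have "\<dots> = (6 * L * (M + 1)) * (1 - s) / W s" using Ws by (simp add: field_simps)
      finally show "6 * L * (I s + (1 / W s) * (1 - s)) \<le> (6 * L * (M + 1)) * (1 - s) / W s" .
    qed
    finally have le: "(\<Sum>n. ennreal (b n * s ^ n / real (n + 1) ^ 2)) \<le> ennreal ((6 * L * (M + 1)) * (1 - s) / W s)" .
    hence sm: "summable (\<lambda>n. b n * s ^ n / real (n + 1) ^ 2)"
      by (intro summable_suminf_not_top t0) (auto simp: top_unique)
    have "0 \<le> (6 * L * (M + 1)) * (1 - s) / W s" using L M0 s Ws by simp
    moreover from le have "ennreal (\<Sum>n. b n * s ^ n / real (n + 1) ^ 2) \<le> ennreal ((6 * L * (M + 1)) * (1 - s) / W s)"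
      unfolding suminf_ennreal_norm[OF sm t0] .
    ultimately show ?thesis using sm by (simp only: ennreal_le_iff)
  qed
  show ?thesis using main L M0 by (intro exI[of _ "6 * L * (M + 1)"]) auto
qed

section \<open>Integral means of the derivative of the kernel\<close>

definition F :: "complex \<Rightarrow> complex" where "F z = (\<Sum>n. of_real (b n) * z ^ n)"

lemma F_sums: "norm z < 1 \<Longrightarrow> (\<lambda>n. of_real (b n) * z ^ n) sums F z"
  unfolding F_def using b_le b_nonneg by (intro summable_sums summable_moment_powser') auto

text \<open>Regular growth gives |d n| at most a multiple of b n s^n / (n + 1). In the square one
  factor b n s^n is replaced by 8 C / W s and the other is summed by \<open>suminf_b_le\<close>, so
  the squared l^2 norm is O((1 - s) / (W s)^2).\<close>

lemma nn_integral_circle_F_le: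
  assumes C: "doubling C" and M: "parts_bound M"
  shows "\<exists>K\<ge>0. \<forall>s. 0 \<le> s \<longrightarrow> s < 1 \<longrightarrow>
    (\<integral>\<^sup>+\<theta>\<in>{0..2*pi}. ennreal (norm (F (rcis s \<theta>))) \<partial>lborel) \<le> ennreal (K / W s)"
proof -
  have C1: "C > 1" using C by (simp add: doubling_def)
  obtain K where "K \<ge> 0" and "\<forall>s. 0 \<le> s \<longrightarrow> s < 1 \<longrightarrow>
      summable (\<lambda>n. b n * s ^ n / real (n + 1) ^ 2) \<and> (\<Sum>n. b n * s ^ n / real (n + 1) ^ 2) \<le> K * (1 - s) / W s"
    using suminf_b_le[OF C M] by (elim exE conjE)
  hence K: "K \<ge> 0" "\<And>s. 0 \<le> s \<Longrightarrow> s < 1 \<Longrightarrow> summable (\<lambda>n. b n * s ^ n / real (n + 1) ^ 2)"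
    "\<And>s. 0 \<le> s \<Longrightarrow> s < 1 \<Longrightarrow> (\<Sum>n. b n * s ^ n / real (n + 1) ^ 2) \<le> K * (1 - s) / W s"
    by simp_all
  define D where "D = (2 * C + 1)\<^sup>2 * (8 * C)"
  have D: "D \<ge> 0" using C1 by (simp add: D_def)
  have "(\<integral>\<^sup>+\<theta>\<in>{0..2*pi}. ennreal (norm (F (rcis s \<theta>))) \<partial>lborel) \<le> ennreal (pi * (D * K + 1) / W s)"
    if s: "0 \<le> s" "s < 1" for s
  proof -
    have Ws: "W s > 0" using s W_pos by simp
    define a where "a n = complex_of_real (b n) * of_real s ^ n" for n
    note F = sums_imp_trig_series[OF F_sums s]
    define d where "d n = a n - (if n = 0 then 0 else s * a (n - 1))" for n
    have d_le: "(norm (d n))\<^sup>2 \<le> D / W s * (b n * s ^ n / real (n + 1) ^ 2)" for n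
    proof -
      have bs: "0 \<le> b n * s ^ n" "b n * s ^ n \<le> 8 * C / W s" using b_nonneg s b_power_le[OF C s] by auto
      have "norm (d n) \<le> (2 * C + 1) * (b n * s ^ n) / real (n + 1)"
      proof (cases n)
        case 0
        have "1 * b 0 \<le> (2 * C + 1) * b 0" using C1 b_nonneg[of 0] by (intro mult_right_mono) auto
        thus ?thesis using 0 b_nonneg[of 0] by (simp add: d_def a_def)
      next
        case (Suc k)
        \<comment> \<open>Since the radius is part of the coefficients, the factor 1 - s w, and not
          1 - w, produces pure differences of b.\<close>
        have "d n = of_real (s ^ n * (b n - b k))" using Suc by (simp add: d_def a_def algebra_simps)
        hence "norm (d n) = s ^ n * (b n - b k)" using b_diff[OF C, of k] s Suc by (simp only: norm_of_real) simp
        also have "\<dots> \<le> s ^ n * ((2 * C + 1) * b n / real (n + 1))"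
          using b_diff[OF C, of k] s Suc by (intro mult_left_mono) (auto simp: add_ac)
        finally show ?thesis by (simp add: mult_ac)
      qed
      hence "(norm (d n))\<^sup>2 \<le> ((2 * C + 1) * (b n * s ^ n) / real (n + 1))\<^sup>2" by (intro power_mono) auto
      also have "\<dots> = (2 * C + 1)\<^sup>2 * (b n * s ^ n) * (b n * s ^ n / real (n + 1) ^ 2)"
        by (simp add: power2_eq_square)
      also have "\<dots> \<le> (2 * C + 1)\<^sup>2 * (8 * C / W s) * (b n * s ^ n / real (n + 1) ^ 2)"
        using bs by (intro mult_right_mono mult_left_mono) auto
      finally show ?thesis by (simp add: D_def)
    qed
    have sumd: "(\<Sum>n. (norm (d n))\<^sup>2) \<le> D / W s * (K * (1 - s) / W s)"
    proof -
      have sm: "summable (\<lambda>n. D / W s * (b n * s ^ n / real (n + 1) ^ 2))" using K(2)[OF s] by (rule summable_mult)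
      have "summable (\<lambda>n. (norm (d n))\<^sup>2)"
        by (rule summable_comparison_test'[OF sm, of 0]) (use d_le in simp)
      hence "(\<Sum>n. (norm (d n))\<^sup>2) \<le> (\<Sum>n. D / W s * (b n * s ^ n / real (n + 1) ^ 2))"
        using sm d_le by (intro suminf_le) auto
      also have "\<dots> = D / W s * (\<Sum>n. b n * s ^ n / real (n + 1) ^ 2)" using K(2)[OF s] by (rule suminf_mult)
      also have "\<dots> \<le> D / W s * (K * (1 - s) / W s)" using K(3)[OF s] D Ws by (intro mult_left_mono) auto
      finally show ?thesis .
    qed
    \<comment> \<open>This c balances the two terms: both c (1 - s) / (W s)^2 and 1 / (c (1 - s))
      equal 1 / W s.\<close>
    define c where "c = W s / (1 - s)"
    have c: "c > 0" using s Ws by (simp add: c_def)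
    have "(\<integral>\<^sup>+\<theta>\<in>{0..2*pi}. ennreal (norm (F (rcis s \<theta>))) \<partial>lborel) =
        (\<integral>\<^sup>+\<theta>\<in>{0..2*pi}. ennreal (norm (trig_series a \<theta>)) \<partial>lborel)"
    proof -
      have "F (rcis s \<theta>) = trig_series a \<theta>" for \<theta> unfolding a_def by (rule F(1))
      thus ?thesis by presburger
    qed
    also have "\<dots> \<le> ennreal (pi * (c * (\<Sum>n. (norm (d n))\<^sup>2) + 1 / (c * (1 - s))))"
      unfolding d_def
    proof (rule nn_integral_trig_series_le_differences)
      show "summable (\<lambda>n. norm (a n))" unfolding a_def by (rule F(2))
    qed (use s c in auto)
    also have "\<dots> \<le> ennreal (pi * (D * K + 1) / W s)"
    proof (intro ennreal_leI)
      have "c * (\<Sum>n. (norm (d n))\<^sup>2) \<le> c * (D / W s * (K * (1 - s) / W s))" using c sumd by (intro mult_left_mono) auto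
      also have "\<dots> = D * K / W s" using s Ws by (simp add: c_def)
      finally have "pi * (c * (\<Sum>n. (norm (d n))\<^sup>2) + 1 / (c * (1 - s))) \<le> pi * (D * K / W s + 1 / W s)"
        using s by (intro mult_left_mono add_mono) (auto simp: c_def)
      also have "\<dots> = pi * (D * K + 1) / W s" by (simp add: algebra_simps add_divide_distrib)
      finally show "pi * (c * (\<Sum>n. (norm (d n))\<^sup>2) + 1 / (c * (1 - s))) \<le> pi * (D * K + 1) / W s" .
    qed
    finally show ?thesis .
  qed
  thus ?thesis using D K(1) by (intro exI[of _ "pi * (D * K + 1)"]) auto
qed

lemma holomorphic_F: "F holomorphic_on ball 0 1"
  by (rule power_series_holomorphic[where a="\<lambda>n. of_real (b n)"]) (use F_sums in auto)

text \<open>In polar coordinates the circle of radius r leads to the mean of F at s = t r. The outer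
  factor t is the Jacobian of this substitution, and r <= 1 is dropped, which leaves the integral of
  1 / W over [0,t).\<close>

theorem nn_integral_ball_F_le:
  assumes C: "doubling C" and M: "parts_bound M"
  shows "\<exists>K\<ge>0. \<forall>t. 0 < t \<longrightarrow> t < 1 \<longrightarrow>
    (\<integral>\<^sup>+z\<in>ball 0 1. ennreal (norm (of_real t * F (of_real t * z))) \<partial>lborel) \<le> ennreal K * J t"
proof -
  obtain K where "K \<ge> 0" and "\<forall>s. 0 \<le> s \<longrightarrow> s < 1 \<longrightarrow>
      (\<integral>\<^sup>+\<theta>\<in>{0..2*pi}. ennreal (norm (F (rcis s \<theta>))) \<partial>lborel) \<le> ennreal (K / W s)"
    using nn_integral_circle_F_le[OF C M] by (elim exE conjE)
  hence K: "K \<ge> 0" "\<And>s. 0 \<le> s \<Longrightarrow> s < 1 \<Longrightarrow>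
      (\<integral>\<^sup>+\<theta>\<in>{0..2*pi}. ennreal (norm (F (rcis s \<theta>))) \<partial>lborel) \<le> ennreal (K / W s)"
    by simp_all
  have "(\<integral>\<^sup>+z\<in>ball 0 1. ennreal (norm (of_real t * F (of_real t * z))) \<partial>lborel) \<le> ennreal K * J t"
    if t: "0 < t" "t < 1" for t
  proof -
    have maps: "of_real t * z \<in> ball 0 1" if "z \<in> ball 0 1" for z :: complex
    proof -
      have "t * norm z \<le> 1 * norm z" using t by (intro mult_right_mono) auto
      thus ?thesis using that t by (simp add: norm_mult)
    qed
    have hol: "(\<lambda>z. of_real t * F (of_real t * z)) holomorphic_on ball 0 1"
      by (intro holomorphic_intros holomorphic_on_compose_gen[OF _ holomorphic_F, unfolded o_def])
         (use maps in auto)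
    have "(\<integral>\<^sup>+z\<in>ball 0 1. ennreal (norm (of_real t * F (of_real t * z))) \<partial>lborel) =
      (\<integral>\<^sup>+r\<in>{0<..<1}. ennreal r * (\<integral>\<^sup>+\<theta>\<in>{0..2*pi}. ennreal (norm (of_real t * F (of_real t * rcis r \<theta>))) \<partial>lborel) \<partial>lborel)"
      by (rule nn_integral_ball_eq_polar[OF hol])
    also have "\<dots> \<le> (\<integral>\<^sup>+r. ennreal K * (ennreal t * (ennreal (1 / W (0 + t * r)) * indicator {0..<t} (0 + t * r))) \<partial>lborel)"
    proof (intro nn_integral_mono)
      fix r :: real
      show "ennreal r * (\<integral>\<^sup>+\<theta>\<in>{0..2*pi}. ennreal (norm (of_real t * F (of_real t * rcis r \<theta>))) \<partial>lborel) * indicator {0<..<1} r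
        \<le> ennreal K * (ennreal t * (ennreal (1 / W (0 + t * r)) * indicator {0..<t} (0 + t * r)))"
      proof (cases "r \<in> {0<..<1}")
        case True
        have tr: "0 \<le> t * r" "t * r < t" "t * r < 1"
        proof -
          have "t * r < t * 1" using True t by (intro mult_strict_left_mono) auto
          thus "t * r < t" "t * r < 1" using t by linarith+
        qed (use True t in auto)
        note F = sums_imp_trig_series[OF F_sums tr(1,3)]
        have Fm[measurable]: "(\<lambda>\<theta>. F (rcis (t * r) \<theta>)) \<in> borel_measurable borel"
        proof -
          have "(\<lambda>\<theta>. F (rcis (t * r) \<theta>)) = trig_series (\<lambda>n. of_real (b n) * of_real (t * r) ^ n)"
            by (intro ext F(1))
          thus ?thesis using trig_series_borel[OF F(2)] by (simp only:)
        qed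
        have e: "of_real t * rcis r \<theta> = rcis (t * r) \<theta>" for \<theta> by (simp add: rcis_def)
        have "(\<integral>\<^sup>+\<theta>\<in>{0..2*pi}. ennreal (norm (of_real t * F (of_real t * rcis r \<theta>))) \<partial>lborel)
          = (\<integral>\<^sup>+\<theta>. ennreal t * (ennreal (norm (F (rcis (t * r) \<theta>))) * indicator {0..2*pi} \<theta>) \<partial>lborel)"
          using t by (intro nn_integral_cong) (simp add: e norm_mult ennreal_mult mult.assoc)
        also have "\<dots> = ennreal t * (\<integral>\<^sup>+\<theta>\<in>{0..2*pi}. ennreal (norm (F (rcis (t * r) \<theta>))) \<partial>lborel)"
          by (rule nn_integral_cmult) simp
        finally have "ennreal r * (\<integral>\<^sup>+\<theta>\<in>{0..2*pi}. ennreal (norm (of_real t * F (of_real t * rcis r \<theta>))) \<partial>lborel)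
          = ennreal r * (ennreal t * (\<integral>\<^sup>+\<theta>\<in>{0..2*pi}. ennreal (norm (F (rcis (t * r) \<theta>))) \<partial>lborel))" by simp
        also have "\<dots> \<le> 1 * (ennreal t * ennreal (K / W (t * r)))"
          using True tr by (intro mult_mono mult_left_mono K) auto
        also have "\<dots> = ennreal K * (ennreal t * (ennreal (1 / W (0 + t * r)) * indicator {0..<t} (0 + t * r)))"
          using tr t K(1) W_nonneg[of "t * r"] by (simp add: ennreal_mult[symmetric] mult_ac)
        finally show ?thesis using True by simp
      qed simp
    qed
    also have "\<dots> = ennreal K * (ennreal t * (\<integral>\<^sup>+r. (ennreal (1 / W (0 + t * r)) * indicator {0..<t} (0 + t * r)) \<partial>lborel))"
      by (subst nn_integral_cmult, simp, subst nn_integral_cmult) auto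
    also have "ennreal t * (\<integral>\<^sup>+r. (ennreal (1 / W (0 + t * r)) * indicator {0..<t} (0 + t * r)) \<partial>lborel) = J t"
      unfolding J_def using t by (subst (2) nn_integral_real_affine[where c=t and t=0]) auto
    finally show ?thesis .
  qed
  thus ?thesis using K(1) by blast
qed

section \<open>The operators\<close>


text \<open>The coefficients of the averaged kernel: taking the mean over [0,z] divides the n-th
  coefficient of the reproducing kernel by n + 1.\<close>

definition \<kappa> :: "nat \<Rightarrow> real" where
  "\<kappa> n = 1 / (2 * real (n + 1) * m (2 * n + 1))"

lemma \<kappa>_pos: "0 < \<kappa> n"
  unfolding \<kappa>_def by (intro divide_pos_pos mult_pos_pos m_pos) auto

lemma m_odd_le: "1 / m (2 * n + 1) \<le> 1 / m (2 * n + 3)"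
  using m_pos by (intro divide_left_mono m_antimono mult_pos_pos) auto

lemma \<kappa>_le: "norm (complex_of_real (\<kappa> n)) \<le> 1 / m (2 * n + 3)"
proof -
  have "\<kappa> n = 1 / (2 * real (n + 1)) * (1 / m (2 * n + 1))" by (simp add: \<kappa>_def)
  also have "\<dots> \<le> 1 * (1 / m (2 * n + 1))" by (intro mult_right_mono) auto
  also have "\<dots> \<le> 1 / m (2 * n + 3)" using m_odd_le by simp
  finally show ?thesis using \<kappa>_pos[of n] by simp
qed

lemma b_norm_le: "norm (complex_of_real (b n)) \<le> 1 / m (2 * n + 3)"
  using b_le b_nonneg by simp

lemma \<kappa>_Suc: "real (Suc n) * \<kappa> (Suc n) = b n"
  by (simp add: \<kappa>_def b_def eval_nat_numeral)

definition kern :: "real \<Rightarrow> complex \<Rightarrow> complex" where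
  "kern t z = (\<Sum>n. of_real (\<kappa> n) * (of_real t * z) ^ n)"

lemma kern_measurable [measurable]: "(\<lambda>t. kern t z) \<in> borel_measurable borel"
  unfolding kern_def by measurable

lemma F_measurable [measurable]: "F \<in> borel_measurable borel"
  unfolding F_def by measurable

lemma norm_of_real_mult_less:
  assumes "0 \<le> t" "t < 1" "norm z < 1"
  shows "norm (complex_of_real t * z) < 1"
proof -
  have "t * norm z \<le> 1 * norm z" using assms by (intro mult_right_mono) auto
  thus ?thesis using assms by (simp add: norm_mult)
qed

text \<open>The function z times \<open>kern t z\<close> is a primitive of the reproducing kernel
  vanishing at 0. The series form also shows measurability in t, which is not visible in the contour
  integral.\<close>

lemma mean_kernel_eq:
  assumes t: "0 \<le> t" "t < 1" and z: "norm z < 1"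
  shows "mean_kernel \<omega> t z = kern t z"
proof -
  have mom: "moment \<omega> (2 * real n + 1) = m (2 * n + 1)" for n
  proof -
    have "real (2 * n + 1) = 2 * real n + 1" by simp
    thus ?thesis using moment_eq[of "2 * n + 1"] by (simp only:)
  qed
  have B: "bergman_kernel \<omega> (of_real t) \<zeta> = (\<Sum>n. of_real (1 / (2 * m (2 * n + 1))) * (of_real t * \<zeta>) ^ n)" for \<zeta>
    unfolding bergman_kernel_def mom by simp
  show ?thesis
  proof (cases "z = 0")
    case True
    have "(\<Sum>n. of_real (1 / (2 * m (2 * n + 1))) * (0::complex) ^ n) = of_real (1 / (2 * m 1))"
      by (subst powser_zero) simp
    moreover have "kern t 0 = of_real (1 / (2 * m 1))"
      unfolding kern_def mult_zero_right by (subst powser_zero) (simp add: \<kappa>_def)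
    ultimately show ?thesis using True by (simp add: mean_kernel_def B)
  next
    case False
    define c where "c n = (if n = 0 then 0 else of_real (\<kappa> (n - 1)) * of_real t ^ (n - 1) :: complex)" for n
    have ks: "(\<lambda>n. of_real (\<kappa> n) * (of_real t * \<zeta>) ^ n) sums kern t \<zeta>" if "norm \<zeta> < 1" for \<zeta>
      unfolding kern_def using norm_of_real_mult_less[OF t that]
      by (intro summable_sums summable_moment_powser' \<kappa>_le)
    have cs: "(\<lambda>n. c n * \<zeta> ^ n) sums (\<zeta> * kern t \<zeta>)" if "norm \<zeta> < 1" for \<zeta>
    proof -
      have "(\<lambda>n. \<zeta> * (of_real (\<kappa> n) * (of_real t * \<zeta>) ^ n)) sums (\<zeta> * kern t \<zeta>)"
        by (intro sums_mult ks that)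
      hence "(\<lambda>n. c (Suc n) * \<zeta> ^ Suc n) sums (\<zeta> * kern t \<zeta>)"
        by (simp add: c_def power_mult_distrib mult_ac)
      from sums_Suc[OF this] show ?thesis by (simp add: c_def)
    qed
    have der: "((\<lambda>\<zeta>. \<zeta> * kern t \<zeta>) has_field_derivative bergman_kernel \<omega> (of_real t) \<zeta>) (at \<zeta> within ball 0 1)"
      if "\<zeta> \<in> ball 0 1" for \<zeta>
    proof -
      have n: "norm \<zeta> < 1" using that by simp
      have "((\<lambda>\<zeta>. \<Sum>n. c n * \<zeta> ^ n) has_field_derivative (\<Sum>n. diffs c n * \<zeta> ^ n)) (at \<zeta>)"
        using cs n by (intro termdiffs_strong'[where K=1]) (auto simp: sums_iff)
      moreover have "(\<Sum>n. diffs c n * \<zeta> ^ n) = bergman_kernel \<omega> (of_real t) \<zeta>"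
        unfolding B
      proof (intro suminf_cong)
        fix n
        have "real (Suc n) * \<kappa> n = 1 / (2 * m (2 * n + 1))"
          by (simp only: \<kappa>_def Suc_eq_plus1[symmetric]) (simp del: of_nat_Suc)
        hence "complex_of_real (1 / (2 * m (2 * n + 1))) = of_nat (Suc n) * of_real (\<kappa> n)"
          by (metis of_real_mult of_real_of_nat_eq)
        thus "diffs c n * \<zeta> ^ n = of_real (1 / (2 * m (2 * n + 1))) * (of_real t * \<zeta>) ^ n"
          by (simp only: diffs_def c_def) (simp add: power_mult_distrib)
      qed
      ultimately have "((\<lambda>\<zeta>. \<Sum>n. c n * \<zeta> ^ n) has_field_derivative bergman_kernel \<omega> (of_real t) \<zeta>) (at \<zeta>)" by simp
      hence "((\<lambda>\<zeta>. \<zeta> * kern t \<zeta>) has_field_derivative bergman_kernel \<omega> (of_real t) \<zeta>) (at \<zeta>)"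
        by (rule has_field_derivative_transform_within_open[where S="ball 0 1"])
          (use that cs in \<open>auto simp: sums_iff\<close>)
      thus ?thesis by (rule has_field_derivative_at_within)
    qed
    have "path_image (linepath 0 z) \<subseteq> ball 0 1"
      unfolding path_image_linepath by (intro closed_segment_subset convex_ball) (use z in auto)
    from contour_integral_primitive[OF der valid_path_linepath this]
    have "contour_integral (linepath 0 z) (bergman_kernel \<omega> (of_real t)) = z * kern t z"
      by (simp add: contour_integral_unique)
    thus ?thesis using False by (simp add: mean_kernel_def)
  qed
qed

text \<open>For fixed z the terms are dominated by |h t| times a convergent series independent of t.
  It is applied with the coefficients \<kappa> to the operator and with b to its derivative.\<close>

lemma integral_powser_swap:
  fixes a :: "nat \<Rightarrow> complex" and h :: "real \<Rightarrow> complex"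
  assumes a: "\<And>n. norm (a n) \<le> 1 / m (2 * n + 3)" and h: "integrable \<nu> h" and z: "norm z < 1"
  shows "integrable \<nu> (\<lambda>t. h t * (\<Sum>n. a n * (of_real t * z) ^ n))"
    and "(\<lambda>n. a n * (\<integral>t. h t * of_real t ^ n \<partial>\<nu>) * z ^ n) sums (\<integral>t. h t * (\<Sum>n. a n * (of_real t * z) ^ n) \<partial>\<nu>)"
proof -
  have [measurable]: "h \<in> borel_measurable borel"
    using borel_measurable_integrable[OF h] by (simp add: measurable_cong_sets[OF sets_weight refl])
  let ?f = "\<lambda>n t. h t * (a n * (of_real t * z) ^ n)"
  have sm: "summable (\<lambda>n. norm (a n) * norm z ^ n)" by (rule summable_moment_powser[OF a norm_ge_zero z])
  have le: "norm (?f n t) \<le> norm (h t) * (norm (a n) * norm z ^ n)" if "0 < t \<and> t < 1" for n t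
  proof -
    have "(t * norm z) ^ n \<le> (1 * norm z) ^ n" using that by (intro power_mono mult_right_mono) auto
    thus ?thesis using that by (auto simp: norm_mult norm_power intro!: mult_left_mono)
  qed
  have int: "integrable \<nu> (?f n)" for n
  proof (rule Bochner_Integration.integrable_bound)
    show "integrable \<nu> (\<lambda>t. norm (h t) * (norm (a n) * norm z ^ n))"
      by (intro integrable_mult_left integrable_norm h)
    show "AE t in \<nu>. norm (?f n t) \<le> norm (norm (h t) * (norm (a n) * norm z ^ n))"
      using AE_weight by eventually_elim (use le in fastforce)
  qed simp
  have s1: "AE t in \<nu>. summable (\<lambda>n. norm (?f n t))"
    using AE_weight
  proof eventually_elim
    case (elim t)
    show ?case
      by (rule summable_comparison_test'[OF summable_mult[OF sm, of "norm (h t)"], of 0]) (use le[OF elim] in simp)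
  qed
  have s2: "summable (\<lambda>n. \<integral>t. norm (?f n t) \<partial>\<nu>)"
  proof (rule summable_comparison_test'[OF summable_mult[OF sm, of "\<integral>t. norm (h t) \<partial>\<nu>"], of 0])
    fix n
    have "(\<integral>t. norm (?f n t) \<partial>\<nu>) \<le> (\<integral>t. norm (h t) * (norm (a n) * norm z ^ n) \<partial>\<nu>)"
      by (rule integral_mono_AE[OF integrable_norm[OF int] integrable_mult_left[OF integrable_norm[OF h]]])
         (use AE_weight in eventually_elim, rule le)
    thus "norm (\<integral>t. norm (?f n t) \<partial>\<nu>) \<le> (\<integral>t. norm (h t) \<partial>\<nu>) * (norm (a n) * norm z ^ n)" by simp
  qed
  have "AE t in \<nu>. (\<Sum>n. ?f n t) = h t * (\<Sum>n. a n * (of_real t * z) ^ n)"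
    using AE_weight
  proof eventually_elim
    case (elim t)
    have "summable (\<lambda>n. a n * (of_real t * z) ^ n)"
      using elim z by (intro summable_moment_powser' a norm_of_real_mult_less) auto
    thus ?case by (rule suminf_mult)
  qed
  note eq = this
  show "integrable \<nu> (\<lambda>t. h t * (\<Sum>n. a n * (of_real t * z) ^ n))"
    using integrable_suminf[OF int s1 s2] eq by (subst (asm) integrable_cong_AE) auto
  have "(\<lambda>n. integral\<^sup>L \<nu> (?f n)) sums (\<integral>t. (\<Sum>n. ?f n t) \<partial>\<nu>)"
    by (rule sums_integral[OF int s1 s2])
  also have "(\<integral>t. (\<Sum>n. ?f n t) \<partial>\<nu>) = (\<integral>t. h t * (\<Sum>n. a n * (of_real t * z) ^ n) \<partial>\<nu>)"
    using eq by (intro integral_cong_AE) auto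
  also have "(\<lambda>n. integral\<^sup>L \<nu> (?f n)) = (\<lambda>n. a n * (\<integral>t. h t * of_real t ^ n \<partial>\<nu>) * z ^ n)"
  proof
    fix n
    have "integral\<^sup>L \<nu> (?f n) = (\<integral>t. (a n * z ^ n) * (h t * of_real t ^ n) \<partial>\<nu>)"
      by (intro Bochner_Integration.integral_cong) (auto simp: power_mult_distrib mult_ac)
    also have "\<dots> = (a n * z ^ n) * (\<integral>t. h t * of_real t ^ n \<partial>\<nu>)" by (rule integral_mult_right_zero)
    also have "\<dots> = a n * (\<integral>t. h t * of_real t ^ n \<partial>\<nu>) * z ^ n"
      by (simp only: mult.assoc mult.commute[of "z ^ n"])
    finally show "integral\<^sup>L \<nu> (?f n) = a n * (\<integral>t. h t * of_real t ^ n \<partial>\<nu>) * z ^ n" .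
  qed
  finally show "(\<lambda>n. a n * (\<integral>t. h t * of_real t ^ n \<partial>\<nu>) * z ^ n) sums (\<integral>t. h t * (\<Sum>n. a n * (of_real t * z) ^ n) \<partial>\<nu>)" .
qed

text \<open>The function f is arbitrary outside the disc, so only the cut-off of its trace on the
  real axis can be expected to be Borel.\<close>

definition restr :: "(real \<Rightarrow> complex) \<Rightarrow> real \<Rightarrow> complex" where
  "restr g t = indicator {0..<1} t *\<^sub>R g t"

definition op_coeff :: "(real \<Rightarrow> complex) \<Rightarrow> nat \<Rightarrow> complex" where
  "op_coeff g n = of_real (\<kappa> n) * (\<integral>t. restr g t * of_real t ^ n \<partial>\<nu>)"

text \<open>For fixed z the kernel is bounded in t, so integrability of the symbol against \<nu>
  makes the operator well defined. The coefficients of the image are \<kappa> n times the moments of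
  the symbol, and termwise differentiation changes them by (n + 1) \<kappa> (n + 1) = b n.\<close>

theorem kernel_op_eq:
  assumes g: "integrable \<nu> (restr g)"
  obtains G where "kernel_op \<omega> g = Some G" "G holomorphic_on ball 0 1"
    "\<And>z. norm z < 1 \<Longrightarrow> (\<lambda>n. op_coeff g n * z ^ n) sums G z"
    "\<And>z. norm z < 1 \<Longrightarrow> deriv G z = (\<integral>t. restr g t * (of_real t * F (of_real t * z)) \<partial>\<nu>)"
proof -
  have [measurable]: "restr g \<in> borel_measurable borel"
    using borel_measurable_integrable[OF g] by (simp add: measurable_cong_sets[OF sets_weight refl])
  define G where "G = (\<lambda>z. LINT t:{0..<1}|lebesgue. g t * mean_kernel \<omega> t z * of_real (\<omega> t))"
  have cong: "indicator {0..<1} t *\<^sub>R (\<omega> t *\<^sub>R (restr g t * kern t z))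
      = indicator {0..<1} t *\<^sub>R (g t * mean_kernel \<omega> t z * of_real (\<omega> t))" if "norm z < 1" for t z
    using that by (auto simp: restr_def mean_kernel_eq scaleR_conv_of_real split: split_indicator)
  have kern_swap: "integrable \<nu> (\<lambda>t. restr g t * kern t z)"
    "(\<lambda>n. op_coeff g n * z ^ n) sums (\<integral>t. restr g t * kern t z \<partial>\<nu>)" if "norm z < 1" for z
    using integral_powser_swap[OF \<kappa>_le g that] by (simp_all add: kern_def op_coeff_def)
  have "set_integrable lebesgue {0..<1} (\<lambda>t. g t * mean_kernel \<omega> t z * of_real (\<omega> t))" if "norm z < 1" for z
  proof -
    have "set_integrable lebesgue {0..<1} (\<lambda>t. \<omega> t *\<^sub>R (restr g t * kern t z))"
      by (rule integral_weight(1)[THEN iffD1, OF _ kern_swap(1)[OF that]]) simp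
    thus ?thesis unfolding set_integrable_def cong[OF that] .
  qed
  hence 1: "kernel_op \<omega> g = Some G" by (simp add: kernel_op_def G_def)
  have "G z = (\<integral>t. restr g t * kern t z \<partial>\<nu>)" if "norm z < 1" for z
  proof -
    have "(\<integral>t. restr g t * kern t z \<partial>\<nu>) = (LINT t:{0..<1}|lebesgue. \<omega> t *\<^sub>R (restr g t * kern t z))"
      by (rule integral_weight(2)) simp
    also have "\<dots> = G z" unfolding G_def set_lebesgue_integral_def cong[OF that] ..
    finally show ?thesis ..
  qed
  hence 2: "(\<lambda>n. op_coeff g n * z ^ n) sums G z" if "norm z < 1" for z
    using kern_swap(2)[OF that] that by simp
  have 3: "G holomorphic_on ball 0 1"
    by (rule power_series_holomorphic[where a="op_coeff g"]) (use 2 in auto)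
  have 4: "deriv G z = (\<integral>t. restr g t * (of_real t * F (of_real t * z)) \<partial>\<nu>)" if z: "norm z < 1" for z
  proof -
    have dif: "diffs (op_coeff g) n = of_real (b n) * (\<integral>t. (restr g t * of_real t) * of_real t ^ n \<partial>\<nu>)" for n
    proof -
      have "of_nat (Suc n) * complex_of_real (\<kappa> (Suc n)) = of_real (b n)"
        by (metis \<kappa>_Suc of_real_mult of_real_of_nat_eq)
      moreover have "(\<integral>t. restr g t * of_real t ^ Suc n \<partial>\<nu>) = (\<integral>t. (restr g t * of_real t) * of_real t ^ n \<partial>\<nu>)"
        by (simp only: power_Suc mult.assoc)
      ultimately show ?thesis by (simp only: diffs_def op_coeff_def mult.assoc[symmetric])
    qed
    have "((\<lambda>z. \<Sum>n. op_coeff g n * z ^ n) has_field_derivative (\<Sum>n. diffs (op_coeff g) n * z ^ n)) (at z)"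
      using 2 z by (intro termdiffs_strong'[where K=1]) (auto simp: sums_iff)
    hence "(G has_field_derivative (\<Sum>n. diffs (op_coeff g) n * z ^ n)) (at z)"
      by (rule has_field_derivative_transform_within_open[where S="ball 0 1"]) (use z 2 in \<open>auto simp: sums_iff\<close>)
    hence "deriv G z = (\<Sum>n. diffs (op_coeff g) n * z ^ n)" by (rule DERIV_imp_deriv)
    also have "\<dots> = (\<Sum>n. of_real (b n) * (\<integral>t. (restr g t * of_real t) * of_real t ^ n \<partial>\<nu>) * z ^ n)"
      by (simp only: dif)
    also have "\<dots> = (\<integral>t. (restr g t * of_real t) * (\<Sum>n. of_real (b n) * (of_real t * z) ^ n) \<partial>\<nu>)"
    proof (rule sums_unique[symmetric], rule integral_powser_swap(2)[OF b_norm_le _ z])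
      show "integrable \<nu> (\<lambda>t. restr g t * of_real t)"
      proof (rule Bochner_Integration.integrable_bound[OF g])
        show "AE t in \<nu>. norm (restr g t * of_real t) \<le> norm (restr g t)"
          using AE_weight by eventually_elim (auto simp: norm_mult mult_left_le)
      qed simp
    qed
    also have "\<dots> = (\<integral>t. restr g t * (of_real t * F (of_real t * z)) \<partial>\<nu>)"
      by (simp add: F_def mult.assoc)
    finally show ?thesis .
  qed
  show thesis using that[OF 1 3 2 4] by simp
qed


section \<open>Carleson embeddings on the radius\<close>

lemma tail_le_if_parts_bound:
  assumes M: "parts_bound M"
  shows "\<exists>c\<ge>0. \<forall>a\<in>{0..<1}. W a \<le> c * (1 - a)"
proof -
  have M0: "0 \<le> M"
    using parts_boundD[OF M, of 0] W_nonneg[of 0] inv_tail_int_nonneg[of 0] by (auto intro: order.trans[rotated])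
  \<comment> \<open>For a >= 1/2 the factor I a is at least I (1/2) >= 1 / (2 W 0), so the
    hypothesis forces linear decay of W; for a < 1/2 the bound 1 - a > 1/2 is enough. Linear decay
    makes \<nu> itself a Carleson measure, which the operator needs in order to be defined.\<close>
  define h :: real where "h = 1 / 2"
  have h: "0 < h" "h < 1" by (simp_all add: h_def)
  have "ennreal ((1 / W 0) * h) = (\<integral>\<^sup>+s. ennreal (1 / W 0) * indicator {0..<h} s \<partial>lborel)"
    using W_nonneg[of 0] h by (subst nn_integral_cmult_indicator) (auto simp: ennreal_mult[symmetric])
  also have "\<dots> \<le> J h"
    unfolding J_def
  proof (intro nn_integral_mono)
    fix s :: real
    show "ennreal (1 / W 0) * indicator {0..<h} s \<le> ennreal (1 / W s) * indicator {0..<h} s"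
      using W_pos[of 0] W_pos[of s] W_antimono[of 0 s] h
      by (auto split: split_indicator intro!: ennreal_leI divide_left_mono)
  qed
  finally have "(1 / W 0) * h \<le> I h" using h by (simp add: J_eq inv_tail_int_nonneg)
  hence half: "(1 / W 0) * (1 / 2) \<le> I (1 / 2)" by (simp only: h_def)
  have "W a \<le> (2 * W 0 * M + 2 * W 0) * (1 - a)" if a: "0 \<le> a" "a < 1" for a
  proof -
    have n: "0 \<le> 2 * W 0 * M * (1 - a)" "0 \<le> 2 * W 0 * (1 - a)" using a M0 W_nonneg by auto
    show ?thesis
    proof (cases "a < 1 / 2")
      case True
      have "W a \<le> W 0 * 1" using a by (simp add: W_antimono)
      also have "\<dots> \<le> W 0 * (2 * (1 - a))" using True W_nonneg by (intro mult_left_mono) auto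
      finally show ?thesis using n by (simp add: algebra_simps)
    next
      case False
      have "W a * ((1 / W 0) * (1 / 2)) \<le> W a * I a"
        using half I_mono[of "1/2" a] False a by (intro mult_left_mono W_nonneg) auto
      also have "\<dots> \<le> M * (1 - a)" by (rule parts_boundD[OF M a])
      finally have "W a \<le> 2 * W 0 * M * (1 - a)" using W_pos[of 0] by (simp add: field_simps)
      thus ?thesis using n by (simp add: algebra_simps)
    qed
  qed
  thus ?thesis using M0 W_nonneg by (intro exI[of _ "2 * W 0 * M + 2 * W 0"]) auto
qed

text \<open>The maximum modulus dominates f on the radius and is nondecreasing, so a measure whose
  tails are at most c times those of Lebesgue measure integrates it to at most c times the
  norm.\<close>

lemma nn_integral_le_norm_Hinf1:
  fixes \<mu> :: "real measure"
  assumes sf: "sigma_finite_measure \<mu>" and sets: "sets \<mu> = sets borel"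
    and tail: "\<And>a. a \<in> {0..<1} \<Longrightarrow> emeasure \<mu> {a..<1} \<le> ennreal (c * (1 - a))" and c: "0 \<le> c"
    and f: "f holomorphic_on ball 0 1"
  shows "(\<integral>\<^sup>+t\<in>{0..<1}. ennreal (norm (f (of_real t))) \<partial>\<mu>) \<le> ennreal c * norm_Hinf1 f"
proof -
  have "(\<integral>\<^sup>+t\<in>{0..<1}. ennreal (norm (f (of_real t))) \<partial>\<mu>) \<le> (\<integral>\<^sup>+t\<in>{0..<1}. ennreal (M_inf t f) \<partial>\<mu>)"
  proof (intro nn_integral_mono)
    fix t :: real
    show "ennreal (norm (f (of_real t))) * indicator {0..<1} t \<le> ennreal (M_inf t f) * indicator {0..<1} t"
      using norm_le_M_inf[OF f, of "of_real t"] by (auto split: split_indicator intro!: ennreal_leI)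
  qed
  also have "\<dots> \<le> ennreal c * (\<integral>\<^sup>+t\<in>{0..<1}. ennreal (M_inf t f) \<partial>lborel)"
  proof (rule nn_integral_mono_tail_dominated[OF sf lborel.sigma_finite_measure_axioms sets])
    fix a :: real assume a: "a \<in> {0..<1}"
    thus "emeasure \<mu> {a..<1} \<le> ennreal c * emeasure lborel {a..<1}"
      using tail[OF a] c by (simp add: ennreal_mult)
  qed (use M_inf_mono[OF f] M_inf_nonneg[OF f] in auto)
  finally show ?thesis by (simp add: norm_Hinf1_def)
qed

lemma carleson_weight:
  assumes M: "parts_bound M"
  shows "\<exists>c\<ge>0. \<forall>f. f holomorphic_on ball 0 1 \<longrightarrow>
    (\<integral>\<^sup>+t\<in>{0..<1}. ennreal (norm (f (of_real t))) \<partial>\<nu>) \<le> ennreal c * norm_Hinf1 f"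
proof -
  obtain c where c: "c \<ge> 0" "\<forall>a\<in>{0..<1}. W a \<le> c * (1 - a)" using tail_le_if_parts_bound[OF M] by blast
  show ?thesis
    using c by (intro exI[of _ c] conjI allI impI nn_integral_le_norm_Hinf1 sigma_finite_measure_axioms sets_weight)
      (auto simp: emeasure_atLeastLessThan_1 intro: ennreal_leI)
qed

text \<open>The tail of the measure with density J is estimated by \<open>nn_integral_J_le\<close>,
  and the boundary term there by the hypothesis.\<close>

lemma carleson_mu:
  assumes M: "parts_bound M"
  shows "\<exists>c\<ge>0. \<forall>f. f holomorphic_on ball 0 1 \<longrightarrow>
    (\<integral>\<^sup>+t\<in>{0..<1}. ennreal (norm (f (of_real t))) * J t \<partial>\<nu>) \<le> ennreal c * norm_Hinf1 f"
proof (intro exI[of _ "M + 1"] conjI allI impI)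
  have M0: "0 \<le> M"
    using parts_boundD[OF M, of 0] W_nonneg[of 0] inv_tail_int_nonneg[of 0] by (auto intro: order.trans[rotated])
  thus "0 \<le> M + 1" by simp
  fix f :: "complex \<Rightarrow> complex" assume f: "f holomorphic_on ball 0 1"
  let ?\<mu> = "density \<nu> J"
  have Jm: "J \<in> borel_measurable \<nu>" by (simp add: measurable_cong_sets[OF sets_weight refl])
  have tl: "emeasure ?\<mu> {a..<1} \<le> ennreal ((M + 1) * (1 - a))" if a: "a \<in> {0..<1}" for a
  proof -
    have "emeasure ?\<mu> {a..<1} = (\<integral>\<^sup>+t\<in>{a..<1}. J t \<partial>\<nu>)" using Jm by (simp add: emeasure_density)
    also have "\<dots> \<le> ennreal (W a) * J a + ennreal (1 - a)" using a by (intro nn_integral_J_le) auto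
    also have "\<dots> = ennreal (W a * I a + (1 - a))"
      using a J_eq[of a] by (simp add: ennreal_mult[symmetric] ennreal_plus[symmetric] W_nonneg inv_tail_int_nonneg del: ennreal_plus)
    also have "\<dots> \<le> ennreal ((M + 1) * (1 - a))"
      using parts_boundD[OF M, of a] a by (intro ennreal_leI) (auto simp: algebra_simps)
    finally show ?thesis .
  qed
  have "finite_measure ?\<mu>"
  proof (rule finite_measureI)
    have "emeasure ?\<mu> (space ?\<mu>) = emeasure ?\<mu> {0..<1}"
    proof (rule emeasure_eq_AE)
      show "AE x in ?\<mu>. x \<in> space ?\<mu> \<longleftrightarrow> x \<in> {0..<1}"
        using AE_weight Jm by (subst AE_density) (auto elim: eventually_mono)
    qed auto
    also have "\<dots> \<le> ennreal ((M + 1) * (1 - 0))" by (rule tl) simp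
    finally show "emeasure ?\<mu> (space ?\<mu>) \<noteq> \<infinity>" by (auto simp: top_unique)
  qed
  then interpret mu: finite_measure ?\<mu> .
  have fm: "(\<lambda>t. ennreal (norm (f (of_real t))) * indicator {0..<1} t) \<in> borel_measurable borel"
  proof -
    have "(\<lambda>t. ennreal (norm (f (of_real t))) * indicator (ball 0 1) (complex_of_real t)) \<in> borel_measurable borel"
      by (rule measurable_compose[OF _ borel_measurable_norm_indicator_ball[OF f]]) simp
    hence "(\<lambda>t. ennreal (norm (f (of_real t))) * indicator (ball 0 1) (complex_of_real t) * indicator {0..<1} t) \<in> borel_measurable borel"
      by measurable
    also have "(\<lambda>t. ennreal (norm (f (of_real t))) * indicator (ball 0 1) (complex_of_real t) * indicator {0..<1} t)
      = (\<lambda>t::real. ennreal (norm (f (of_real t))) * indicator {0..<1} t)"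
      by (auto split: split_indicator)
    finally show ?thesis .
  qed
  have "(\<integral>\<^sup>+t\<in>{0..<1}. ennreal (norm (f (of_real t))) * J t \<partial>\<nu>) = (\<integral>\<^sup>+t\<in>{0..<1}. ennreal (norm (f (of_real t))) \<partial>?\<mu>)"
    using fm Jm by (subst nn_integral_density) (auto simp: mult_ac measurable_cong_sets[OF sets_weight refl])
  also have "\<dots> \<le> ennreal (M + 1) * norm_Hinf1 f"
    using M0 by (intro nn_integral_le_norm_Hinf1 f tl mu.sigma_finite_measure_axioms) auto
  finally show "(\<integral>\<^sup>+t\<in>{0..<1}. ennreal (norm (f (of_real t))) * J t \<partial>\<nu>) \<le> ennreal (M + 1) * norm_Hinf1 f" .
qed

text \<open>Only the modulus of the symbol enters the estimate, so allowing any g with |g| = |f|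
  treats both operators together. The area integral of |G'| is taken inside the t integral by
  Tonelli; the value at 0 uses the Carleson property of \<nu>, the derivative that of the measure
  with density J.\<close>

theorem kernel_op_bounded:
  assumes C: "doubling C" and M: "parts_bound M"
  shows "\<exists>K\<ge>0. \<forall>f g. f holomorphic_on ball 0 1 \<longrightarrow> norm_Hinf1 f < \<infinity> \<longrightarrow> restr g \<in> borel_measurable borel \<longrightarrow>
    (\<forall>t\<in>{0..<1}. norm (g t) = norm (f (of_real t))) \<longrightarrow>
    (\<exists>G. kernel_op \<omega> g = Some G \<and> G holomorphic_on ball 0 1 \<and> norm_D10 G \<le> ennreal K * norm_Hinf1 f)"
proof -
  obtain c1 where c1: "c1 \<ge> 0" "\<forall>f. f holomorphic_on ball 0 1 \<longrightarrow>
    (\<integral>\<^sup>+t\<in>{0..<1}. ennreal (norm (f (of_real t))) \<partial>\<nu>) \<le> ennreal c1 * norm_Hinf1 f"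
    using carleson_weight[OF M] by (elim exE conjE)
  obtain c2 where c2: "c2 \<ge> 0" "\<forall>f. f holomorphic_on ball 0 1 \<longrightarrow>
    (\<integral>\<^sup>+t\<in>{0..<1}. ennreal (norm (f (of_real t))) * J t \<partial>\<nu>) \<le> ennreal c2 * norm_Hinf1 f"
    using carleson_mu[OF M] by (elim exE conjE)
  obtain K where K: "K \<ge> 0" "\<forall>t. 0 < t \<longrightarrow> t < 1 \<longrightarrow>
    (\<integral>\<^sup>+z\<in>ball 0 1. ennreal (norm (of_real t * F (of_real t * z))) \<partial>lborel) \<le> ennreal K * J t"
    using nn_integral_ball_F_le[OF C M] by (elim exE conjE)
  have "\<exists>G. kernel_op \<omega> g = Some G \<and> G holomorphic_on ball 0 1 \<and>
      norm_D10 G \<le> ennreal (\<kappa> 0 * c1 + 1 / pi * (K * c2)) * norm_Hinf1 f"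
    if f: "f holomorphic_on ball 0 1" and fin: "norm_Hinf1 f < \<infinity>" and gm[measurable]: "restr g \<in> borel_measurable borel"
      and fg: "\<forall>t\<in>{0..<1}. norm (g t) = norm (f (of_real t))" for f g
  proof -
    have ng: "norm (restr g t) = norm (f (of_real t)) * indicator {0..<1} t" for t
      using fg by (auto simp: restr_def split: split_indicator)
    have "(\<integral>\<^sup>+t. ennreal (norm (restr g t)) \<partial>\<nu>) = (\<integral>\<^sup>+t\<in>{0..<1}. ennreal (norm (f (of_real t))) \<partial>\<nu>)"
      unfolding ng by (intro nn_integral_cong) (auto split: split_indicator)
    hence i1: "(\<integral>\<^sup>+t. ennreal (norm (restr g t)) \<partial>\<nu>) \<le> ennreal c1 * norm_Hinf1 f" using c1 f by simp
    have "(\<integral>\<^sup>+t. ennreal (norm (restr g t)) * J t \<partial>\<nu>) = (\<integral>\<^sup>+t\<in>{0..<1}. ennreal (norm (f (of_real t))) * J t \<partial>\<nu>)"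
      unfolding ng by (intro nn_integral_cong) (auto split: split_indicator)
    hence i2: "(\<integral>\<^sup>+t. ennreal (norm (restr g t)) * J t \<partial>\<nu>) \<le> ennreal c2 * norm_Hinf1 f" using c2 f by simp
    have ig: "integrable \<nu> (restr g)"
    proof (rule integrableI_bounded)
      show "restr g \<in> borel_measurable \<nu>" by (simp add: measurable_cong_sets[OF sets_weight refl])
      show "(\<integral>\<^sup>+t. ennreal (norm (restr g t)) \<partial>\<nu>) < \<infinity>"
        by (rule le_less_trans[OF i1]) (use fin in \<open>simp add: ennreal_mult_less_top\<close>)
    qed
    obtain G where G: "kernel_op \<omega> g = Some G" "G holomorphic_on ball 0 1"
      "\<And>z. norm z < 1 \<Longrightarrow> (\<lambda>n. op_coeff g n * z ^ n) sums G z"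
      "\<And>z. norm z < 1 \<Longrightarrow> deriv G z = (\<integral>t. restr g t * (of_real t * F (of_real t * z)) \<partial>\<nu>)"
      by (rule kernel_op_eq[OF ig], rule that, simp_all)
    have "G 0 = op_coeff g 0" using G(3)[of 0] by (simp add: sums_iff)
    hence "norm (G 0) = \<kappa> 0 * norm (\<integral>t. restr g t \<partial>\<nu>)"
      using \<kappa>_pos[of 0] by (simp add: op_coeff_def norm_mult)
    hence "ennreal (norm (G 0)) = ennreal (\<kappa> 0) * ennreal (norm (\<integral>t. restr g t \<partial>\<nu>))"
      using \<kappa>_pos[of 0] by (simp add: ennreal_mult)
    also have "\<dots> \<le> ennreal (\<kappa> 0) * (ennreal c1 * norm_Hinf1 f)"
      using integral_norm_bound_ennreal[OF ig] i1 by (intro mult_left_mono) (auto intro: order.trans)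
    finally have G0: "ennreal (norm (G 0)) \<le> ennreal (\<kappa> 0) * (ennreal c1 * norm_Hinf1 f)" .
    interpret P: pair_sigma_finite lborel \<nu> ..
    let ?k = "\<lambda>z t. ennreal (norm (restr g t)) * (ennreal (norm (of_real t * F (of_real t * z))) * indicator (ball 0 1) z)"
    have "(\<integral>\<^sup>+z\<in>ball 0 1. ennreal (norm (deriv G z)) \<partial>lborel) \<le> (\<integral>\<^sup>+z. (\<integral>\<^sup>+t. ?k z t \<partial>\<nu>) \<partial>lborel)"
    proof (intro nn_integral_mono)
      fix z :: complex
      show "ennreal (norm (deriv G z)) * indicator (ball 0 1) z \<le> (\<integral>\<^sup>+t. ?k z t \<partial>\<nu>)"
      proof (cases "z \<in> ball 0 1")
        case True
        have "ennreal (norm (deriv G z)) \<le> (\<integral>\<^sup>+t. ennreal (norm (restr g t * (of_real t * F (of_real t * z)))) \<partial>\<nu>)"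
        \<comment> \<open>If the integrand is not integrable, the Bochner integral is 0 by
          convention and the inequality is trivial.\<close>
        proof (cases "integrable \<nu> (\<lambda>t. restr g t * (of_real t * F (of_real t * z)))")
          case True
          thus ?thesis using G(4)[of z] \<open>z \<in> ball 0 1\<close> by (simp add: integral_norm_bound_ennreal)
        next
          case False
          thus ?thesis using G(4)[of z] \<open>z \<in> ball 0 1\<close> by (simp add: not_integrable_integral_eq)
        qed
        also have "\<dots> = (\<integral>\<^sup>+t. ?k z t \<partial>\<nu>)"
          using True by (intro nn_integral_cong) (simp add: norm_mult ennreal_mult)
        finally show ?thesis using True by simp
      qed simp
    qed
    also have "\<dots> = (\<integral>\<^sup>+t. (\<integral>\<^sup>+z. ?k z t \<partial>lborel) \<partial>\<nu>)"
    proof (rule P.Fubini'[symmetric])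
      have [measurable]: "(\<lambda>p. indicator (ball 0 1 :: complex set) (fst p) :: ennreal) \<in> borel_measurable (lborel \<Otimes>\<^sub>M \<nu>)"
        by (rule measurable_compose[OF measurable_fst], rule borel_measurable_indicator) simp
      have [measurable]: "(\<lambda>p. complex_of_real (snd p)) \<in> borel_measurable (lborel \<Otimes>\<^sub>M \<nu>)"
        "(\<lambda>p. fst p) \<in> borel_measurable (lborel \<Otimes>\<^sub>M \<nu>)"
        by measurable
      have [measurable]: "(\<lambda>p. restr g (snd p)) \<in> borel_measurable (lborel \<Otimes>\<^sub>M \<nu>)"
        "(\<lambda>p. F (of_real (snd p) * fst p)) \<in> borel_measurable (lborel \<Otimes>\<^sub>M \<nu>)"
        by measurable
      show "(\<lambda>(z, t). ?k z t) \<in> borel_measurable (lborel \<Otimes>\<^sub>M \<nu>)"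
        unfolding case_prod_beta'
        by (intro borel_measurable_times_ennreal measurable_compose[OF _ measurable_ennreal] borel_measurable_norm borel_measurable_times) simp_all
    qed
    also have "\<dots> \<le> (\<integral>\<^sup>+t. ennreal K * (ennreal (norm (restr g t)) * J t) \<partial>\<nu>)"
    proof (intro nn_integral_mono_AE)
      show "AE t in \<nu>. (\<integral>\<^sup>+z. ?k z t \<partial>lborel) \<le> ennreal K * (ennreal (norm (restr g t)) * J t)"
        using AE_weight
      proof eventually_elim
        case (elim t)
        have mz: "(\<lambda>z. ennreal (norm (of_real t * F (of_real t * z)))) \<in> borel_measurable lborel"
          by measurable
        have "(\<integral>\<^sup>+z. ?k z t \<partial>lborel) = ennreal (norm (restr g t)) * (\<integral>\<^sup>+z\<in>ball 0 1. ennreal (norm (of_real t * F (of_real t * z))) \<partial>lborel)"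
          by (rule nn_integral_cmult, intro borel_measurable_times_ennreal mz borel_measurable_indicator) simp
        also have "\<dots> \<le> ennreal (norm (restr g t)) * (ennreal K * J t)"
          using K elim by (intro mult_left_mono) auto
        finally show ?case by (simp add: mult_ac)
      qed
    qed
    also have "\<dots> = ennreal K * (\<integral>\<^sup>+t. ennreal (norm (restr g t)) * J t \<partial>\<nu>)"
      by (rule nn_integral_cmult) (simp add: measurable_cong_sets[OF sets_weight refl])
    also have "\<dots> \<le> ennreal K * (ennreal c2 * norm_Hinf1 f)" by (intro mult_left_mono i2) auto
    finally have "norm_D10 G \<le> ennreal (\<kappa> 0) * (ennreal c1 * norm_Hinf1 f) + ennreal (1 / pi) * (ennreal K * (ennreal c2 * norm_Hinf1 f))"
      unfolding norm_D10_def by (intro add_mono G0 mult_left_mono) auto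
    also have "\<dots> = ennreal (\<kappa> 0 * c1 + 1 / pi * (K * c2)) * norm_Hinf1 f"
    proof -
      have "ennreal (\<kappa> 0 * c1 + 1 / pi * (K * c2)) = ennreal (\<kappa> 0) * ennreal c1 + ennreal (1 / pi) * (ennreal K * ennreal c2)"
      proof -
        have k0: "0 \<le> \<kappa> 0" using \<kappa>_pos[of 0] by simp
        have "ennreal (1 / pi * (K * c2)) = ennreal (1 / pi) * ennreal (K * c2)"
          using c2(1) K(1) by (intro ennreal_mult) auto
        moreover have "ennreal (K * c2) = ennreal K * ennreal c2" using c2(1) K(1) by (intro ennreal_mult)
        moreover have "ennreal (\<kappa> 0 * c1) = ennreal (\<kappa> 0) * ennreal c1" using c1(1) k0 by (intro ennreal_mult)
        moreover have "ennreal (\<kappa> 0 * c1 + 1 / pi * (K * c2)) = ennreal (\<kappa> 0 * c1) + ennreal (1 / pi * (K * c2))"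
          using c1(1) c2(1) K(1) k0 by (intro ennreal_plus) auto
        ultimately show ?thesis by (simp only:)
      qed
      thus ?thesis by (simp only: distrib_right mult.assoc)
    qed
    finally show ?thesis using G by blast
  qed
  thus ?thesis using \<kappa>_pos[of 0] c1(1) c2(1) K(1) by (intro exI[of _ "\<kappa> 0 * c1 + 1 / pi * (K * c2)"]) auto
qed

section \<open>Test functions for the operators\<close>


text \<open>The test function on the radius. It is positive there, so f and |f| agree on [0,1) and
  the two operators have the same value on it.\<close>

definition \<phi> :: "real \<Rightarrow> real \<Rightarrow> real" where
  "\<phi> a t = (1 - a\<^sup>2)\<^sup>2 / (1 - a * t) ^ 3"

lemma restr_test_fun:
  assumes a: "0 \<le> a" "a < 1" and g: "\<And>t. t \<in> {0..<1} \<Longrightarrow> g t = of_real (c * \<phi> a t)"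
  shows "restr g \<in> borel_measurable borel" "integrable \<nu> (restr g)"
    "op_coeff g n = of_real (\<kappa> n * (c * (\<integral>t. \<phi> a t * t ^ n \<partial>\<nu>)))"
    "integrable \<nu> (\<lambda>t. \<phi> a t * t ^ n)"
proof -
  have eq: "restr g = (\<lambda>t. of_real (indicator {0..<1} t * (c * \<phi> a t)))"
    using g by (auto simp: restr_def split: split_indicator)
  have [measurable]: "\<phi> a \<in> borel_measurable borel" unfolding \<phi>_def by measurable
  show m: "restr g \<in> borel_measurable borel" unfolding eq by measurable
  have bd: "\<bar>\<phi> a t\<bar> \<le> 1 / (1 - a) ^ 3" if "0 < t \<and> t < 1" for t
  proof -
    have "a * t \<le> a * 1" using a that by (intro mult_left_mono) auto
    hence d: "1 - a \<le> 1 - a * t" by simp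
    have "(1 - a\<^sup>2)\<^sup>2 \<le> 1" using a by (intro power_le_one) (auto simp: power_le_one)
    hence "\<phi> a t \<le> 1 / (1 - a) ^ 3"
      unfolding \<phi>_def using a d by (intro frac_le power_mono) auto
    moreover have "0 \<le> \<phi> a t" unfolding \<phi>_def using a that by (intro test_fun_nonneg) auto
    ultimately show ?thesis by simp
  qed
  have int: "integrable \<nu> (\<lambda>t. \<phi> a t * t ^ n)" for n
  proof (rule integrable_const_bound[where B="1 / (1 - a) ^ 3 * 1"])
    show "AE t in \<nu>. norm (\<phi> a t * t ^ n) \<le> 1 / (1 - a) ^ 3 * 1"
      using AE_weight
    proof eventually_elim
      case (elim t)
      show ?case unfolding norm_mult
        using bd[OF elim] elim a by (intro mult_mono) (auto intro: power_le_one)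
    qed
  qed simp
  show "integrable \<nu> (\<lambda>t. \<phi> a t * t ^ n)" by (rule int)
  have "integrable \<nu> (\<lambda>t. c * (\<phi> a t * t ^ 0))" by (intro integrable_mult_right int)
  hence "complex_integrable \<nu> (\<lambda>t. complex_of_real (c * (\<phi> a t * t ^ 0)))"
    by (simp only: complex_of_real_integrable_eq)
  hence "complex_integrable \<nu> (\<lambda>t. complex_of_real (c * \<phi> a t))" by (simp only: power_0 mult_1_right)
  thus "integrable \<nu> (restr g)"
  proof (rule Bochner_Integration.integrable_bound)
    show "AE t in \<nu>. norm (restr g t) \<le> norm (complex_of_real (c * \<phi> a t))"
      unfolding eq by (intro AE_I2) (auto split: split_indicator)
  qed (use m in \<open>simp add: measurable_cong_sets[OF sets_weight refl]\<close>)
  have "(\<integral>t. restr g t * of_real t ^ n \<partial>\<nu>) = (\<integral>t. complex_of_real (c * (\<phi> a t * t ^ n)) \<partial>\<nu>)"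
  proof (rule integral_cong_AE)
    have "(\<lambda>t. restr g t * of_real t ^ n) \<in> borel_measurable borel" using m by measurable
    thus "(\<lambda>t. restr g t * of_real t ^ n) \<in> borel_measurable \<nu>"
      by (simp add: measurable_cong_sets[OF sets_weight refl])
    show "AE t in \<nu>. restr g t * of_real t ^ n = complex_of_real (c * (\<phi> a t * t ^ n))"
      using AE_weight by eventually_elim (simp add: eq)
  qed simp
  also have "\<dots> = of_real (\<integral>t. c * (\<phi> a t * t ^ n) \<partial>\<nu>)" by (rule integral_complex_of_real)
  finally show "op_coeff g n = of_real (\<kappa> n * (c * (\<integral>t. \<phi> a t * t ^ n \<partial>\<nu>)))"
    by (simp add: op_coeff_def)
qed

text \<open>The coefficient bound that boundedness yields for the test function with \<open>a = 1 - 1 / N\<close>.\<close>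

definition test_bound :: "real \<Rightarrow> bool" where
  "test_bound B \<longleftrightarrow> (\<forall>N\<ge>1. \<forall>A. finite A \<longrightarrow>
     (\<Sum>n\<in>A. real N * m (3 * N + n) / (real (n + 1) ^ 2 * m (2 * n + 1))) \<le> B)"

text \<open>The image has nonnegative coefficients q n, so its maximum modulus is at least its value
  at r and integrating gives the sum of q n / (n + 1). The pointwise bound \<phi> a t >= N t^(3N)
  turns q n into a moment of order 3 N + n. The factor 2 is the one in the denominator of
  \<kappa>.\<close>

lemma test_bound_if_norm_le:
  assumes c: "c > 0" and B: "B \<ge> 0"
    and le: "\<And>a. 0 \<le> a \<Longrightarrow> a < 1 \<Longrightarrow> \<exists>g G. (\<forall>t\<in>{0..<1}. g t = of_real (c * \<phi> a t)) \<and> kernel_op \<omega> g = Some G \<and> norm_Hinf1 G \<le> ennreal B"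
  shows "test_bound (2 * B / c)"
  unfolding test_bound_def
proof (intro allI impI)
  fix N :: nat and A :: "nat set" assume N: "1 \<le> N" and A: "finite A"
  define a where "a = 1 - 1 / real N"
  have a: "0 \<le> a" "a < 1" using N by (auto simp: a_def)
  obtain g G where g: "\<And>t. t \<in> {0..<1} \<Longrightarrow> g t = of_real (c * \<phi> a t)" and G: "kernel_op \<omega> g = Some G"
    and GB: "norm_Hinf1 G \<le> ennreal B" using le[OF a] by blast
  note rt = restr_test_fun[OF a g]
  define q where "q n = \<kappa> n * (c * (\<integral>t. \<phi> a t * t ^ n \<partial>\<nu>))" for n
  have hol: "G holomorphic_on ball 0 1" and sums: "\<And>z. norm z < 1 \<Longrightarrow> (\<lambda>n. op_coeff g n * z ^ n) sums G z"
    by (rule kernel_op_eq[OF rt(2)]; use G in simp)+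
  have q_ge: "\<kappa> n * (c * (real N * m (3 * N + n))) \<le> q n" for n
  proof -
    have "real N * m (3 * N + n) = (\<integral>t. real N * t ^ (3 * N + n) \<partial>\<nu>)" by (simp add: m_def)
    also have "\<dots> \<le> (\<integral>t. \<phi> a t * t ^ n \<partial>\<nu>)"
    proof (rule integral_mono_AE)
      show "AE t in \<nu>. real N * t ^ (3 * N + n) \<le> \<phi> a t * t ^ n"
        using AE_weight
      proof eventually_elim
        case (elim t)
        have "real N * t ^ (3 * N) \<le> \<phi> a t"
          unfolding \<phi>_def using elim N by (intro test_fun_ge_power) (auto simp: a_def)
        hence "real N * t ^ (3 * N) * t ^ n \<le> \<phi> a t * t ^ n" using elim by (intro mult_right_mono) auto
        thus ?case by (simp add: power_add mult.assoc)
      qed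
    qed (intro integrable_mult_right integrable_power rt(4))+
    finally show ?thesis unfolding q_def using c \<kappa>_pos[of n] by (intro mult_left_mono) auto
  qed
  have q0: "0 \<le> q n" for n
    by (rule order.trans[OF _ q_ge]) (use c \<kappa>_pos[of n] in \<open>auto intro!: mult_nonneg_nonneg\<close>)
  have "(\<Sum>n. ennreal (q n / real (n + 1))) = (\<integral>\<^sup>+r\<in>{0..<1}. (\<Sum>n. ennreal (q n * r ^ n)) \<partial>lborel)"
    by (rule nn_integral_powser_01[symmetric]) (rule q0)
  also have "\<dots> \<le> norm_Hinf1 G"
    unfolding norm_Hinf1_def
  proof (intro nn_integral_mono)
    fix r :: real
    show "(\<Sum>n. ennreal (q n * r ^ n)) * indicator {0..<1} r \<le> ennreal (M_inf r G) * indicator {0..<1} r"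
    proof (cases "r \<in> {0..<1}")
      case True
      have "(\<lambda>n. op_coeff g n * of_real r ^ n) sums G (of_real r)" using True by (intro sums) auto
      moreover have "op_coeff g n = of_real (q n)" for n unfolding q_def by (rule rt(3))
      ultimately have s: "(\<lambda>n. complex_of_real (q n * r ^ n)) sums G (of_real r)" by simp
      hence sr: "(\<lambda>n. q n * r ^ n) sums Re (G (of_real r))" using sums_Re by fastforce
      have "(\<Sum>n. ennreal (q n * r ^ n)) = ennreal (\<Sum>n. q n * r ^ n)"
        using sr True q0 by (intro suminf_ennreal_norm) (auto simp: sums_iff)
      also have "(\<Sum>n. q n * r ^ n) = Re (G (of_real r))" using sr by (simp add: sums_iff)
      also have "\<dots> \<le> norm (G (of_real r))" by (rule complex_Re_le_cmod)
      also have "\<dots> \<le> M_inf r G" using norm_le_M_inf[OF hol, of "of_real r"] True by simp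
      finally show ?thesis using True by (simp add: ennreal_leI)
    qed simp
  qed
  also note GB
  finally have total: "(\<Sum>n. ennreal (q n / real (n + 1))) \<le> ennreal B" .
  have "ennreal (\<Sum>n\<in>A. q n / real (n + 1)) = (\<Sum>n\<in>A. ennreal (q n / real (n + 1)))"
    using q0 by (simp add: sum_ennreal)
  also have "\<dots> \<le> (\<Sum>n. ennreal (q n / real (n + 1)))" using A by (intro sum_le_suminf) auto
  finally have qB: "(\<Sum>n\<in>A. q n / real (n + 1)) \<le> B" using total B by (meson ennreal_le_iff order.trans)
  have "c / 2 * (\<Sum>n\<in>A. real N * m (3 * N + n) / (real (n + 1) ^ 2 * m (2 * n + 1))) =
      (\<Sum>n\<in>A. \<kappa> n * (c * (real N * m (3 * N + n))) / real (n + 1))"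
    unfolding sum_distrib_left
    by (intro sum.cong refl) (simp add: \<kappa>_def power2_eq_square algebra_simps)
  also have "\<dots> \<le> (\<Sum>n\<in>A. q n / real (n + 1))" by (intro sum_mono divide_right_mono q_ge) auto
  also note qB
  finally show "(\<Sum>n\<in>A. real N * m (3 * N + n) / (real (n + 1) ^ 2 * m (2 * n + 1))) \<le> 2 * B / c"
    using c by (simp add: field_simps)
qed

text \<open>In the window 12 N <= n < 13 N one has 3 N + n <= 16 N and 2 n + 1 >= 24 N, so each of
  its N terms is at least a multiple of m(16 N) / (N m(24 N)). The constant 338 exceeds 13^2, which
  bounds (n + 1)^2 / N^2. The result raises the order by the factor 3/2 and is then
  iterated.\<close>

lemma moment_doubling_if_test_bound:
  assumes T: "test_bound B"
  shows "\<exists>C>1. \<forall>n\<ge>1. m n \<le> C * m (2 * n)"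
proof -
  have B0: "0 \<le> B" using T[unfolded test_bound_def, rule_format, of 1 "{}"] by simp
  define D where "D = 338 * B + 1"
  have D1: "D \<ge> 1" using B0 by (simp add: D_def)
  have base: "m (16 * N) \<le> D * m (24 * N)" if N: "N \<ge> 1" for N
  proof -
    define e where "e = m (16 * N) / (338 * m (24 * N)) / real N"
    have "m (16 * N) / (338 * m (24 * N)) = (\<Sum>n\<in>{12 * N..<13 * N}. e)"
      using N by (simp add: e_def)
    also have "\<dots> \<le> (\<Sum>n\<in>{12 * N..<13 * N}. real N * m (3 * N + n) / (real (n + 1) ^ 2 * m (2 * n + 1)))"
    proof (intro sum_mono)
      fix n assume n: "n \<in> {12 * N..<13 * N}"
      have "n + 1 \<le> 13 * N" using n by simp
      hence "real (n + 1) \<le> real (13 * N)" by (simp only: of_nat_le_iff)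
      hence "real (n + 1) ^ 2 \<le> (13 * real N) ^ 2" by (intro power_mono) auto
      hence "real (n + 1) ^ 2 * m (2 * n + 1) \<le> (13 * real N) ^ 2 * m (24 * N)"
        using n by (intro mult_mono m_antimono) auto
      also have "\<dots> \<le> 338 * (real N) ^ 2 * m (24 * N)" by (intro mult_right_mono) (auto simp: power_mult_distrib)
      finally have "real N * m (16 * N) / (338 * (real N) ^ 2 * m (24 * N)) \<le> real N * m (3 * N + n) / (real (n + 1) ^ 2 * m (2 * n + 1))"
        using n N m_pos by (intro frac_le mult_left_mono m_antimono mult_pos_pos mult_nonneg_nonneg) auto
      thus "e \<le> real N * m (3 * N + n) / (real (n + 1) ^ 2 * m (2 * n + 1))"
        using N by (simp add: e_def power2_eq_square mult_ac)
    qed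
    also have "\<dots> \<le> B" using T N unfolding test_bound_def by blast
    finally have "m (16 * N) \<le> 338 * B * m (24 * N)" using m_pos[of "24 * N"] by (simp add: field_simps)
    also have "\<dots> \<le> D * m (24 * N)" by (intro mult_right_mono) (auto simp: D_def)
    finally show ?thesis .
  qed
  \<comment> \<open>Rounding n down to a multiple of 16 spoils the factor 3/2: s n >= (6 n - 90) /
    4, which is at least 5 n / 4 from n = 90 on. Four steps suffice, because (5/4)^4 > 2.\<close>
  define s where "s n = 24 * (n div 16)" for n :: nat
  have st: "m n \<le> D * m (s n) \<and> 5 * n \<le> 4 * s n \<and> 90 \<le> s n" if "n \<ge> 90" for n
  proof (intro conjI)
    have "m n \<le> m (16 * (n div 16))" by (rule m_antimono) simp
    also have "\<dots> \<le> D * m (24 * (n div 16))" by (rule base) (use that in linarith)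
    finally show "m n \<le> D * m (s n)" by (simp add: s_def)
    show "5 * n \<le> 4 * s n" "90 \<le> s n" using that unfolding s_def by linarith+
  qed
  have big: "m n \<le> D ^ 4 * m (2 * n)" if n: "n \<ge> 90" for n
  proof -
    note s1 = st[OF n] note s2 = st[OF s1[THEN conjunct2, THEN conjunct2]]
    note s3 = st[OF s2[THEN conjunct2, THEN conjunct2]] note s4 = st[OF s3[THEN conjunct2, THEN conjunct2]]
    have "m n \<le> D * m (s n)" using s1 by blast
    also have "\<dots> \<le> D * (D * m (s (s n)))" using s2 D1 by (intro mult_left_mono) auto
    also have "\<dots> \<le> D * (D * (D * m (s (s (s n)))))" using s3 D1 by (intro mult_left_mono) auto
    also have "\<dots> \<le> D * (D * (D * (D * m (s (s (s (s n)))))))" using s4 D1 by (intro mult_left_mono) auto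
    also have "\<dots> \<le> D * (D * (D * (D * m (2 * n))))"
    proof (intro mult_left_mono m_antimono)
      show "2 * n \<le> s (s (s (s n)))" using s1 s2 s3 s4 by linarith
    qed (use D1 in auto)
    finally show ?thesis by (simp add: eval_nat_numeral mult_ac)
  qed
  \<comment> \<open>The quotient m 0 / m 180 handles n < 90, where 2 n < 180.\<close>
  define C where "C = max 2 (max (D ^ 4) (m 0 / m 180))"
  have "m n \<le> C * m (2 * n)" for n
  proof (cases "n \<ge> 90")
    case True
    have "D ^ 4 * m (2 * n) \<le> C * m (2 * n)" by (intro mult_right_mono) (auto simp: C_def)
    thus ?thesis using big[OF True] by simp
  next
    case False
    have "m n \<le> m 0" by (rule m_antimono) simp
    also have "\<dots> = m 0 / m 180 * m 180" using m_pos[of 180] by simp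
    also have "\<dots> \<le> C * m (2 * n)" using False by (intro mult_mono m_antimono) (auto simp: C_def)
    finally show ?thesis .
  qed
  thus ?thesis by (intro exI[of _ C]) (auto simp: C_def)
qed

text \<open>The terms k <= N have m(3 N + k) >= m(4 N) and m(2 k + 1) <= m(2 k), which gives the sum
  in \<open>M1\<close> with m(4 N) in front; the doubling just obtained replaces it by m(2
  N).\<close>

theorem Dhat_and_M1_finite_if_test_bound:
  assumes T: "test_bound B"
  shows "\<omega> \<in> Dhat" "M1 \<omega> < \<infinity>"
proof -
  obtain C where C: "C > 1" "\<And>n. n \<ge> 1 \<Longrightarrow> m n \<le> C * m (2 * n)"
    using moment_doubling_if_test_bound[OF T] by blast
  show "\<omega> \<in> Dhat" by (rule Dhat_if_moment_doubling[OF C(2,1)])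
  have "real (N + 1) * m (2 * N) * M1_sum N \<le> 2 * C * B" if N: "N \<ge> 1" for N
  proof -
    have t: "real N * m (4 * N) * M1_sum N \<le> B"
    proof -
      have "real N * m (4 * N) * M1_sum N = (\<Sum>k\<in>{0..N}. real N * m (4 * N) * (1 / (real (k + 1) ^ 2 * m (2 * k))))"
        by (simp add: M1_sum_def sum_distrib_left)
      also have "\<dots> \<le> (\<Sum>k\<in>{0..N}. real N * m (3 * N + k) / (real (k + 1) ^ 2 * m (2 * k + 1)))"
      proof (intro sum_mono)
        fix k assume "k \<in> {0..N}"
        hence "real N * m (4 * N) / (real (k + 1) ^ 2 * m (2 * k)) \<le> real N * m (3 * N + k) / (real (k + 1) ^ 2 * m (2 * k + 1))"
          using m_pos by (intro frac_le mult_left_mono m_antimono mult_pos_pos mult_nonneg_nonneg) auto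
        thus "real N * m (4 * N) * (1 / (real (k + 1) ^ 2 * m (2 * k))) \<le> real N * m (3 * N + k) / (real (k + 1) ^ 2 * m (2 * k + 1))"
          by simp
      qed
      also have "\<dots> \<le> B" using T N unfolding test_bound_def by blast
      finally show ?thesis .
    qed
    have "real (N + 1) * m (2 * N) * M1_sum N \<le> (2 * real N) * (C * m (2 * (2 * N))) * M1_sum N"
      using N C(1) by (intro mult_right_mono mult_mono C(2) M1_sum_nonneg) auto
    also have "\<dots> = 2 * C * (real N * m (4 * N) * M1_sum N)" by simp
    also have "\<dots> \<le> 2 * C * B" using t C(1) by (intro mult_left_mono) auto
    finally show ?thesis .
  qed
  thus "M1 \<omega> < \<infinity>" unfolding M1_finite_iff by blast
qed

text \<open>Transport from the measure on the disc, a push-forward of a Lebesgue density, to \<nu>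
  and J. The cut-offs are needed because f is Borel only on the disc.\<close>

lemma nn_integral_mu_weight:
  assumes f: "f holomorphic_on ball 0 1"
  shows "(\<integral>\<^sup>+z. ennreal (norm (f z)) \<partial>mu_weight \<omega>) = (\<integral>\<^sup>+t\<in>{0..<1}. ennreal (norm (f (of_real t))) * J t \<partial>\<nu>)"
proof -
  have fm: "(\<lambda>t. ennreal (norm (f (of_real t))) * indicator {0..<1} t) \<in> borel_measurable borel"
  proof -
    have "(\<lambda>t. ennreal (norm (f (of_real t))) * indicator (ball 0 1) (complex_of_real t)) \<in> borel_measurable borel"
      by (rule measurable_compose[OF _ borel_measurable_norm_indicator_ball[OF f]]) simp
    hence "(\<lambda>t. ennreal (norm (f (of_real t))) * indicator (ball 0 1) (complex_of_real t) * indicator {0..<1} t) \<in> borel_measurable borel"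
      by measurable
    also have "(\<lambda>t. ennreal (norm (f (of_real t))) * indicator (ball 0 1) (complex_of_real t) * indicator {0..<1} t)
      = (\<lambda>t::real. ennreal (norm (f (of_real t))) * indicator {0..<1} t)"
      by (auto split: split_indicator)
    finally show ?thesis .
  qed
  let ?R = "restrict_space lebesgue {0..<1::real}"
  have fb: "(\<lambda>z. ennreal (norm (f z))) \<in> borel_measurable (restrict_space borel (ball 0 1))"
    using borel_measurable_norm_indicator_ball[OF f] by (subst borel_measurable_restrict_space_iff_ennreal) auto
  have T: "complex_of_real \<in> measurable ?R (restrict_space borel (ball 0 1))"
  proof (rule measurable_restrict_space2)
    show "complex_of_real \<in> borel_measurable ?R"
      by (intro measurable_restrict_space1 measurable_completion) simp
  qed (auto simp: space_restrict_space)
  have Jl: "J \<in> borel_measurable lebesgue" by (rule measurable_completion) simp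
  have dm: "(\<lambda>t. ennreal (\<omega> t * I t)) \<in> borel_measurable ?R"
  proof (subst borel_measurable_restrict_space_iff_ennreal)
    have "(\<lambda>t. ennreal (indicator {0..<1} t * \<omega> t) * J t) \<in> borel_measurable lebesgue"
      by (intro borel_measurable_times_ennreal measurable_compose[OF weight_measurable] Jl) simp_all
    also have "(\<lambda>t. ennreal (indicator {0..<1} t * \<omega> t) * J t) = (\<lambda>t. ennreal (\<omega> t * I t) * indicator {0..<1} t)"
      by (auto simp: J_eq ennreal_mult inv_tail_int_nonneg nonneg split: split_indicator)
    finally show "(\<lambda>t. ennreal (\<omega> t * I t) * indicator {0..<1} t) \<in> borel_measurable lebesgue" .
  qed auto
  have "(\<integral>\<^sup>+z. ennreal (norm (f z)) \<partial>mu_weight \<omega>)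
      = (\<integral>\<^sup>+t. ennreal (norm (f (of_real t))) \<partial>density ?R (\<lambda>t. ennreal (\<omega> t * I t)))"
    unfolding mu_weight_def using T fb by (subst nn_integral_distr) auto
  also have "\<dots> = (\<integral>\<^sup>+t. ennreal (\<omega> t * I t) * ennreal (norm (f (of_real t))) \<partial>?R)"
    using dm measurable_compose[OF T fb] by (intro nn_integral_density) auto
  also have "\<dots> = (\<integral>\<^sup>+t\<in>{0..<1}. ennreal (\<omega> t * I t) * ennreal (norm (f (of_real t))) \<partial>lebesgue)"
    by (subst nn_integral_restrict_space) auto
  also have "\<dots> = (\<integral>\<^sup>+t\<in>{0..<1}. (ennreal (norm (f (of_real t))) * indicator {0..<1} t) * ennreal (\<omega> t * I t) \<partial>lebesgue)"
    by (intro nn_integral_cong) (auto simp: mult_ac split: split_indicator)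
  also have "\<dots> = (\<integral>\<^sup>+t\<in>{0..<1}. (ennreal (norm (f (of_real t))) * indicator {0..<1} t) * J t \<partial>\<nu>)"
    by (rule nn_integral_mu) (use fm in auto)
  also have "\<dots> = (\<integral>\<^sup>+t\<in>{0..<1}. ennreal (norm (f (of_real t))) * J t \<partial>\<nu>)"
    by (intro nn_integral_cong) (auto split: split_indicator)
  finally show ?thesis .
qed

lemma mu_weight_measurable:
  assumes f: "f holomorphic_on ball 0 1"
  shows "f \<in> borel_measurable (mu_weight \<omega>)"
proof -
  have "f \<in> borel_measurable (restrict_space borel (ball 0 1))"
    by (intro borel_measurable_continuous_on_restrict holomorphic_on_imp_continuous_on f)
  thus ?thesis by (simp add: mu_weight_def)
qed

end

section \<open>The equivalences\<close>

text \<open>The four norms form a chain: \<open>norm_Hinf1\<close> <= \<open>norm_HL1\<close> <= 4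
  \<open>norm_H1\<close> <= 8 \<open>norm_D10\<close>. The constant 8 serves every choice.\<close>

lemma norm_space_embeddings:
  assumes NX: "NX \<in> {norm_Hinf1, norm_H1, norm_D10, norm_HL1}" and f: "f holomorphic_on ball 0 1"
  shows "norm_Hinf1 f \<le> 8 * NX f" "NX f \<le> 8 * norm_D10 f"
proof -
  note e1 = norm_Hinf1_le_norm_HL1[OF f] and e2 = norm_HL1_le_norm_H1[OF f] and e3 = norm_H1_le_norm_D10[OF f]
  have e13: "norm_HL1 f \<le> 8 * norm_D10 f"
    using order.trans[OF e2 mult_left_mono[OF e3, of 4]] by (simp add: mult.assoc[symmetric])
  have le: "x \<le> 8 * x" "2 * x \<le> 8 * x" "4 * x \<le> 8 * x" for x :: ennreal
    using mult_right_mono[of 1 8 x] mult_right_mono[of 2 8 x] mult_right_mono[of 4 8 x] by simp_all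
  show "norm_Hinf1 f \<le> 8 * NX f"
    using NX e1 order.trans[OF e1 e2] order.trans[OF e1 e13] le by (auto intro: order.trans)
  show "NX f \<le> 8 * norm_D10 f"
    using NX e3 e13 order.trans[OF e1 e13] le by (auto intro: order.trans)
qed

lemma norm_D10_cmult_le:
  assumes f: "f holomorphic_on ball 0 1" and c: "0 \<le> c"
  shows "norm_D10 (\<lambda>z. of_real c * f z) \<le> ennreal c * norm_D10 f"
proof -
  have "(\<integral>\<^sup>+z\<in>ball 0 1. ennreal (norm (deriv (\<lambda>z. of_real c * f z) z)) \<partial>lborel) =
      (\<integral>\<^sup>+z. ennreal c * (ennreal (norm (deriv f z)) * indicator (ball 0 1) z) \<partial>lborel)"
  proof (intro nn_integral_cong)
    fix z :: complex
    show "ennreal (norm (deriv (\<lambda>z. of_real c * f z) z)) * indicator (ball 0 1) z =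
      ennreal c * (ennreal (norm (deriv f z)) * indicator (ball 0 1) z)"
    proof (cases "z \<in> ball 0 1")
      case True
      hence "deriv (\<lambda>z. of_real c * f z) z = of_real c * deriv f z"
        using f by (intro deriv_cmult holomorphic_on_imp_differentiable_at[OF f]) auto
      thus ?thesis using c by (simp add: norm_mult ennreal_mult mult.assoc)
    qed simp
  qed
  also have "\<dots> = ennreal c * (\<integral>\<^sup>+z\<in>ball 0 1. ennreal (norm (deriv f z)) \<partial>lborel)"
  proof (rule nn_integral_cmult)
    have "deriv f holomorphic_on ball 0 1" using f by (rule holomorphic_deriv) simp
    thus "(\<lambda>z. ennreal (norm (deriv f z)) * indicator (ball 0 1) z) \<in> borel_measurable lborel"
      using borel_measurable_norm_indicator_ball by simp
  qed
  finally have "norm_D10 (\<lambda>z. of_real c * f z) = ennreal c * norm_D10 f"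
    using c by (simp add: norm_D10_def norm_mult ennreal_mult distrib_left mult.left_commute)
  thus ?thesis by simp
qed

text \<open>The factor 1/32 normalises in all four spaces: the test function has
  \<open>norm_D10\<close> at most 4, and the embedding constant is 8.\<close>

definition scaled_test_fun :: "real \<Rightarrow> complex \<Rightarrow> complex" where
  "scaled_test_fun a z = of_real (1 / 32) * test_fun a z"

lemma scaled_test_fun:
  assumes a: "0 \<le> a" "a < 1" and NX: "NX \<in> {norm_Hinf1, norm_H1, norm_D10, norm_HL1}"
  shows "scaled_test_fun a holomorphic_on ball 0 1" "NX (scaled_test_fun a) \<le> 1"
proof -
  show h: "scaled_test_fun a holomorphic_on ball 0 1"
    unfolding scaled_test_fun_def by (intro holomorphic_intros holomorphic_test_fun a)
  have "norm_D10 (scaled_test_fun a) \<le> ennreal (1 / 32) * norm_D10 (test_fun a)"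
    unfolding scaled_test_fun_def[abs_def] by (intro norm_D10_cmult_le holomorphic_test_fun a) simp
  also have "\<dots> \<le> ennreal (1 / 32) * ennreal 4"
    using norm_D10_test_fun_le[OF a] by (intro mult_left_mono) auto
  also have "\<dots> = ennreal (1 / 8)" by (subst ennreal_mult[symmetric]) auto
  finally have D: "norm_D10 (scaled_test_fun a) \<le> ennreal (1 / 8)" .
  have "NX (scaled_test_fun a) \<le> 8 * norm_D10 (scaled_test_fun a)"
    by (rule norm_space_embeddings(2)[OF NX h])
  also have "\<dots> \<le> ennreal 8 * ennreal (1 / 8)" using D by (intro mult_mono) auto
  also have "\<dots> = 1" by (subst ennreal_mult[symmetric]) auto
  finally show "NX (scaled_test_fun a) \<le> 1" .
qed

context weight
begin

lemma scaled_test_fun_of_real: "scaled_test_fun a (of_real t) = of_real (1 / 32 * \<phi> a t)"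
  by (simp add: scaled_test_fun_def test_fun_def \<phi>_def)

lemma \<phi>_nonneg: "0 \<le> a \<Longrightarrow> a < 1 \<Longrightarrow> 0 \<le> t \<Longrightarrow> t < 1 \<Longrightarrow> 0 \<le> \<phi> a t"
  unfolding \<phi>_def by (rule test_fun_nonneg)

lemma restr_measurable:
  assumes "f holomorphic_on ball 0 1"
  shows "restr (\<lambda>t. f (of_real t)) \<in> borel_measurable borel"
proof -
  have "continuous_on {0..<1} (\<lambda>t. f (complex_of_real t))"
    by (rule continuous_on_compose2[OF holomorphic_on_imp_continuous_on[OF assms]]) (auto intro!: continuous_intros)
  thus ?thesis unfolding restr_def by (intro borel_measurable_continuous_on_indicator) auto
qed

lemma restr_norm_measurable:
  assumes "f holomorphic_on ball 0 1"
  shows "restr (\<lambda>t. of_real (norm (f (of_real t)))) \<in> borel_measurable borel"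
proof -
  have "(\<lambda>t. complex_of_real (norm (restr (\<lambda>t. f (of_real t)) t))) \<in> borel_measurable borel"
    using restr_measurable[OF assms] by measurable
  moreover have "(\<lambda>t. complex_of_real (norm (restr (\<lambda>t. f (of_real t)) t))) = restr (\<lambda>t. of_real (norm (f (of_real t))))"
    by (auto simp: restr_def split: split_indicator)
  ultimately show ?thesis by simp
qed

section \<open>Boundedness and the Carleson property for all choices of spaces\<close>

lemma bounded_op_if_parts_bound:
  assumes NX: "NX \<in> {norm_Hinf1, norm_H1, norm_D10, norm_HL1}" and NY: "NY \<in> {norm_Hinf1, norm_H1, norm_D10, norm_HL1}"
    and T: "T \<in> {H_op \<omega>, H_tilde_op \<omega>}" and D: "\<omega> \<in> Dhat" and M: "parts_bound M"
  shows "bounded_op T (H_space NX) NX (H_space NY) NY"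
proof -
  obtain C where C: "doubling C" using D Dhat_iff by blast
  obtain K where K: "K \<ge> 0" "\<forall>f g. f holomorphic_on ball 0 1 \<longrightarrow> norm_Hinf1 f < \<infinity> \<longrightarrow> restr g \<in> borel_measurable borel \<longrightarrow>
    (\<forall>t\<in>{0..<1}. norm (g t) = norm (f (of_real t))) \<longrightarrow>
    (\<exists>G. kernel_op \<omega> g = Some G \<and> G holomorphic_on ball 0 1 \<and> norm_D10 G \<le> ennreal K * norm_Hinf1 f)"
    using kernel_op_bounded[OF C M] by (elim exE conjE)
  have main: "\<exists>G. T f = Some G \<and> G \<in> H_space NY \<and> NY G \<le> ennreal (64 * K) * NX f" if f: "f \<in> H_space NX" for f
  proof -
    have fh: "f holomorphic_on ball 0 1" and fX: "NX f < \<infinity>" using f by (auto simp: H_space_def)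
    have i: "norm_Hinf1 f \<le> 8 * NX f" by (rule norm_space_embeddings(1)[OF NX fh])
    have fi: "norm_Hinf1 f < \<infinity>" by (rule le_less_trans[OF i]) (use fX in \<open>simp add: ennreal_mult_less_top\<close>)
    have "\<exists>G. T f = Some G \<and> G holomorphic_on ball 0 1 \<and> norm_D10 G \<le> ennreal K * norm_Hinf1 f"
      using T
    proof (elim insertE emptyE)
      assume "T = H_op \<omega>"
      thus ?thesis using K(2)[rule_format, OF fh fi restr_measurable[OF fh]] by (simp add: H_op_def)
    next
      assume "T = H_tilde_op \<omega>"
      thus ?thesis using K(2)[rule_format, OF fh fi restr_norm_measurable[OF fh]] by (simp add: H_tilde_op_def)
    qed
    then obtain G where G: "T f = Some G" "G holomorphic_on ball 0 1" "norm_D10 G \<le> ennreal K * norm_Hinf1 f" by blast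
    have "NY G \<le> 8 * norm_D10 G" by (rule norm_space_embeddings(2)[OF NY G(2)])
    also have "\<dots> \<le> 8 * (ennreal K * (8 * NX f))"
      using order.trans[OF G(3) mult_left_mono[OF i]] by (intro mult_left_mono) auto
    also have "\<dots> = ennreal (64 * K) * NX f"
    proof -
      have "ennreal (64 * K) = 64 * ennreal K" using K(1) by (simp add: ennreal_mult)
      thus ?thesis by (simp add: mult_ac flip: mult.assoc)
    qed
    finally have YG: "NY G \<le> ennreal (64 * K) * NX f" .
    also have "\<dots> < \<infinity>" using fX by (simp add: ennreal_mult_less_top)
    finally show ?thesis using G YG by (auto simp: H_space_def)
  qed
  have "(SUP f\<in>{f \<in> H_space NX. NX f \<le> 1}. NY (the (T f))) \<le> ennreal (64 * K)"
  proof (rule SUP_least)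
    fix f assume f: "f \<in> {f \<in> H_space NX. NX f \<le> 1}"
    then obtain G where "T f = Some G" "NY G \<le> ennreal (64 * K) * NX f" using main by blast
    moreover have "ennreal (64 * K) * NX f \<le> ennreal (64 * K) * 1" using f by (intro mult_left_mono) auto
    ultimately show "NY (the (T f)) \<le> ennreal (64 * K)" by simp
  qed
  hence "(SUP f\<in>{f \<in> H_space NX. NX f \<le> 1}. NY (the (T f))) < \<infinity>"
    by (rule le_less_trans) simp
  thus ?thesis unfolding bounded_op_def using main by blast
qed

lemma Dhat_and_M1_finite_if_bounded_op:
  assumes NX: "NX \<in> {norm_Hinf1, norm_H1, norm_D10, norm_HL1}" and NY: "NY \<in> {norm_Hinf1, norm_H1, norm_D10, norm_HL1}"
    and T: "T \<in> {H_op \<omega>, H_tilde_op \<omega>}" and bd: "bounded_op T (H_space NX) NX (H_space NY) NY"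
  shows "\<omega> \<in> Dhat \<and> M1 \<omega> < \<infinity>"
proof -
  have "(SUP f\<in>{f \<in> H_space NX. NX f \<le> 1}. NY (the (T f))) < \<infinity>" using bd by (simp add: bounded_op_def)
  then obtain B where B: "(SUP f\<in>{f \<in> H_space NX. NX f \<le> 1}. NY (the (T f))) = ennreal B" "B \<ge> 0"
    by (cases "SUP f\<in>{f \<in> H_space NX. NX f \<le> 1}. NY (the (T f))") auto
  \<comment> \<open>The factor 8 is the embedding of the target space into H(\<infinity>,1), and
    1/32 is the normalisation of the test function.\<close>
  have "test_bound (2 * (8 * B) / (1 / 32))"
  proof (rule test_bound_if_norm_le)
    fix a :: real assume a: "0 \<le> a" "a < 1"
    let ?f = "scaled_test_fun a"
    have f: "?f holomorphic_on ball 0 1" "NX ?f \<le> 1" using scaled_test_fun[OF a NX] by blast+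
    have fX: "?f \<in> H_space NX" using f by (auto simp: H_space_def intro: le_less_trans)
    then obtain G where G: "T ?f = Some G" "G \<in> H_space NY" using bd unfolding bounded_op_def by metis
    have Gh: "G holomorphic_on ball 0 1" using G by (simp add: H_space_def)
    have "NY (the (T ?f)) \<le> ennreal B" unfolding B(1)[symmetric] using fX f by (intro SUP_upper) auto
    hence "NY G \<le> ennreal B" by (simp add: G)
    hence "8 * NY G \<le> ennreal 8 * ennreal B" by (intro mult_mono) auto
    hence GB: "norm_Hinf1 G \<le> ennreal (8 * B)"
      using norm_space_embeddings(1)[OF NY Gh] B(2) by (simp add: ennreal_mult)
    from T show "\<exists>g G. (\<forall>t\<in>{0..<1}. g t = of_real (1 / 32 * \<phi> a t)) \<and> kernel_op \<omega> g = Some G \<and> norm_Hinf1 G \<le> ennreal (8 * B)"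
    proof (elim insertE emptyE)
      assume "T = H_op \<omega>"
      hence "kernel_op \<omega> (\<lambda>t. ?f (of_real t)) = Some G" using G by (simp add: H_op_def)
      thus ?thesis using GB
        by (intro exI[of _ "\<lambda>t. ?f (of_real t)"] exI[of _ G] conjI ballI scaled_test_fun_of_real)
    next
      assume "T = H_tilde_op \<omega>"
      hence "kernel_op \<omega> (\<lambda>t. of_real (norm (?f (of_real t)))) = Some G" using G by (simp add: H_tilde_op_def)
      moreover have "complex_of_real (norm (?f (of_real t))) = of_real (1 / 32 * \<phi> a t)" if "t \<in> {0..<1}" for t
      proof -
        have "0 \<le> 1 / 32 * \<phi> a t" using \<phi>_nonneg[of a t] a that by simp
        thus ?thesis by (simp only: scaled_test_fun_of_real norm_of_real abs_of_nonneg)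
      qed
      ultimately show ?thesis using GB
        by (intro exI[of _ "\<lambda>t. of_real (norm (?f (of_real t)))"] exI[of _ G] conjI ballI)
    qed
  qed (use B in auto)
  from Dhat_and_M1_finite_if_test_bound[OF this] show ?thesis ..
qed

lemma carleson1_if_parts_bound:
  assumes NX: "NX \<in> {norm_Hinf1, norm_H1, norm_D10, norm_HL1}" and M: "parts_bound M"
  shows "carleson1 (mu_weight \<omega>) NX"
proof -
  obtain c where c: "c \<ge> 0" "\<forall>f. f holomorphic_on ball 0 1 \<longrightarrow>
    (\<integral>\<^sup>+t\<in>{0..<1}. ennreal (norm (f (of_real t))) * J t \<partial>\<nu>) \<le> ennreal c * norm_Hinf1 f"
    using carleson_mu[OF M] by (elim exE conjE)
  have le: "(\<integral>\<^sup>+z. ennreal (norm (f z)) \<partial>mu_weight \<omega>) \<le> ennreal c * (8 * NX f)" if f: "f holomorphic_on ball 0 1" for f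
  proof -
    have "(\<integral>\<^sup>+z. ennreal (norm (f z)) \<partial>mu_weight \<omega>) \<le> ennreal c * norm_Hinf1 f"
      using c(2) f by (simp add: nn_integral_mu_weight)
    also have "\<dots> \<le> ennreal c * (8 * NX f)" by (intro mult_left_mono norm_space_embeddings(1)[OF NX f]) simp
    finally show ?thesis .
  qed
  have int: "integrable (mu_weight \<omega>) f" if f: "f \<in> H_space NX" for f
  proof (rule integrableI_bounded)
    have fh: "f holomorphic_on ball 0 1" and fX: "NX f < \<infinity>" using f by (auto simp: H_space_def)
    show "f \<in> borel_measurable (mu_weight \<omega>)" by (rule mu_weight_measurable[OF fh])
    show "(\<integral>\<^sup>+z. ennreal (norm (f z)) \<partial>mu_weight \<omega>) < \<infinity>"
      by (rule le_less_trans[OF le[OF fh]]) (use fX in \<open>simp add: ennreal_mult_less_top\<close>)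
  qed
  have "(SUP f\<in>{f \<in> H_space NX. NX f \<le> 1}. \<integral>\<^sup>+z. ennreal (norm (the (Some f) z)) \<partial>mu_weight \<omega>) \<le> ennreal c * (8 * 1)"
  proof (rule SUP_least)
    fix f assume f: "f \<in> {f \<in> H_space NX. NX f \<le> 1}"
    have "(\<integral>\<^sup>+z. ennreal (norm (the (Some f) z)) \<partial>mu_weight \<omega>) \<le> ennreal c * (8 * NX f)"
      using f le[of f] by (simp add: H_space_def)
    also have "\<dots> \<le> ennreal c * (8 * 1)" using f by (intro mult_left_mono) auto
    finally show "(\<integral>\<^sup>+z. ennreal (norm (the (Some f) z)) \<partial>mu_weight \<omega>) \<le> ennreal c * (8 * 1)" .
  qed
  also have "\<dots> < \<infinity>" by (simp add: ennreal_mult_less_top)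
  finally show ?thesis unfolding carleson1_def bounded_op_def using int by blast
qed

text \<open>The normalised test function is at least 1 / (64 (1 - a)) on [a,1), where 64 = 2 * 32,
  and J is at least J a there. Its integral against the measure therefore dominates W a * I a / (64
  (1 - a)).\<close>

lemma parts_bound_if_carleson1:
  assumes NX: "NX \<in> {norm_Hinf1, norm_H1, norm_D10, norm_HL1}" and car: "carleson1 (mu_weight \<omega>) NX"
  shows "\<exists>M. parts_bound M"
proof -
  define S where "S = (SUP f\<in>{f \<in> H_space NX. NX f \<le> 1}. \<integral>\<^sup>+z. ennreal (norm (the (Some f) z)) \<partial>mu_weight \<omega>)"
  have "S < \<infinity>" using car unfolding S_def carleson1_def bounded_op_def by blast
  then obtain B where B: "S = ennreal B" "B \<ge> 0" by (cases S) auto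
  have "W a * I a \<le> (64 * B) * (1 - a)" if a: "a \<in> {0..<1}" for a
  proof -
    have a': "0 \<le> a" "a < 1" using a by auto
    let ?f = "scaled_test_fun a"
    have f: "?f holomorphic_on ball 0 1" "NX ?f \<le> 1" using scaled_test_fun[OF a' NX] by blast+
    hence fX: "?f \<in> {f \<in> H_space NX. NX f \<le> 1}" by (auto simp: H_space_def intro: le_less_trans)
    have "ennreal (1 / (64 * (1 - a)) * (W a * I a)) = ennreal (1 / (64 * (1 - a))) * (J a * emeasure \<nu> {a..<1})"
    proof -
      have "ennreal (W a * I a) = J a * emeasure \<nu> {a..<1}"
        using a' J_eq[of a] by (simp add: emeasure_atLeastLessThan_1 ennreal_mult W_nonneg inv_tail_int_nonneg mult.commute)
      thus ?thesis using a' W_nonneg inv_tail_int_nonneg by (subst ennreal_mult) auto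
    qed
    also have "\<dots> = (\<integral>\<^sup>+t. (ennreal (1 / (64 * (1 - a))) * J a) * indicator {a..<1} t \<partial>\<nu>)"
      by (subst nn_integral_cmult_indicator) (simp_all add: mult.assoc)
    also have "\<dots> \<le> (\<integral>\<^sup>+t\<in>{0..<1}. ennreal (norm (?f (of_real t))) * J t \<partial>\<nu>)"
    proof (intro nn_integral_mono)
      fix t :: real
      show "(ennreal (1 / (64 * (1 - a))) * J a) * indicator {a..<1} t \<le> ennreal (norm (?f (of_real t))) * J t * indicator {0..<1} t"
      proof (cases "t \<in> {a..<1}")
        case True
        have "1 / (2 * (1 - a)) \<le> \<phi> a t" unfolding \<phi>_def using a' True by (intro test_fun_ge) auto
        hence "1 / (64 * (1 - a)) \<le> \<bar>1 / 32 * \<phi> a t\<bar>"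
          using mult_left_mono[of "1 / (2 * (1 - a))" "\<phi> a t" "1 / 32"] by simp
        hence "1 / (64 * (1 - a)) \<le> norm (?f (of_real t))"
          by (simp only: scaled_test_fun_of_real norm_of_real)
        hence "ennreal (1 / (64 * (1 - a))) * J a \<le> ennreal (norm (?f (of_real t))) * J t"
          using True by (intro mult_mono ennreal_leI J_mono) auto
        thus ?thesis using True a' by simp
      qed simp
    qed
    also have "\<dots> = (\<integral>\<^sup>+z. ennreal (norm (the (Some ?f) z)) \<partial>mu_weight \<omega>)"
      by (simp add: nn_integral_mu_weight[OF f(1)])
    also have "\<dots> \<le> ennreal B" unfolding B(1)[symmetric] S_def by (rule SUP_upper[OF fX])
    finally have "1 / (64 * (1 - a)) * (W a * I a) \<le> B" using B(2) by simp
    thus ?thesis using a' by (simp add: field_simps)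
  qed
  thus ?thesis unfolding parts_bound_def by blast
qed

end

theorem theorem2:
  fixes \<omega> :: "real \<Rightarrow> real"
    and X1 Y1 :: "(complex \<Rightarrow> complex) \<Rightarrow> ennreal"
    and T :: "(complex \<Rightarrow> complex) \<Rightarrow> (complex \<Rightarrow> complex) option"
  assumes "radial_weight \<omega>"
    and "X1 \<in> {norm_Hinf1, norm_H1, norm_D10, norm_HL1}"
    and "Y1 \<in> {norm_Hinf1, norm_H1, norm_D10, norm_HL1}"
    and "T \<in> {H_op \<omega>, H_tilde_op \<omega>}"
  shows "(bounded_op T (H_space X1) X1 (H_space Y1) Y1
            \<longleftrightarrow> \<omega> \<in> Dhat \<and> carleson1 (mu_weight \<omega>) X1)
       \<and> (\<omega> \<in> Dhat \<and> carleson1 (mu_weight \<omega>) X1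
            \<longleftrightarrow> \<omega> \<in> Dhat \<and> M1c \<omega> < \<infinity>)
       \<and> (\<omega> \<in> Dhat \<and> M1c \<omega> < \<infinity>
            \<longleftrightarrow> \<omega> \<in> Dreg \<and> M1c \<omega> < \<infinity>)
       \<and> (\<omega> \<in> Dreg \<and> M1c \<omega> < \<infinity>
            \<longleftrightarrow> \<omega> \<in> Dhat \<and> M1d \<omega> < \<infinity>)
       \<and> (\<omega> \<in> Dhat \<and> M1d \<omega> < \<infinity>
            \<longleftrightarrow> \<omega> \<in> Dhat \<and> M1 \<omega> < \<infinity>)"
proof -
  interpret weight \<omega> by unfold_locales fact
  define P where "P \<longleftrightarrow> \<omega> \<in> Dhat \<and> (\<exists>M. parts_bound M)"
  have M1P: "P" if "\<omega> \<in> Dhat \<and> M1 \<omega> < \<infinity>"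
    using that parts_bound_if_M1 unfolding P_def Dhat_iff M1_finite_iff by blast
  have i: "bounded_op T (H_space X1) X1 (H_space Y1) Y1 \<longleftrightarrow> P"
    using bounded_op_if_parts_bound[OF assms(2-4)] Dhat_and_M1_finite_if_bounded_op[OF assms(2-4)] M1P
    unfolding P_def by blast
  have ii: "\<omega> \<in> Dhat \<and> carleson1 (mu_weight \<omega>) X1 \<longleftrightarrow> P"
    using carleson1_if_parts_bound[OF assms(2)] parts_bound_if_carleson1[OF assms(2)] unfolding P_def by blast
  have iii: "\<omega> \<in> Dhat \<and> M1c \<omega> < \<infinity> \<longleftrightarrow> P" unfolding P_def M1c_finite_iff ..
  have iv: "\<omega> \<in> Dreg \<and> M1c \<omega> < \<infinity> \<longleftrightarrow> P"
    unfolding P_def M1c_finite_iff Dreg_def using Dcheck_if_parts_bound by blast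
  have v: "\<omega> \<in> Dhat \<and> M1d \<omega> < \<infinity> \<longleftrightarrow> P" unfolding P_def M1d_finite_iff ..
  \<comment> \<open>That P implies finiteness of \<open>M1\<close> is not proved by discretisation:
    P gives boundedness of the operator, and the test functions then give \<open>M1\<close>.\<close>
  have vi: "\<omega> \<in> Dhat \<and> M1 \<omega> < \<infinity> \<longleftrightarrow> P"
    using M1P i Dhat_and_M1_finite_if_bounded_op[OF assms(2-4)] by blast
  show ?thesis unfolding i ii iii iv v vi by blast
qed

end
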